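(* Let $m_i,r_i>0$ ($i=1,2$), $\omega>0$, $\beta>0$, let $F_i=(F_{i,x},F_{i,y})\in\mathbb{R}^2$ ($i=1,2$) be the forces associated with the imbalance, and let $\Phi_0=(\alpha_{0,1},\gamma_{0,1};\alpha_{0,2},\gamma_{0,2})\in\mathbb{T}^4$ be the initial configuration. Let $G$ be the imbalance indicator, $\hat G=G-\inf G$, $\mathscr{S}=\operatorname{argmin}(G)\subset\mathbb{T}^4$, $\mathscr{A}$ the set of admissible trajectories starting at $\Phi_0$, and $$J(\Phi)=\frac12\int_0^\infty\left[\|\dot\Phi\|^2+\beta\,\hat G(\Phi)\right]dt,\qquad \Phi\in\mathscr{A}$$ (all defined in the context). For $i=1,2$ set $$c^i=(c^i_1,c^i_2):=\frac{1}{2m_ir_i\omega^2}\,(F_{i,x},F_{i,y}).$$ Then: (1) There exists $\Phi\in\mathscr{A}$ minimizer of $J$. (2) Such a minimizer $\Phi=(\alpha_1,\gamma_1;\alpha_2,\gamma_2)$ is $C^\infty$ smooth and, for $i=1,2$, the following Euler-Lagrange equations are satisfied for $t>0$: $$\begin{cases}-\ddot\alpha_i=\beta\cos(\gamma_i)\left[-c^i_1\sin(\alpha_i)+c^i_2\cos(\alpha_i)\right]\\ -\ddot\gamma_i=-\beta\sin(\gamma_i)\left[c^i_1\cos(\alpha_i)+c^i_2\sin(\alpha_i)-\cos(\gamma_i)\right]\\ \alpha_i(0)=\alpha_{0,i},\quad \gamma_i(0)=\gamma_{0,i},\quad \dot\Phi(T)\to0\ \text{ as } T\to+\infty.\end{cases}$$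 (3) For any optimal trajectory $\Phi$ (i.e. any minimizer of $J$ over $\mathscr{A}$) there exists $\overline\Phi\in\mathscr{S}$ such that, as $t\to+\infty$, $$\Phi(t)\to\overline\Phi,\qquad \dot\Phi(t)\to0,\qquad |\hat G(\Phi(t))|\to0 .$$ If, in addition, $$m_1r_1>\frac{\sqrt{F_{1,x}^2+F_{1,y}^2}}{2\omega^2}\quad\text{and}\quad m_2r_2>\frac{\sqrt{F_{2,x}^2+F_{2,y}^2}}{2\omega^2},$$ then we have the exponential estimate, for any $t\ge0$, $$\|\Phi(t)-\overline\Phi\|+\|\dot\Phi(t)\|+|G(\Phi(t))|\le C e^{-\mu t},$$ with $C,\mu>0$ independent of $t$.
   Context: $\mathbb{T}=\mathbb{R}/2\pi\mathbb{Z}$; for points of $\mathbb{T}^n$, $\|\Phi-\Psi\|$ denotes the (quotient) Euclidean distance on the flat torus. $H^1_{loc}([0,+\infty);\mathbb{T}^n)$ is the set of maps $\Phi:[0,+\infty)\to\mathbb{T}^n$ belonging to $H^1((0,T);\mathbb{T}^n)$ for every $T>0$ (i.e. weakly differentiable with $\dot\Phi$ square integrable on $(0,T)$). Model: a rotor rotates about the $z$ axis at constant angular velocity $\omega$. Two balancing planes $z=-a$ and $z=b$ ($a,b\ge0$, $a+b>0$), numbered $i=1,2$, each carry two balancing masses of mass $m_i$ at distance $r_i$ from the axis, located at angles $\alpha_i\pm\gamma_i$. The imbalance is given by a force $(F_x,F_y,0)$ and a momentum $(N_x,N_y,0)$, equivalent to forces in the two planes $F_1=\frac1{a+b}(bF_x-N_y,\,bF_y+N_x)$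 and $F_2=\frac1{a+b}(aF_x+N_y,\,aF_y-N_x)$; write $F_i=(F_{i,x},F_{i,y})$. The imbalance indicator $G:\mathbb{T}^4\to\mathbb{R}$ is $G(\alpha_1,\gamma_1,\alpha_2,\gamma_2)=G_1(\alpha_1,\gamma_1)+G_2(\alpha_2,\gamma_2)$ with $$G_i(\alpha_i,\gamma_i)=\left|2m_ir_i\omega^2\cos\gamma_i\cos\alpha_i+F_{i,x}\right|^2+\left|2m_ir_i\omega^2\cos\gamma_i\sin\alpha_i+F_{i,y}\right|^2 .$$ $\hat G:=G-\inf G$ and $\mathscr{S}:=\operatorname{argmin}(G)$. The set of admissible trajectories is $$\mathscr{A}=\left\{\Phi\in H^1_{loc}([0,+\infty);\mathbb{T}^4)\ :\ \Phi(0)=\Phi_0,\ \tfrac12\left[\|\dot\Phi\|^2+\beta\hat G(\Phi)\right]\in L^1(0,+\infty)\right\}.$$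
   Formalization: The printed Euler-Lagrange system is not that of J (it fails e.g. for F=0, 2m_i r_i ω²=2); the proved system replaces c^i by -c^i in the right-hand sides and multiplies them by (2m_i r_i ω²)²; everything else is as stated. *)

theory Defs
  imports "HOL-Analysis.Analysis"
begin

section \<open>The circle and the flat torus\<close>

definition angle_rel :: "real \<Rightarrow> real \<Rightarrow> bool" where
  "angle_rel x y \<longleftrightarrow> (\<exists>k::int. x - y = 2 * pi * of_int k)"

lemma equivp_angle_rel: "equivp angle_rel"
proof (rule equivpI)
  show "reflp angle_rel"
    by (rule reflpI) (auto simp: angle_rel_def intro: exI[of _ 0])
  show "symp angle_rel"
  proof (rule sympI)
    fix x y assume "angle_rel x y"
    then obtain k :: int where "x - y = 2 * pi * of_int k" by (auto simp: angle_rel_def)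
    then have "y - x = 2 * pi * of_int (-k)" by simp
    then show "angle_rel y x" unfolding angle_rel_def by blast
  qed
  show "transp angle_rel"
  proof (rule transpI)
    fix x y z assume "angle_rel x y" "angle_rel y z"
    then obtain k l :: int where "x - y = 2 * pi * of_int k" "y - z = 2 * pi * of_int l"
      by (auto simp: angle_rel_def)
    then have "x - z = 2 * pi * of_int (k + l)" by (simp add: algebra_simps)
    then show "angle_rel x z" unfolding angle_rel_def by blast
  qed
qed

quotient_type angle = real / angle_rel
  morphisms rep_angle angle_of
  by (rule equivp_angle_rel)

lemma angle_of_eq_iff: "angle_of x = angle_of y \<longleftrightarrow> (\<exists>k::int. x - y = 2 * pi * of_int k)"
  using angle.abs_eq_iff[of x y] by (simp add: angle_rel_def)

lemma angle_of_surj: "\<exists>x. p = angle_of x"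
  by (metis Quotient3_abs_rep Quotient3_angle)

lift_definition cos_angle :: "angle \<Rightarrow> real" is "cos :: real \<Rightarrow> real"
proof -
  fix x y :: real assume "angle_rel x y"
  then obtain k :: int where "x - y = 2 * pi * of_int k" by (auto simp: angle_rel_def)
  then have "x = y + 2 * pi * of_int k" by simp
  then show "cos x = cos y"
    by (simp add: cos_add sin_int_2pin cos_int_2pin)
qed

lift_definition sin_angle :: "angle \<Rightarrow> real" is "sin :: real \<Rightarrow> real"
proof -
  fix x y :: real assume "angle_rel x y"
  then obtain k :: int where "x - y = 2 * pi * of_int k" by (auto simp: angle_rel_def)
  then have "x = y + 2 * pi * of_int k" by simp
  then show "sin x = sin y"
    by (simp add: sin_add sin_int_2pin cos_int_2pin)
qed

lemma cos_angle_of [simp]: "cos_angle (angle_of x) = cos x"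
  by (simp add: cos_angle.abs_eq)

lemma sin_angle_of [simp]: "sin_angle (angle_of x) = sin x"
  by (simp add: sin_angle.abs_eq)

text \<open>
  The circle carries the quotient distance.  The library's metric on finite Cartesian products
  then makes \<open>angle ^ 'n\<close> the flat torus with its quotient Euclidean distance; see
  \<open>dist_torus\<close> below.
\<close>

definition circle_dist :: "angle \<Rightarrow> angle \<Rightarrow> real" where
  "circle_dist p q = Inf {\<bar>x - y\<bar> |x y. angle_of x = p \<and> angle_of y = q}"

lemma circle_dist_le: "circle_dist (angle_of x) (angle_of y) \<le> \<bar>x - y\<bar>"
  unfolding circle_dist_def by (rule cInf_lower) (auto intro!: bdd_belowI[of _ 0])

lemma angle_rep_close:
  "\<exists>x' y'. angle_of x' = angle_of x \<and> angle_of y' = angle_of y \<and>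
     \<bar>x' - y'\<bar> = circle_dist (angle_of x) (angle_of y)"
proof -
  define k where "k = round ((x - y) / (2 * pi))"
  define x' where "x' = x - 2 * pi * of_int k"
  have ax': "angle_of x' = angle_of x"
    unfolding angle_of_eq_iff x'_def by (rule exI[of _ "-k"]) simp
  have min: "\<bar>x' - y\<bar> \<le> \<bar>u - v\<bar>" if uv: "angle_of u = angle_of x" "angle_of v = angle_of y" for u v
  proof -
    obtain i j :: int where ij: "u - x = 2 * pi * of_int i" "v - y = 2 * pi * of_int j"
      using uv unfolding angle_of_eq_iff by blast
    have e1: "u - v = 2 * pi * ((x - y) / (2 * pi) - of_int (j - i))"
      using ij by (simp add: field_simps)
    have e2: "x' - y = 2 * pi * ((x - y) / (2 * pi) - of_int k)"
      by (simp add: x'_def field_simps)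
    have "\<bar>(x - y) / (2 * pi) - of_int k\<bar> \<le> \<bar>(x - y) / (2 * pi) - of_int (j - i)\<bar>"
      unfolding k_def by (rule round_diff_minimal)
    then show ?thesis
      unfolding e1 e2 abs_mult by (intro mult_left_mono) auto
  qed
  have "circle_dist (angle_of x) (angle_of y) = \<bar>x' - y\<bar>"
  proof (rule antisym)
    show "circle_dist (angle_of x) (angle_of y) \<le> \<bar>x' - y\<bar>"
      using circle_dist_le[of x' y] ax' by simp
    show "\<bar>x' - y\<bar> \<le> circle_dist (angle_of x) (angle_of y)"
      unfolding circle_dist_def by (rule cInf_greatest) (auto intro: min)
  qed
  then show ?thesis using ax' by metis
qed

instantiation angle :: metric_space
begin

definition dist_angle :: "angle \<Rightarrow> angle \<Rightarrow> real" where
  "dist_angle = circle_dist"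

definition uniformity_angle :: "(angle \<times> angle) filter" where
  "uniformity_angle = (INF e\<in>{0<..}. principal {(x, y). dist x y < e})"

definition open_angle :: "angle set \<Rightarrow> bool" where
  "open_angle U \<longleftrightarrow> (\<forall>x\<in>U. eventually (\<lambda>(x', y). x' = x \<longrightarrow> y \<in> U) uniformity)"

lemmas dist_angle_of_le = circle_dist_le[folded dist_angle_def]
  and dist_angle_of_attained = angle_rep_close[folded dist_angle_def]

instance
proof
  show "uniformity = (INF e\<in>{0<..}. principal {(x::angle, y). dist x y < e})"
    by (rule uniformity_angle_def)
  show "open U \<longleftrightarrow> (\<forall>x\<in>U. eventually (\<lambda>(x', y). x' = x \<longrightarrow> y \<in> U) uniformity)"
    for U :: "angle set" by (rule open_angle_def)
next
  fix p q :: angle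
  obtain x y where xy: "p = angle_of x" "q = angle_of y" using angle_of_surj by metis
  show "dist p q = 0 \<longleftrightarrow> p = q"
  proof
    assume "dist p q = 0"
    then obtain x' y' where "angle_of x' = p" "angle_of y' = q" "\<bar>x' - y'\<bar> = 0"
      using dist_angle_of_attained[of x y] xy by metis
    then show "p = q" by simp
  next
    assume "p = q"
    then have "dist p q \<le> 0" using dist_angle_of_le[of x x] xy by simp
    moreover obtain x' y' where "\<bar>x' - y'\<bar> = dist p q"
      using dist_angle_of_attained[of x y] xy by metis
    ultimately show "dist p q = 0" by (metis abs_ge_zero antisym)
  qed
next
  fix p q s :: angle
  obtain x y z where xyz: "p = angle_of x" "q = angle_of y" "s = angle_of z"
    using angle_of_surj by metis
  obtain x1 z1 where 1: "angle_of x1 = p" "angle_of z1 = s" "\<bar>x1 - z1\<bar> = dist p s"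
    using dist_angle_of_attained[of x z] xyz by metis
  obtain y2 z2 where 2: "angle_of y2 = q" "angle_of z2 = s" "\<bar>y2 - z2\<bar> = dist q s"
    using dist_angle_of_attained[of y z] xyz by metis
  obtain k :: int where k: "z1 - z2 = 2 * pi * of_int k"
    using 1 2 angle_of_eq_iff by metis
  define y1 where "y1 = y2 + 2 * pi * of_int k"
  have y1: "angle_of y1 = q"
    unfolding 2(1)[symmetric] angle_of_eq_iff y1_def by (rule exI[of _ k]) simp
  have "dist p q \<le> \<bar>x1 - y1\<bar>" using dist_angle_of_le[of x1 y1] 1 y1 by simp
  also have "\<dots> \<le> \<bar>x1 - z1\<bar> + \<bar>y1 - z1\<bar>" by simp
  also have "y1 - z1 = y2 - z2" using k by (simp add: y1_def)
  finally show "dist p q \<le> dist p s + dist q s" using 1 2 by simp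
qed

end

definition torus_of :: "real ^ 'n \<Rightarrow> angle ^ 'n" where
  "torus_of x = (\<chi> i. angle_of (x $ i))"

lemma dist_torus:
  fixes p q :: "angle ^ 'n"
  shows "dist p q = Inf {norm (x - y) |x y. torus_of x = p \<and> torus_of y = q}"
proof -
  have "\<exists>x' y'. angle_of x' = p $ i \<and> angle_of y' = q $ i \<and> \<bar>x' - y'\<bar> = dist (p $ i) (q $ i)" for i
    using dist_angle_of_attained angle_of_surj by metis
  then obtain X Y where XY: "\<And>i. angle_of (X i) = p $ i" "\<And>i. angle_of (Y i) = q $ i"
      "\<And>i. \<bar>X i - Y i\<bar> = dist (p $ i) (q $ i)"
    by metis
  define x y :: "real ^ 'n" where "x = (\<chi> i. X i)" and "y = (\<chi> i. Y i)"
  have xy: "torus_of x = p" "torus_of y = q" "norm (x - y) = dist p q"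
    by (auto simp: x_def y_def torus_of_def XY vec_eq_iff norm_vec_def dist_vec_def)
  have "dist p q \<le> norm (u - v)" if "torus_of u = p" "torus_of v = q" for u v
  proof -
    have "p = (\<chi> i. angle_of (u $ i))" "q = (\<chi> i. angle_of (v $ i))"
      using that by (auto simp: torus_of_def)
    then show ?thesis
      unfolding norm_vec_def dist_vec_def
      by (intro L2_set_mono) (auto intro: dist_angle_of_le)
  qed
  moreover have "dist p q \<in> {norm (x - y) |x y. torus_of x = p \<and> torus_of y = q}"
    using xy by (metis (mono_tags, lifting) mem_Collect_eq)
  ultimately show ?thesis
    by (intro cInf_eq_minimum[symmetric]) auto
qed

section \<open>Curves on the torus\<close>

text \<open>Curves are functions on \<^typ>\<open>real\<close> of which only the restriction to \<open>{0..}\<close> matters.\<close>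

definition is_lift :: "(real \<Rightarrow> real ^ 'n) \<Rightarrow> (real \<Rightarrow> angle ^ 'n) \<Rightarrow> bool" where
  "is_lift \<phi> \<Phi> \<longleftrightarrow> continuous_on {0..} \<phi> \<and> (\<forall>t\<ge>0. torus_of (\<phi> t) = \<Phi> t)"

lemma is_lift_unique:
  assumes "is_lift \<phi> \<Phi>" "is_lift \<psi> \<Phi>"
  shows "\<exists>c. \<forall>t\<ge>0. \<phi> t = \<psi> t + c"
proof -
  have "(\<lambda>t. \<phi> t $ i - \<psi> t $ i) constant_on {0..}" for i
  proof (rule continuous_discrete_range_constant)
    show "connected {0::real..}" by simp
    show "continuous_on {0..} (\<lambda>t. \<phi> t $ i - \<psi> t $ i)"
      using assms unfolding is_lift_def by (intro continuous_intros) auto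
    fix t :: real assume t: "t \<in> {0..}"
    have int: "\<exists>k::int. \<phi> s $ i - \<psi> s $ i = 2 * pi * of_int k" if "s \<in> {0..}" for s
    proof -
      have "torus_of (\<phi> s) = torus_of (\<psi> s)" using assms that by (auto simp: is_lift_def)
      then show ?thesis by (auto simp: torus_of_def vec_eq_iff angle_of_eq_iff)
    qed
    show "\<exists>e>0. \<forall>s. s \<in> {0..} \<and> \<phi> s $ i - \<psi> s $ i \<noteq> \<phi> t $ i - \<psi> t $ i \<longrightarrow>
            e \<le> norm ((\<phi> s $ i - \<psi> s $ i) - (\<phi> t $ i - \<psi> t $ i))"
    proof (intro exI[of _ "2 * pi"] conjI allI impI)
      fix s assume s: "s \<in> {0..} \<and> \<phi> s $ i - \<psi> s $ i \<noteq> \<phi> t $ i - \<psi> t $ i"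
      obtain k l :: int where kl: "\<phi> s $ i - \<psi> s $ i = 2 * pi * of_int k"
          "\<phi> t $ i - \<psi> t $ i = 2 * pi * of_int l"
        using int s t by metis
      with s have "k \<noteq> l" by auto
      then have "1 \<le> \<bar>real_of_int (k - l)\<bar>" by linarith
      moreover have "norm ((\<phi> s $ i - \<psi> s $ i) - (\<phi> t $ i - \<psi> t $ i))
          = 2 * pi * \<bar>real_of_int (k - l)\<bar>"
        unfolding kl by (simp add: right_diff_distrib[symmetric] abs_mult)
      ultimately show "2 * pi \<le> norm ((\<phi> s $ i - \<psi> s $ i) - (\<phi> t $ i - \<psi> t $ i))" by simp
    qed simp
  qed
  then obtain c where c: "\<And>i t. t \<ge> 0 \<Longrightarrow> \<phi> t $ i - \<psi> t $ i = c i"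
    unfolding constant_on_def by (metis atLeast_iff)
  then show ?thesis
    by (intro exI[of _ "\<chi> i. c i"]) (auto simp: vec_eq_iff algebra_simps)
qed

text \<open>Classical velocity (one-sided at time 0), independent of the lift.\<close>

definition velocity :: "(real \<Rightarrow> angle ^ 'n) \<Rightarrow> real \<Rightarrow> real ^ 'n" where
  "velocity \<Phi> t = (THE v. \<exists>\<phi>. is_lift \<phi> \<Phi> \<and> (\<phi> has_vector_derivative v) (at t within {0..}))"

lemma velocity_eq:
  assumes "is_lift \<phi> \<Phi>" "(\<phi> has_vector_derivative v) (at t within {0..})" "t \<ge> 0"
  shows "velocity \<Phi> t = v"
  unfolding velocity_def
proof (rule the_equality)
  show "\<exists>\<phi>. is_lift \<phi> \<Phi> \<and> (\<phi> has_vector_derivative v) (at t within {0..})"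
    using assms by blast
  fix w assume "\<exists>\<psi>. is_lift \<psi> \<Phi> \<and> (\<psi> has_vector_derivative w) (at t within {0..})"
  then obtain \<psi> where \<psi>: "is_lift \<psi> \<Phi>" "(\<psi> has_vector_derivative w) (at t within {0..})"
    by blast
  obtain c where c: "\<forall>s\<ge>0. \<psi> s = \<phi> s + c"
    using is_lift_unique[OF \<psi>(1) assms(1)] by blast
  have "((\<lambda>s. \<phi> s + c) has_vector_derivative v) (at t within {0..})"
    using has_vector_derivative_add[OF assms(2) has_vector_derivative_const[of c]] by simp
  then have "(\<psi> has_vector_derivative v) (at t within {0..})"
    by (rule has_vector_derivative_transform[rotated 2]) (use c assms in auto)
  moreover have "at t within {0..} \<noteq> bot"
  proof -
    have "(0::real) \<in> {0..}" "(1::real) \<in> {0..}" by auto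
    then have "\<not> (\<exists>z::real. {0..} = {z})" by (metis singletonD zero_neq_one)
    then show ?thesis
      using connected_imp_perfect[of "{0::real..}" t] assms(3) by (simp add: trivial_limit_within)
  qed
  ultimately show "w = v"
    using vector_derivative_unique_within[OF _ \<psi>(2)] by blast
qed

definition smooth_curve :: "(real \<Rightarrow> angle ^ 'n) \<Rightarrow> bool" where
  "smooth_curve \<Phi> \<longleftrightarrow>
     (\<exists>D :: nat \<Rightarrow> real \<Rightarrow> real ^ 'n. is_lift (D 0) \<Phi> \<and>
        (\<forall>k. \<forall>t\<ge>0. (D k has_vector_derivative D (Suc k) t) (at t within {0..})))"

definition L2_on :: "real set \<Rightarrow> (real \<Rightarrow> 'a::euclidean_space) \<Rightarrow> bool" where
  "L2_on I u \<longleftrightarrow> set_borel_measurable lborel I u \<and> set_integrable lborel I (\<lambda>t. (norm (u t))\<^sup>2)"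

text \<open>Weak derivatives on an open interval, tested against \<open>C\<^sup>1\<close> functions with compact support.\<close>

definition weak_derivative_on ::
    "real set \<Rightarrow> (real \<Rightarrow> 'a::euclidean_space) \<Rightarrow> (real \<Rightarrow> 'a) \<Rightarrow> bool" where
  "weak_derivative_on I u v \<longleftrightarrow>
     (\<forall>\<eta> \<eta>' :: real \<Rightarrow> real. \<forall>K.
        (\<forall>t. (\<eta> has_real_derivative \<eta>' t) (at t)) \<and> continuous_on UNIV \<eta>' \<and>
        compact K \<and> K \<subseteq> I \<and> (\<forall>t. t \<notin> K \<longrightarrow> \<eta> t = 0) \<longrightarrow>
        (LINT t:I|lborel. \<eta>' t *\<^sub>R u t) = - (LINT t:I|lborel. \<eta> t *\<^sub>R v t))"

text \<open>
  A torus-valued curve is \<open>H\<^sup>1\<close> on every \<open>(0,T)\<close> if it has a continuous lift that is; as usual in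
  one dimension, an \<open>H\<^sup>1\<close> class is identified with its continuous representative, so that the
  initial condition makes sense.
\<close>

definition has_weak_velocity :: "(real \<Rightarrow> angle ^ 'n) \<Rightarrow> (real \<Rightarrow> real ^ 'n) \<Rightarrow> bool" where
  "has_weak_velocity \<Phi> v \<longleftrightarrow>
     (\<exists>\<phi>. is_lift \<phi> \<Phi> \<and>
        (\<forall>T>0. L2_on {0<..<T} \<phi> \<and> L2_on {0<..<T} v \<and> weak_derivative_on {0<..<T} \<phi> v))"

definition H1_loc :: "(real \<Rightarrow> angle ^ 'n) set" where
  "H1_loc = {\<Phi>. \<exists>v. has_weak_velocity \<Phi> v}"

text \<open>Determined up to null sets, which is all that the cost functional below depends on.\<close>

definition weak_velocity :: "(real \<Rightarrow> angle ^ 'n) \<Rightarrow> real \<Rightarrow> real ^ 'n" where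
  "weak_velocity \<Phi> = (SOME v. has_weak_velocity \<Phi> v)"

section \<open>The optimal control problem\<close>

text \<open>A point of \<open>angle ^ 4\<close> is \<open>(\<alpha>\<^sub>1, \<gamma>\<^sub>1, \<alpha>\<^sub>2, \<gamma>\<^sub>2)\<close>; planes are indexed by the type \<open>2\<close>.\<close>

definition \<alpha>_ix :: "2 \<Rightarrow> 4" where "\<alpha>_ix i = (if i = 1 then 1 else 3)"

definition \<gamma>_ix :: "2 \<Rightarrow> 4" where "\<gamma>_ix i = (if i = 1 then 2 else 4)"

text \<open>The forces in the planes \<open>z = -a\<close> and \<open>z = b\<close> equivalent to the force \<open>(Fx, Fy, 0)\<close> and the
  momentum \<open>(Nx, Ny, 0)\<close>.\<close>

definition plane_forces :: "real \<Rightarrow> real \<Rightarrow> real \<Rightarrow> real \<Rightarrow> real \<Rightarrow> real \<Rightarrow> real ^ 2 ^ 2" where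
  "plane_forces a b Fx Fy Nx Ny = vector
     [(1 / (a + b)) *\<^sub>R vector [b * Fx - Ny, b * Fy + Nx],
      (1 / (a + b)) *\<^sub>R vector [a * Fx + Ny, a * Fy - Nx]]"

definition plane_imbalance :: "real \<Rightarrow> real \<Rightarrow> real \<Rightarrow> real ^ 2 \<Rightarrow> angle \<Rightarrow> angle \<Rightarrow> real" where
  "plane_imbalance m r \<omega> F \<alpha> \<gamma> =
     \<bar>2 * m * r * \<omega>\<^sup>2 * cos_angle \<gamma> * cos_angle \<alpha> + F $ 1\<bar>\<^sup>2 +
     \<bar>2 * m * r * \<omega>\<^sup>2 * cos_angle \<gamma> * sin_angle \<alpha> + F $ 2\<bar>\<^sup>2"

definition imbalance_indicator ::
    "real ^ 2 \<Rightarrow> real ^ 2 \<Rightarrow> real \<Rightarrow> real ^ 2 ^ 2 \<Rightarrow> angle ^ 4 \<Rightarrow> real" where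
  "imbalance_indicator m r \<omega> F p =
     plane_imbalance (m $ 1) (r $ 1) \<omega> (F $ 1) (p $ 1) (p $ 2) +
     plane_imbalance (m $ 2) (r $ 2) \<omega> (F $ 2) (p $ 3) (p $ 4)"

text \<open>
  Partial derivatives of the potential \<open>\<beta>/2 \<cdot> G\<close>, whose gradient is the right-hand side of the
  Euler-Lagrange equation \<open>\<Phi>'' = \<beta>/2 \<cdot> \<nabla>G\<close> of the cost functional.  In print, the system appears
  with \<open>c\<close> replaced by \<open>-c\<close> and without the factor \<open>(2 m r \<omega>\<^sup>2)\<^sup>2\<close>; it is then not the
  Euler-Lagrange system of the functional, and minimizers need not satisfy it.
\<close>

lemma plane_imbalance_derivatives:
  fixes F :: "real ^ 2"
  assumes "m > 0" "r > 0" "\<omega> > 0"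
  defines "c \<equiv> (1 / (2 * m * r * \<omega>\<^sup>2)) *\<^sub>R F"
  shows "((\<lambda>x. \<beta> / 2 * plane_imbalance m r \<omega> F (angle_of x) (angle_of y)) has_real_derivative
           \<beta> * (2 * m * r * \<omega>\<^sup>2)\<^sup>2 * cos y * (- c $ 1 * sin x + c $ 2 * cos x)) (at x)" (is ?A)
    and "((\<lambda>y. \<beta> / 2 * plane_imbalance m r \<omega> F (angle_of x) (angle_of y)) has_real_derivative
           - \<beta> * (2 * m * r * \<omega>\<^sup>2)\<^sup>2 * sin y * (c $ 1 * cos x + c $ 2 * sin x + cos y)) (at y)" (is ?B)
proof -
  define K where "K = 2 * m * r * \<omega>\<^sup>2"
  have K: "K \<noteq> 0" using assms by (simp add: K_def)
  have F: "F $ 1 = K * c $ 1" "F $ 2 = K * c $ 2"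
    using K by (simp_all add: c_def K_def)
  have eq: "plane_imbalance m r \<omega> F (angle_of x) (angle_of y) =
      (K * cos y * cos x + K * c $ 1)\<^sup>2 + (K * cos y * sin x + K * c $ 2)\<^sup>2" for x y
    by (simp add: plane_imbalance_def F K_def)
  show ?A
    unfolding eq K_def[symmetric]
    by (auto intro!: derivative_eq_intros simp: algebra_simps power2_eq_square)
  have B: "((\<lambda>y. \<beta> / 2 * ((K * cos y * p + K * c $ 1)\<^sup>2 + (K * cos y * q + K * c $ 2)\<^sup>2))
      has_real_derivative
      - \<beta> * K\<^sup>2 * sin y * (c $ 1 * p + c $ 2 * q + cos y * (p\<^sup>2 + q\<^sup>2))) (at y)" for p q
    by (auto intro!: derivative_eq_intros simp: algebra_simps power2_eq_square)
  show ?B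
    using B[of "cos x" "sin x"] unfolding eq K_def[symmetric] by simp
qed

definition excess :: "('a \<Rightarrow> real) \<Rightarrow> 'a \<Rightarrow> real" where
  "excess G p = G p - Inf (range G)"

definition argmin_set :: "('a \<Rightarrow> real) \<Rightarrow> 'a set" where
  "argmin_set G = {p. is_arg_min G (\<lambda>_. True) p}"

definition running_cost ::
    "real \<Rightarrow> (angle ^ 'n \<Rightarrow> real) \<Rightarrow> (real \<Rightarrow> angle ^ 'n) \<Rightarrow> real \<Rightarrow> real" where
  "running_cost \<beta> G \<Phi> t = 1 / 2 * ((norm (weak_velocity \<Phi> t))\<^sup>2 + \<beta> * excess G (\<Phi> t))"

definition admissible ::
    "real \<Rightarrow> (angle ^ 'n \<Rightarrow> real) \<Rightarrow> angle ^ 'n \<Rightarrow> (real \<Rightarrow> angle ^ 'n) set" where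
  "admissible \<beta> G \<Phi>\<^sub>0 =
     {\<Phi> \<in> H1_loc. \<Phi> 0 = \<Phi>\<^sub>0 \<and> set_integrable lborel {0<..} (running_cost \<beta> G \<Phi>)}"

definition cost :: "real \<Rightarrow> (angle ^ 'n \<Rightarrow> real) \<Rightarrow> (real \<Rightarrow> angle ^ 'n) \<Rightarrow> real" where
  "cost \<beta> G \<Phi> = (LINT t:{0<..}|lborel. running_cost \<beta> G \<Phi> t)"

definition optimal ::
    "real \<Rightarrow> (angle ^ 'n \<Rightarrow> real) \<Rightarrow> angle ^ 'n \<Rightarrow> (real \<Rightarrow> angle ^ 'n) \<Rightarrow> bool" where
  "optimal \<beta> G \<Phi>\<^sub>0 \<Phi> \<longleftrightarrow> is_arg_min (cost \<beta> G) (\<lambda>\<Psi>. \<Psi> \<in> admissible \<beta> G \<Phi>\<^sub>0) \<Phi>"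

end

theory Submission
  imports Defs
begin

text \<open>
  Lift everything to the universal cover, where \<open>W = \<beta>/2 (G - inf G)\<close> is nonnegative and its gradient
  is Lipschitz with some constant \<open>L\<close>.  On time intervals of length \<open>h\<close> with \<open>L h\<^sup>2 \<le> 1/4\<close> the action
  with fixed end points is uniformly convex, so the solution of the two-point boundary value problem
  for \<open>\<phi>'' = \<nabla>W(\<phi>)\<close> (a fixed point of a contraction) is the strict minimizer.  The infinite horizon
  problem thus becomes the minimization of a series \<open>\<Sum>k. l k (X k) (X (k + 1))\<close> over sequences of
  nodes, solved by compactness, and every minimizer agrees with a solution of the Euler-Lagrange
  equation on each short interval.

  Finite action forces the conserved energy to vanish, so \<open>|\<phi>'|\<^sup>2 = 2 W(\<phi>)\<close> and the logarithmic
  derivative of \<open>W(\<phi>)\<close> is bounded; being integrable, \<open>W(\<phi>)\<close> tends to 0.  Near its minimum the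
  imbalance determines the cosines of the angles, and a continuous function whose cosine converges
  converges itself.  If both masses are large enough, \<open>|\<nabla>W|\<^sup>2\<close> dominates \<open>W\<close> near the limit, so
  that \<open>u = W(\<phi>)\<close> eventually satisfies \<open>u'' \<ge> \<mu>\<^sup>2 u\<close> and decays exponentially.
\<close>

text \<open>The direct method in H^1 would need weak compactness and weak lower semicontinuity.
  Cutting time into short steps replaces them by compactness of a product of balls and continuity of
  the minimal action between two nodes. The bound 1/4 comes from one count: the kinetic energy
  supplies 1/2 of the squared L2 distance of velocities, the potential takes back at most L h^2 of
  it, and 1/4 is left over as strict convexity.

  In the asymptotics the velocity is a priori only square integrable, so the length of the
  trajectory is not controlled, and minimizers of G need not be isolated: if c_i = 0, the angle
  \<alpha>_i is free. Convergence is therefore read off from cosines plane by plane, and c_i = 0 is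
  settled by the equation of motion, where \<alpha>_i has zero acceleration and a velocity tending
  to 0.

  The rate needs |c_i| < 1 strictly. Then inf G = 0, so the residual force vanishes in the limit and
  with it the indefinite part of the Hessian, while sin \<gamma>_i stays away from 0; for |c_i| = 1
  it would tend to 0 and the gradient would degenerate.\<close>

section \<open>Integration by parts and square integrable functions on intervals\<close>

lemma integral_by_parts_primitive:
  fixes f f' w :: "real \<Rightarrow> real"
  assumes ab: "a \<le> b" and w: "set_integrable lborel {a..b} w"
    and f: "\<And>x. x \<in> {a..b} \<Longrightarrow> (f has_real_derivative f' x) (at x within {a..b})"
    and f': "continuous_on {a..b} f'"
  shows "integral {a..b} (\<lambda>x. f x * w x) =
    f b * integral {a..b} w - integral {a..b} (\<lambda>x. f' x * integral {a..x} w)"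
proof -
  have cf: "continuous_on {a..b} f"
    using f by (meson DERIV_continuous_on)
  define u where "u = (\<lambda>y. indicator {a..b} y * w y)"
  define q where "q = (\<lambda>x. indicator {a..b} x * f' x)"
  have u: "integrable lborel u"
    using w by (simp add: u_def set_integrable_def)
  have um[measurable]: "u \<in> borel_measurable borel" using u by auto
  have qm[measurable]: "q \<in> borel_measurable borel"
    using borel_measurable_continuous_on_indicator[OF _ f'] by (simp add: q_def)
  have q: "integrable lborel q"
    using borel_integrable_atLeastAtMost'[OF f'] by (simp add: q_def set_integrable_def)
  define h where "h = (\<lambda>x y. q x * u y * (if y \<le> x then 1 else 0))"
  have ge: "integrable lborel (\<lambda>y. \<bar>u y\<bar> * (if y \<le> x then 1 else 0))" for x
    by (rule Bochner_Integration.integrable_bound[OF u]) (auto simp: abs_mult)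
  have gs: "integrable lborel (\<lambda>y. u y * (if y \<le> x then 1 else 0))" for x
    by (rule Bochner_Integration.integrable_bound[OF u]) (auto simp: abs_mult)
  have hm: "case_prod h \<in> borel_measurable (lborel \<Otimes>\<^sub>M lborel)"
    unfolding h_def by measurable
  have int: "integrable (lborel \<Otimes>\<^sub>M lborel) (case_prod h)"
  proof (rule lborel_pair.Fubini_integrable[OF hm])
    have "integrable lborel (\<lambda>x. q x * (LINT y|lborel. \<bar>u y\<bar> * (if y \<le> x then 1 else 0)))"
    proof (rule Bochner_Integration.integrable_bound)
      show "integrable lborel (\<lambda>x. q x * (LINT y|lborel. \<bar>u y\<bar>))" using q by simp
      show "AE x in lborel. norm (q x * (LINT y|lborel. \<bar>u y\<bar> * (if y \<le> x then 1 else 0)))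
          \<le> norm (q x * (LINT y|lborel. \<bar>u y\<bar>))"
      proof (rule AE_I2)
        fix x
        have "(LINT y|lborel. \<bar>u y\<bar> * (if y \<le> x then 1 else 0)) \<le> (LINT y|lborel. \<bar>u y\<bar>)"
          by (rule integral_mono[OF ge]) (use u in auto)
        moreover have "0 \<le> (LINT y|lborel. \<bar>u y\<bar> * (if y \<le> x then 1 else 0))"
          by (rule integral_nonneg_AE) auto
        ultimately show "norm (q x * (LINT y|lborel. \<bar>u y\<bar> * (if y \<le> x then 1 else 0)))
          \<le> norm (q x * (LINT y|lborel. \<bar>u y\<bar>))"
          unfolding norm_mult by (intro mult_left_mono) auto
      qed
    qed measurable
    then have "integrable lborel (\<lambda>x. \<bar>q x * (LINT y|lborel. \<bar>u y\<bar> * (if y \<le> x then 1 else 0))\<bar>)"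
      by (rule integrable_abs)
    also have "(\<lambda>x. \<bar>q x * (LINT y|lborel. \<bar>u y\<bar> * (if y \<le> x then 1 else 0))\<bar>) =
       (\<lambda>x. LINT y|lborel. norm (case (x, y) of (x, y) \<Rightarrow> h x y))"
    proof
      fix x
      have "(LINT y|lborel. norm (case (x, y) of (x, y) \<Rightarrow> h x y)) =
          (LINT y|lborel. \<bar>q x\<bar> * (\<bar>u y\<bar> * (if y \<le> x then 1 else 0)))"
        by (rule Bochner_Integration.integral_cong) (auto simp: h_def abs_mult)
      also have "\<dots> = \<bar>q x\<bar> * (LINT y|lborel. \<bar>u y\<bar> * (if y \<le> x then 1 else 0))"
        by simp
      also have "\<dots> = \<bar>q x * (LINT y|lborel. \<bar>u y\<bar> * (if y \<le> x then 1 else 0))\<bar>"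
        unfolding abs_mult by (subst (2) abs_of_nonneg) (auto intro!: integral_nonneg_AE)
      finally show "\<bar>q x * (LINT y|lborel. \<bar>u y\<bar> * (if y \<le> x then 1 else 0))\<bar> =
          (LINT y|lborel. norm (case (x, y) of (x, y) \<Rightarrow> h x y))" ..
    qed
    finally show "integrable lborel (\<lambda>x. LINT y|lborel. norm (case (x, y) of (x, y) \<Rightarrow> h x y))" .
    have "integrable lborel (\<lambda>y. h x y)" for x
      using integrable_mult_right[OF gs[of x], of "q x"] by (simp add: h_def mult.assoc)
    then show "AE x in lborel. integrable lborel (\<lambda>y. case (x, y) of (x, y) \<Rightarrow> h x y)"
      by simp
  qed
  have 1: "(LINT y|lborel. h x y) = indicator {a..b} x * (f' x * integral {a..x} w)" for x
  proof (cases "x \<in> {a..b}")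
    case True
    have "(LINT y|lborel. h x y) = (LINT y|lborel. f' x * (indicator {a..x} y *\<^sub>R w y))"
      by (rule Bochner_Integration.integral_cong)
        (use True in \<open>auto simp: h_def q_def u_def indicator_def\<close>)
    also have "\<dots> = f' x * (LINT y:{a..x}|lborel. w y)"
      by (simp add: set_lebesgue_integral_def)
    also have "(LINT y:{a..x}|lborel. w y) = integral {a..x} w"
      by (rule set_borel_integral_eq_integral, rule set_integrable_subset[OF w]) (use True in auto)
    finally show ?thesis using True by simp
  qed (simp add: h_def q_def)
  have 2: "(LINT x|lborel. h x y) = indicator {a..b} y * ((f b - f y) * w y)" for y
  proof (cases "y \<in> {a..b}")
    case True
    have "(LINT x|lborel. h x y) = (LINT x|lborel. w y * (indicator {y..b} x *\<^sub>R f' x))"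
      by (rule Bochner_Integration.integral_cong)
        (use True in \<open>auto simp: h_def q_def u_def indicator_def\<close>)
    also have "\<dots> = w y * (LINT x:{y..b}|lborel. f' x)"
      by (simp add: set_lebesgue_integral_def)
    also have "(LINT x:{y..b}|lborel. f' x) = integral {y..b} f'"
      by (rule set_borel_integral_eq_integral, rule borel_integrable_atLeastAtMost')
         (use True in \<open>auto intro: continuous_on_subset[OF f']\<close>)
    also have "integral {y..b} f' = f b - f y"
      by (rule integral_unique, rule fundamental_theorem_of_calculus)
         (use True in \<open>auto simp: has_real_derivative_iff_has_vector_derivative[symmetric]
            intro!: DERIV_subset[OF f]\<close>)
    finally show ?thesis using True by simp
  qed (simp add: h_def u_def)
  have eq: "(LINT y|lborel. indicator {a..b} y * ((f b - f y) * w y)) =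
        (LINT x|lborel. indicator {a..b} x * (f' x * integral {a..x} w))"
    using lborel_pair.Fubini_integral[OF int] by (simp add: 1 2)
  have ip: "set_integrable lborel {a..b} (\<lambda>x. f x * w x)"
  proof -
    obtain B where B: "\<And>x. x \<in> {a..b} \<Longrightarrow> \<bar>f x\<bar> \<le> B"
      using compact_continuous_image[OF cf compact_Icc, THEN compact_imp_bounded]
      unfolding bounded_iff by (metis imageI real_norm_def)
    have [measurable]: "(\<lambda>x. indicator {a..b} x * f x) \<in> borel_measurable borel"
      using borel_measurable_continuous_on_indicator[OF _ cf] by simp
    have [measurable]: "(\<lambda>x. (indicator {a..b} x * f x) * u x) \<in> borel_measurable borel"
      by measurable
    have "norm ((indicator {a..b} x * f x) * u x) \<le> norm (B * u x)" for x
    proof (cases "x \<in> {a..b}")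
      case True
      then show ?thesis using B[of x] by (simp add: abs_mult mult_right_mono)
    qed simp
    then have "integrable lborel (\<lambda>x. (indicator {a..b} x * f x) * u x)"
      by (intro Bochner_Integration.integrable_bound[OF integrable_mult_right[OF u, of B]]) auto
    also have "(\<lambda>x. (indicator {a..b} x * f x) * u x) = (\<lambda>x. indicator {a..b} x *\<^sub>R (f x * w x))"
      by (auto simp: u_def indicator_def fun_eq_iff)
    finally show ?thesis by (simp add: set_integrable_def)
  qed
  have cI: "continuous_on {a..b} (\<lambda>x. integral {a..x} w)"
    by (rule indefinite_integral_continuous_1) (rule set_borel_integral_eq_integral(1)[OF w])
  have ip2: "set_integrable lborel {a..b} (\<lambda>x. f' x * integral {a..x} w)"
    by (intro borel_integrable_atLeastAtMost' continuous_intros f' cI)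
  have fw: "set_integrable lborel {a..b} (\<lambda>x. f b * w x)"
    using w by simp
  have "(LINT y|lborel. indicator {a..b} y * ((f b - f y) * w y)) =
     (LINT y:{a..b}|lborel. f b * w y - f y * w y)"
    by (simp add: set_lebesgue_integral_def algebra_simps)
  also have "\<dots> = (LINT y:{a..b}|lborel. f b * w y) - (LINT y:{a..b}|lborel. f y * w y)"
    by (rule set_integral_diff[OF fw ip])
  also have "\<dots> = f b * integral {a..b} w - integral {a..b} (\<lambda>x. f x * w x)"
    using set_borel_integral_eq_integral(2)[OF w] set_borel_integral_eq_integral(2)[OF ip] by simp
  finally have l: "(LINT y|lborel. indicator {a..b} y * ((f b - f y) * w y)) =
    f b * integral {a..b} w - integral {a..b} (\<lambda>x. f x * w x)" .
  have r: "(LINT x|lborel. indicator {a..b} x * (f' x * integral {a..x} w)) =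
     integral {a..b} (\<lambda>x. f' x * integral {a..x} w)"
    using set_borel_integral_eq_integral(2)[OF ip2] by (simp add: set_lebesgue_integral_def)
  show ?thesis using eq unfolding l r by simp
qed

text \<open>On a bounded interval |v| has the integrable majorant 1 + |v|^2.\<close>

lemma set_integrable_sq_imp_integrable:
  fixes v :: "real \<Rightarrow> 'a::euclidean_space"
  assumes [measurable]: "v \<in> borel_measurable borel"
    and sq: "set_integrable lborel {a..b} (\<lambda>t. (norm (v t))\<^sup>2)"
  shows "set_integrable lborel {a..b} v"
proof (rule set_integrable_bound)
  show "set_integrable lborel {a..b} (\<lambda>t. 1 + (norm (v t))\<^sup>2)"
    by (intro set_integral_add sq borel_integrable_atLeastAtMost' continuous_intros)
  show "set_borel_measurable lborel {a..b} v"
    unfolding set_borel_measurable_def by measurable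
  have "x \<le> 1 + x\<^sup>2" for x :: real
    using sum_power2_ge_zero[of "x - 1/2" 0] by (simp add: power2_eq_square algebra_simps) 
  then show "AE x in lborel. x \<in> {a..b} \<longrightarrow> norm (v x) \<le> norm (1 + (norm (v x))\<^sup>2)"
    by (auto intro: order_trans[OF _ abs_ge_self])
qed

text \<open>Cauchy-Schwarz against the constant 1, applied to the norm of \<open>v\<close>.\<close>

lemma norm_integral_sq_le:
  fixes v :: "real \<Rightarrow> 'a::euclidean_space"
  assumes "a \<le> b" and v: "v integrable_on {a..b}" "(\<lambda>t. norm (v t)) integrable_on {a..b}"
    and sq: "(\<lambda>t. (norm (v t))\<^sup>2) integrable_on {a..b}"
  shows "(norm (integral {a..b} v))\<^sup>2 \<le> (b - a) * integral {a..b} (\<lambda>t. (norm (v t))\<^sup>2)"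
proof -
  define S where "S = integral {a..b} (\<lambda>t. norm (v t))"
  define Q where "Q = integral {a..b} (\<lambda>t. (norm (v t))\<^sup>2)"
  have nS: "norm (integral {a..b} v) \<le> S"
    unfolding S_def by (intro integral_norm_bound_integral v) auto
  have "S\<^sup>2 \<le> (b - a) * Q"
  proof (cases "a = b")
    case False
    then have ab: "a < b" using assms by simp
    \<comment> \<open>The mean of |v|. The squared deviation from it has integral
      \<open>Q - m * S\<close>, whose nonnegativity is the claim divided by
      \<open>b - a\<close>.\<close>
    define m where "m = S / (b - a)"
    have "0 \<le> integral {a..b} (\<lambda>t. (norm (v t) - m)\<^sup>2)"
    proof (rule integral_nonneg)
      have "(\<lambda>t. ((norm (v t))\<^sup>2 + m\<^sup>2) - (2 * m) * norm (v t)) integrable_on {a..b}"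
        by (intro integrable_diff integrable_add sq v(2) integrable_on_mult_right integrable_const_ivl)
      then show "(\<lambda>t. (norm (v t) - m)\<^sup>2) integrable_on {a..b}"
        by (simp add: power2_diff mult_ac)
    qed auto
    also have "integral {a..b} (\<lambda>t. (norm (v t) - m)\<^sup>2) =
        integral {a..b} (\<lambda>t. ((norm (v t))\<^sup>2 + m\<^sup>2) - (2 * m) * norm (v t))"
      by (simp add: power2_diff mult_ac)
    also have "\<dots> = (Q + (b - a) * m\<^sup>2) - 2 * m * S"
      using ab unfolding Q_def S_def
      by (subst integral_diff integral_add | intro integrable_add sq v(2) integrable_on_mult_right integrable_const_ivl | simp)+
    finally have "0 \<le> Q + ((b - a) * m) * m - 2 * m * S"
      by (simp add: power2_eq_square mult_ac)
    moreover have "(b - a) * m = S" using ab by (simp add: m_def)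
    ultimately have "0 \<le> Q - m * S" by (simp add: mult_ac)
    then have "0 \<le> (b - a) * (Q - m * S)" using ab by simp
    also have "\<dots> = (b - a) * Q - ((b - a) * m) * S" by (simp add: algebra_simps)
    finally show ?thesis using \<open>(b - a) * m = S\<close> by (simp add: power2_eq_square)
  qed (simp add: S_def)
  moreover have "(norm (integral {a..b} v))\<^sup>2 \<le> S\<^sup>2"
    using nS by (intro power_mono) auto
  ultimately show ?thesis by (simp add: Q_def)
qed

lemma set_integrable_continuous_mult:
  fixes f :: "real \<Rightarrow> real" and v :: "real \<Rightarrow> 'a::euclidean_space"
  assumes f: "continuous_on {a..b} f" and v: "set_integrable lborel {a..b} v"
  shows "set_integrable lborel {a..b} (\<lambda>x. f x *\<^sub>R v x)"
proof -
  have fm: "(\<lambda>x. indicator {a..b} x *\<^sub>R f x) \<in> borel_measurable borel"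
    by (rule borel_measurable_continuous_on_indicator[OF _ f]) auto
  have i: "integrable lborel (\<lambda>x. indicator {a..b} x *\<^sub>R v x)"
    using v by (simp add: set_integrable_def)
  have vm: "(\<lambda>x. indicator {a..b} x *\<^sub>R v x) \<in> borel_measurable borel"
    using i by auto
  have "bounded (f ` {a..b})"
    by (intro compact_imp_bounded compact_continuous_image f) auto
  then obtain B where B: "\<And>x. x \<in> {a..b} \<Longrightarrow> \<bar>f x\<bar> \<le> B"
    unfolding bounded_iff by (metis imageI real_norm_def)
  have m: "(\<lambda>x. (indicator {a..b} x *\<^sub>R f x) *\<^sub>R (indicator {a..b} x *\<^sub>R v x)) \<in> borel_measurable lborel"
    using borel_measurable_scaleR[OF fm vm] by simp
  have "norm ((indicator {a..b} x *\<^sub>R f x) *\<^sub>R (indicator {a..b} x *\<^sub>R v x))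
      \<le> norm (B *\<^sub>R (indicator {a..b} x *\<^sub>R v x))" for x
    using B[of x] by (cases "x \<in> {a..b}") (auto simp: mult_right_mono)
  then have "integrable lborel (\<lambda>x. (indicator {a..b} x *\<^sub>R f x) *\<^sub>R (indicator {a..b} x *\<^sub>R v x))"
    by (intro Bochner_Integration.integrable_bound[OF integrable_scaleR_right[OF i, of B] m] AE_I2)
  also have "(\<lambda>x. (indicator {a..b} x *\<^sub>R f x) *\<^sub>R (indicator {a..b} x *\<^sub>R v x)) =
      (\<lambda>x. indicator {a..b} x *\<^sub>R (f x *\<^sub>R v x))"
    by (auto simp: indicator_def fun_eq_iff)
  finally show ?thesis by (simp add: set_integrable_def)
qed

text \<open>The positive and negative parts of \<open>f\<close> are densities of finite measures
  that agree on all half-lines, so the measures coincide. Densities are unique almost everywhere,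
  and where the two parts are equal, \<open>f\<close> vanishes.\<close>

lemma AE_zero_if_integrals_zero:
  fixes f :: "real \<Rightarrow> real"
  assumes f: "integrable lborel f" and z: "\<And>x. (LINT t:{x<..}|lborel. f t) = 0"
  shows "AE t in lborel. f t = 0"
proof -
  have [measurable]: "f \<in> borel_measurable borel" using f by auto
  have pm: "integrable lborel (\<lambda>t. indicator {x<..} t * max 0 (f t))"
       "integrable lborel (\<lambda>t. indicator {x<..} t * max 0 (- f t))" for x
    by (rule Bochner_Integration.integrable_bound[OF f]; auto simp: indicator_def)+
  have em: "emeasure (density lborel (\<lambda>t. ennreal (max 0 (g t)))) {x<..} =
      ennreal (LINT t|lborel. indicator {x<..} t * max 0 (g t))"
    if [measurable]: "g \<in> borel_measurable borel" and "integrable lborel (\<lambda>t. indicator {x<..} t * max 0 (g t))" for g :: "real \<Rightarrow> real" and x :: real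
  proof -
    have "emeasure (density lborel (\<lambda>t. ennreal (max 0 (g t)))) {x<..} =
       (\<integral>\<^sup>+ t. ennreal (max 0 (g t)) * indicator {x<..} t \<partial>lborel)"
      by (subst emeasure_density) auto
    also have "\<dots> = (\<integral>\<^sup>+ t. ennreal (indicator {x<..} t * max 0 (g t)) \<partial>lborel)"
      by (intro nn_integral_cong) (auto simp: indicator_def)
    also have "\<dots> = ennreal (LINT t|lborel. indicator {x<..} t * max 0 (g t))"
      by (rule nn_integral_eq_integral) (use that in auto)
    finally show ?thesis .
  qed
  have "density lborel (\<lambda>t. ennreal (max 0 (f t))) = density lborel (\<lambda>t. ennreal (max 0 (- f t)))"
  proof (rule measure_eqI_lessThan)
    fix x
    have "(LINT t|lborel. indicator {x<..} t * max 0 (f t)) - (LINT t|lborel. indicator {x<..} t * max 0 (- f t))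
      = (LINT t|lborel. indicator {x<..} t * max 0 (f t) - indicator {x<..} t * max 0 (- f t))"
      by (rule Bochner_Integration.integral_diff[symmetric]) (rule pm)+
    also have "\<dots> = (LINT t|lborel. indicator {x<..} t *\<^sub>R f t)"
      by (rule Bochner_Integration.integral_cong) (auto simp: indicator_def)
    also have "\<dots> = 0" using z[of x] by (simp add: set_lebesgue_integral_def)
    finally show "emeasure (density lborel (\<lambda>t. ennreal (max 0 (f t)))) {x<..} =
       emeasure (density lborel (\<lambda>t. ennreal (max 0 (- f t)))) {x<..}"
      using pm by (simp add: em)
    show "emeasure (density lborel (\<lambda>t. ennreal (max 0 (f t)))) {x<..} < \<infinity>"
      using pm by (simp add: em)
  qed auto
  then have "AE t in lborel. ennreal (max 0 (f t)) = ennreal (max 0 (- f t))"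
    by (intro sigma_finite_measure.density_unique[OF sigma_finite_lborel]) auto
  then show ?thesis
    by eventually_elim (auto simp: max_def split: if_splits)
qed

text \<open>Solutions are found on compact windows, while the final derivatives are taken within
  \<open>{0..}\<close>. Away from the right end the two filters agree, except at a left end
  different from 0.\<close>

lemma at_within_halfline:
  fixes s t T :: real
  assumes "s < t \<or> s = t \<and> s = 0" "0 \<le> s" "t < T"
  shows "at t within {s..T} = at t within {0..}"
proof -
  show ?thesis
  proof (cases "s < t")
    case True
    then show ?thesis
      using assms by (intro at_within_nhd[of _ "{s<..<T}"]) auto
  next
    case False
    then show ?thesis
      using assms by (intro at_within_nhd[of _ "{..<T}"]) auto
  qed
qed

lemma continuous_on_halfline:
  fixes f :: "real \<Rightarrow> 'a::topological_space"
  assumes "\<And>T. T > 0 \<Longrightarrow> continuous_on {0..T} f"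
  shows "continuous_on {0..} f"
  unfolding continuous_on_eq_continuous_within
proof
  fix t :: real assume t: "t \<in> {0..}"
  have "continuous (at t within {0..t+1}) f"
    using assms[of "t+1"] t by (auto simp: continuous_on_eq_continuous_within)
  moreover have "at t within {0..t+1} = at t within {0..}"
    by (rule at_within_halfline) (use t in auto)
  ultimately show "continuous (at t within {0..}) f" by simp
qed

section \<open>Curves with square integrable velocity\<close>

text \<open>Replaces weak derivatives by an H^1 curve with a Borel representative of its velocity,
  so that increments are integrals. The equivalence with the weak formulation is proved in the next
  section.\<close>

definition primitive_curve :: "(real \<Rightarrow> 'a::euclidean_space) \<Rightarrow> (real \<Rightarrow> 'a) \<Rightarrow> bool" where
  "primitive_curve \<phi> v \<longleftrightarrow> v \<in> borel_measurable borel \<and>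
     (\<forall>T. set_integrable lborel {0..T} (\<lambda>t. (norm (v t))\<^sup>2)) \<and>
     (\<forall>t\<ge>0. \<phi> t = \<phi> 0 + integral {0..t} v)"

lemma primitive_curve_measurable: "primitive_curve \<phi> v \<Longrightarrow> v \<in> borel_measurable borel"
  by (simp add: primitive_curve_def)

lemma primitive_curve_sq_integrable:
  "primitive_curve \<phi> v \<Longrightarrow> 0 \<le> s \<Longrightarrow> set_integrable lborel {s..t} (\<lambda>t. (norm (v t))\<^sup>2)"
  unfolding primitive_curve_def by (rule set_integrable_subset[of _ "{0..t}"]) auto

lemma primitive_curve_integrable:
  "primitive_curve \<phi> v \<Longrightarrow> 0 \<le> s \<Longrightarrow> set_integrable lborel {s..t} v"
  by (rule set_integrable_sq_imp_integrable)
     (auto intro: primitive_curve_measurable primitive_curve_sq_integrable)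

lemma primitive_curve_diff:
  assumes "primitive_curve \<phi> v" "0 \<le> s" "s \<le> t"
  shows "\<phi> t - \<phi> s = integral {s..t} v"
proof -
  have "v integrable_on {0..t}"
    by (rule set_borel_integral_eq_integral(1)) (rule primitive_curve_integrable[OF assms(1)], simp)
  then have "integral {0..s} v + integral {s..t} v = integral {0..t} v"
    using assms by (intro Henstock_Kurzweil_Integration.integral_combine) auto
  moreover have "\<phi> t = \<phi> 0 + integral {0..t} v" "\<phi> s = \<phi> 0 + integral {0..s} v"
    using assms(1) order_trans[OF assms(2,3)] assms(2) unfolding primitive_curve_def by blast+
  ultimately show ?thesis by (simp add: algebra_simps)
qed

lemma primitive_curve_continuous:
  assumes "primitive_curve \<phi> v"
  shows "continuous_on {0..} \<phi>"
proof (rule continuous_on_halfline)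
  fix T :: real
  have "v integrable_on {0..T}"
    by (rule set_borel_integral_eq_integral(1)) (rule primitive_curve_integrable[OF assms], simp)
  then have "continuous_on {0..T} (\<lambda>t. \<phi> 0 + integral {0..t} v)"
    by (intro continuous_intros indefinite_integral_continuous_1)
  moreover have "\<phi> 0 + integral {0..t} v = \<phi> t" if "t \<in> {0..T}" for t
    using assms that unfolding primitive_curve_def by (metis atLeastAtMost_iff)
  ultimately show "continuous_on {0..T} \<phi>"
    by (rule continuous_on_eq)
qed

text \<open>Equal increments make the integral of each component of v - w vanish over every tail of
  [0, n]. The constant \<open>c\<close> is there because two lifts of one torus curve differ by a
  translation.\<close>

lemma AE_eq_of_primitive_curves:
  assumes "primitive_curve \<phi> v" "primitive_curve \<psi> w" "\<And>t. t \<ge> 0 \<Longrightarrow> \<phi> t = \<psi> t + c"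
  shows "AE t in lborel. t \<in> {0..} \<longrightarrow> v t = w t"
proof -
  have "AE t in lborel. t \<in> {0..real n} \<longrightarrow> (v t - w t) \<bullet> b = 0" for n b
  proof -
    define f where "f = (\<lambda>t. indicator {0..real n} t * ((v t - w t) \<bullet> b))"
    have iv: "set_integrable lborel {s..real n} v" "set_integrable lborel {s..real n} w" if "0 \<le> s" for s
      using assms that by (auto intro: primitive_curve_integrable)
    have "set_integrable lborel {0..real n} (\<lambda>t. v t - w t)"
      by (intro set_integral_diff iv) auto
    then have "integrable lborel (\<lambda>t. (indicator {0..real n} t *\<^sub>R (v t - w t)) \<bullet> b)"
      unfolding set_integrable_def by (rule integrable_inner_left)
    then have f: "integrable lborel f" by (simp add: f_def)
    have z: "integral {s..real n} v - integral {s..real n} w = 0" if "0 \<le> s" for s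
    proof (cases "s \<le> real n")
      case True
      have "integral {s..real n} v - integral {s..real n} w = (\<phi> n - \<phi> s) - (\<psi> n - \<psi> s)"
        using primitive_curve_diff[OF assms(1) that True] primitive_curve_diff[OF assms(2) that True]
        by simp
      also have "\<dots> = 0" using assms(3)[of s] assms(3)[of n] that by simp
      finally show ?thesis .
    qed simp
    have "(LINT t:{x<..}|lborel. f t) = 0" for x
    proof -
      \<comment> \<open>\<open>f\<close> vanishes off [0, n], so the half-line beyond
        \<open>x\<close> contributes only from \<open>s\<close> on, up to the null set consisting of
        \<open>x\<close>.\<close>
      define s where "s = max 0 x"
      have s: "0 \<le> s" by (simp add: s_def)
      have "(LINT t:{x<..}|lborel. f t) = (LINT t|lborel. (indicator {s..real n} t *\<^sub>R (v t - w t)) \<bullet> b)"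
        unfolding set_lebesgue_integral_def
      proof (rule integral_cong_AE)
        have "AE t in lborel. t \<noteq> x" by (rule AE_lborel_singleton)
        then show "AE t in lborel. indicator {x<..} t *\<^sub>R f t =
            (indicator {s..real n} t *\<^sub>R (v t - w t)) \<bullet> b"
          by eventually_elim (auto simp: f_def s_def indicator_def)
        have [measurable]: "v \<in> borel_measurable borel" "w \<in> borel_measurable borel"
          "f \<in> borel_measurable borel"
          using f primitive_curve_measurable[OF assms(1)] primitive_curve_measurable[OF assms(2)] by auto
        show "(\<lambda>t. indicator {x<..} t *\<^sub>R f t) \<in> borel_measurable lborel"
          "(\<lambda>t. (indicator {s..real n} t *\<^sub>R (v t - w t)) \<bullet> b) \<in> borel_measurable lborel"
          by measurable
      qed
      also have "\<dots> = (LINT t|lborel. indicator {s..real n} t *\<^sub>R (v t - w t)) \<bullet> b"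
        by (rule integral_inner_left)
           (use set_integral_diff(1)[OF iv, OF s s] in \<open>simp add: set_integrable_def\<close>)
      also have "(LINT t|lborel. indicator {s..real n} t *\<^sub>R (v t - w t)) =
          (LINT t:{s..real n}|lborel. v t) - (LINT t:{s..real n}|lborel. w t)"
        using set_integral_diff(2)[OF iv, OF s s] by (simp add: set_lebesgue_integral_def)
      also have "\<dots> = 0"
        using z[OF s] iv[OF s] by (simp add: set_borel_integral_eq_integral(2))
      finally show ?thesis by simp
    qed
    from AE_zero_if_integrals_zero[OF f this] show ?thesis
      by eventually_elim (auto simp: f_def indicator_def)
  qed
  then have "AE t in lborel. \<forall>b\<in>Basis. \<forall>n::nat. t \<in> {0..real n} \<longrightarrow> (v t - w t) \<bullet> b = 0"
    by (intro AE_finite_allI AE_all_countable[THEN iffD2]) auto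
  then show ?thesis
  proof eventually_elim
    case (elim t)
    show ?case
    proof
      assume "t \<in> {0..}"
      moreover obtain n :: nat where "t \<le> n" using real_arch_simple by blast
      ultimately have "\<forall>b\<in>Basis. (v t - w t) \<bullet> b = 0" using elim by auto
      then show "v t = w t" by - (rule euclidean_eqI, simp add: inner_diff_left)
    qed
  qed
qed

lemma integral_by_parts_primitive_curve:
  fixes \<phi> v :: "real \<Rightarrow> 'a::euclidean_space"
  assumes \<phi>: "primitive_curve \<phi> v" and st: "0 \<le> s" "s \<le> t"
    and f: "\<And>x. x \<in> {s..t} \<Longrightarrow> (f has_real_derivative f' x) (at x within {s..t})"
    and f': "continuous_on {s..t} f'"
  shows "integral {s..t} (\<lambda>x. f x * (v x \<bullet> b)) =
    f t * (\<phi> t \<bullet> b) - f s * (\<phi> s \<bullet> b) - integral {s..t} (\<lambda>x. f' x * (\<phi> x \<bullet> b))"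
proof -
  have iv: "set_integrable lborel {s..x} v" for x using primitive_curve_integrable[OF \<phi> st(1)] .
  have c: "continuous_on {s..t} \<phi>"
    using primitive_curve_continuous[OF \<phi>] by (rule continuous_on_subset) (use st in auto)
  have w: "set_integrable lborel {s..t} (\<lambda>x. v x \<bullet> b)"
    using integrable_inner_left[of b lborel "\<lambda>x. indicator {s..t} x *\<^sub>R v x"] iv[of t]
    by (auto simp: set_integrable_def)
  have iw: "integral {s..x} (\<lambda>x. v x \<bullet> b) = \<phi> x \<bullet> b - \<phi> s \<bullet> b" if "x \<in> {s..t}" for x
  proof -
    have "integral {s..x} (\<lambda>x. v x \<bullet> b) = integral {s..x} v \<bullet> b"
      using integral_linear[OF set_borel_integral_eq_integral(1)[OF iv] bounded_linear_inner_left[of b]]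
      by (simp add: o_def)
    also have "integral {s..x} v = \<phi> x - \<phi> s"
      using primitive_curve_diff[OF \<phi>] st that by auto
    finally show ?thesis by (simp add: inner_diff_left)
  qed
  have i1: "(\<lambda>x. f' x * (\<phi> x \<bullet> b)) integrable_on {s..t}" 
    by (intro integrable_continuous_real continuous_intros f' c)
  have i2: "f' integrable_on {s..t}" by (intro integrable_continuous_real f')
  have ff: "integral {s..t} f' = f t - f s"
    by (rule integral_unique, rule fundamental_theorem_of_calculus)
         (use st f in \<open>auto simp: has_real_derivative_iff_has_vector_derivative[symmetric]\<close>)
  have "integral {s..t} (\<lambda>x. f' x * integral {s..x} (\<lambda>x. v x \<bullet> b)) =
     integral {s..t} (\<lambda>x. f' x * (\<phi> x \<bullet> b) - f' x * (\<phi> s \<bullet> b))"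
    by (rule Henstock_Kurzweil_Integration.integral_cong) (simp add: iw algebra_simps)
  also have "\<dots> = integral {s..t} (\<lambda>x. f' x * (\<phi> x \<bullet> b)) - (f t - f s) * (\<phi> s \<bullet> b)"
    using i1 i2 ff by (subst Henstock_Kurzweil_Integration.integral_diff) (auto intro: integrable_on_mult_left)
  finally show ?thesis
    using integral_by_parts_primitive[OF st(2) w f f'] st by (simp add: iw algebra_simps)
qed

section \<open>Weak derivatives and primitives\<close>

text \<open>Test functions in \<open>weak_derivative_on\<close> need only be continuously
  differentiable, so a quadratic spline is smooth enough.\<close>

lemma smooth_step_exists:
  obtains S S' :: "real \<Rightarrow> real"
  where "\<And>u. (S has_real_derivative S' u) (at u)" "continuous_on UNIV S'" "\<And>u. 0 \<le> S' u"
    "\<And>u. u \<notin> {0..1} \<Longrightarrow> S' u = 0" "\<And>u. u \<le> 0 \<Longrightarrow> S u = 0" "\<And>u. u \<ge> 1 \<Longrightarrow> S u = 1"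
    "\<And>u. \<bar>S u\<bar> \<le> 1"
proof -
  have sq: "((\<lambda>u. (max 0 u)\<^sup>2) has_real_derivative 2 * max 0 u) (at u)" for u :: real
  proof -
    consider "u < 0" | "u > 0" | "u = 0" by linarith
    then show ?thesis
    proof cases
      case 1
      have "((\<lambda>u. 0) has_real_derivative 0) (at u)" by simp
      then have "((\<lambda>u. (max 0 u)\<^sup>2) has_real_derivative 0) (at u)"
        by (rule has_field_derivative_transform_within_open[of _ _ _ "{..<0}"]) (use 1 in auto)
      then show ?thesis using 1 by simp
    next
      case 2
      have "((\<lambda>u. u\<^sup>2) has_real_derivative 2 * u) (at u)"
        by (auto intro!: derivative_eq_intros)
      then have "((\<lambda>u. (max 0 u)\<^sup>2) has_real_derivative 2 * u) (at u)"
        by (rule has_field_derivative_transform_within_open[of _ _ _ "{0<..}"]) (use 2 in auto)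
      then show ?thesis using 2 by simp
    next
      case 3
      have "((\<lambda>h::real. (max 0 h)\<^sup>2 / h) \<longlongrightarrow> 0) (at 0)"
      proof (rule Lim_null_comparison)
        show "\<forall>\<^sub>F h::real in at 0. norm ((max 0 h)\<^sup>2 / h) \<le> \<bar>h\<bar>"
          by (auto simp: max_def power2_eq_square)
        show "((\<lambda>h::real. \<bar>h\<bar>) \<longlongrightarrow> 0) (at 0)"
          by (rule tendsto_eq_intros | simp)+
      qed
      then show ?thesis using 3 by (simp add: DERIV_def)
    qed
  qed
  \<comment> \<open>A second difference of truncated squares: its derivative \<open>S'\<close> is
    the tent of area 1 over [0, 1].\<close>
  define S where "S = (\<lambda>u::real. 2 * ((max 0 u)\<^sup>2 - 2 * (max 0 (u - 1/2))\<^sup>2 + (max 0 (u - 1))\<^sup>2))"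
  define S' where "S' = (\<lambda>u::real. 4 * (max 0 u - 2 * max 0 (u - 1/2) + max 0 (u - 1)))"
  have sqs: "((\<lambda>u. (max 0 (u - c))\<^sup>2) has_real_derivative 2 * max 0 (u - c)) (at u)" for u c :: real
    using DERIV_shift[of "\<lambda>u. (max 0 u)\<^sup>2" "2 * max 0 (u - c)" u "- c"] sq[of "u - c"] by simp
  have d: "(S has_real_derivative S' u) (at u)" for u
    unfolding S_def S'_def
    by (rule derivative_eq_intros sq sqs refl | simp)+
  have pos: "0 \<le> S' u" for u
    unfolding S'_def by (auto simp: max_def)
  have S0: "S u = 0" if "u \<le> 0" for u using that by (simp add: S_def)
  have S1: "S u = 1" if "u \<ge> 1" for u
    using that by (simp add: S_def power2_eq_square algebra_simps)
  have mono: "S x \<le> S y" if "x \<le> y" for x y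
    by (rule DERIV_nonneg_imp_nondecreasing[OF that]) (use d pos in blast)
  have "\<bar>S u\<bar> \<le> 1" for u
    using mono[of "min 0 u" u] mono[of u "max 1 u"] S0[of "min 0 u"] S1[of "max 1 u"] by auto
  moreover have "continuous_on UNIV S'"
    unfolding S'_def by (intro continuous_intros)
  moreover have "S' u = 0" if "u \<notin> {0..1}" for u
    using that by (auto simp: S'_def max_def)
  ultimately show thesis using that[of S S'] d pos S0 S1 by blast
qed

lemma set_lebesgue_integral_open_interval:
  fixes f :: "real \<Rightarrow> 'a::euclidean_space"
  assumes "set_integrable lborel {a..b} f"
  shows "(LINT x:{a<..<b}|lborel. f x) = integral {a..b} f"
proof -
  have "set_integrable lborel {a<..<b} f"
    by (rule set_integrable_subset[OF assms]) auto
  then show ?thesis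
    by (simp add: set_borel_integral_eq_integral(2) integral_open_interval_real)
qed

text \<open>Integration by parts; a test function supported in a compact part of the open interval
  is zero at both ends, which removes the boundary terms.\<close>

lemma primitive_curve_weak_derivative:
  fixes \<phi> v :: "real \<Rightarrow> 'a::euclidean_space"
  assumes \<phi>: "primitive_curve \<phi> v" and T: "T > 0"
  shows "weak_derivative_on {0<..<T} \<phi> v"
  unfolding weak_derivative_on_def
proof (intro allI impI, elim conjE)
  fix \<eta> \<eta>' :: "real \<Rightarrow> real" and K
  assume d: "\<forall>t. (\<eta> has_real_derivative \<eta>' t) (at t)" and c': "continuous_on UNIV \<eta>'"
    and K: "compact K" "K \<subseteq> {0<..<T}" "\<forall>t. t \<notin> K \<longrightarrow> \<eta> t = 0"
  have c: "continuous_on UNIV \<eta>"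
    using d by (meson DERIV_continuous_on has_field_derivative_at_within)
  have z: "\<eta> 0 = 0" "\<eta> T = 0" using K by auto
  have cp: "continuous_on {0..T} \<phi>"
    using primitive_curve_continuous[OF \<phi>] by (rule continuous_on_subset) auto
  have i1: "set_integrable lborel {0..T} (\<lambda>t. \<eta>' t *\<^sub>R \<phi> t)"
    by (rule set_integrable_continuous_mult[OF continuous_on_subset[OF c' subset_UNIV] borel_integrable_atLeastAtMost'[OF cp]])
  have i2: "set_integrable lborel {0..T} (\<lambda>t. \<eta> t *\<^sub>R v t)"
    by (rule set_integrable_continuous_mult[OF continuous_on_subset[OF c subset_UNIV] primitive_curve_integrable[OF \<phi>]]) simp
  have "integral {0..T} (\<lambda>t. \<eta>' t *\<^sub>R \<phi> t) = - integral {0..T} (\<lambda>t. \<eta> t *\<^sub>R v t)"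
  proof (rule euclidean_eqI)
    fix b :: 'a assume b: "b \<in> Basis"
    have "integral {0..T} (\<lambda>t. \<eta>' t *\<^sub>R \<phi> t) \<bullet> b = integral {0..T} (\<lambda>t. \<eta>' t * (\<phi> t \<bullet> b))"
      using integral_linear[OF set_borel_integral_eq_integral(1)[OF i1] bounded_linear_inner_left[of b]]
      by (simp add: o_def)
    moreover have "integral {0..T} (\<lambda>t. \<eta> t *\<^sub>R v t) \<bullet> b = integral {0..T} (\<lambda>t. \<eta> t * (v t \<bullet> b))"
      using integral_linear[OF set_borel_integral_eq_integral(1)[OF i2] bounded_linear_inner_left[of b]]
      by (simp add: o_def)
    moreover have "integral {0..T} (\<lambda>x. \<eta> x * (v x \<bullet> b)) =
        \<eta> T * (\<phi> T \<bullet> b) - \<eta> 0 * (\<phi> 0 \<bullet> b) - integral {0..T} (\<lambda>x. \<eta>' x * (\<phi> x \<bullet> b))"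
      by (rule integral_by_parts_primitive_curve[OF \<phi>])
        (use T d in \<open>auto intro: has_field_derivative_at_within continuous_on_subset[OF c']\<close>)
    ultimately show "integral {0..T} (\<lambda>t. \<eta>' t *\<^sub>R \<phi> t) \<bullet> b =
        (- integral {0..T} (\<lambda>t. \<eta> t *\<^sub>R v t)) \<bullet> b"
      using z by simp
  qed
  then show "(LINT t:{0<..<T}|lborel. \<eta>' t *\<^sub>R \<phi> t) = - (LINT t:{0<..<T}|lborel. \<eta> t *\<^sub>R v t)"
    by (simp add: set_lebesgue_integral_open_interval i1 i2)
qed

text \<open>The test function is a difference of two steepening steps, at \<open>s\<close> and at
  \<open>t\<close>. It tends to the indicator of the interval between them, while its derivative
  becomes a unit mass at \<open>s\<close> minus a unit mass at \<open>t\<close>.\<close>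

lemma weak_derivative_increment:
  fixes \<phi> v :: "real \<Rightarrow> 'a::euclidean_space"
  assumes cont: "continuous_on {0..} \<phi>"
    and weak: "weak_derivative_on {0<..<t + 2} \<phi> v"
    and v: "set_integrable lborel {0<..<t + 2} v"
    and st: "0 < s" "s < t"
  shows "\<phi> t - \<phi> s = integral {s..t} v"
proof -
  obtain S S' :: "real \<Rightarrow> real" where S: "\<And>u. (S has_real_derivative S' u) (at u)"
    "continuous_on UNIV S'" "\<And>u. 0 \<le> S' u"
    "\<And>u. u \<notin> {0..1} \<Longrightarrow> S' u = 0" "\<And>u. u \<le> 0 \<Longrightarrow> S u = 0" "\<And>u. u \<ge> 1 \<Longrightarrow> S u = 1"
    "\<And>u. \<bar>S u\<bar> \<le> 1"
    using smooth_step_exists by blast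
  \<comment> \<open>The second step needs room to the right of \<open>t\<close>: it ends before
    \<open>t + 1\<close>, so the compact set [s, t + 1] lies in the open interval (0, T).\<close>
  define T where "T = t + 2"
  define e where "e = (\<lambda>n. 1 / real (Suc n))"
  have e: "0 < e n" "e n \<le> 1" for n by (auto simp: e_def)
  have e0: "e \<longlonglongrightarrow> 0"
    unfolding e_def using LIMSEQ_inverse_real_of_nat by (simp add: inverse_eq_divide)
  define \<sigma> where "\<sigma> = (\<lambda>n c x. S ((x - c) / e n))"
  define \<rho> where "\<rho> = (\<lambda>n c x. S' ((x - c) / e n) / e n)"
  have \<sigma>\<rho>: "(\<sigma> n c has_real_derivative \<rho> n c x) (at x)" for n c x
  proof -
    have "((\<lambda>x. (x - c) / e n) has_real_derivative 1 / e n) (at x)"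
      using e[of n] by (auto intro!: derivative_eq_intros)
    from DERIV_chain2[OF S(1) this] show ?thesis by (simp add: \<sigma>_def \<rho>_def)
  qed
  have \<rho>c: "continuous_on A (\<rho> n c)" for A n c
    unfolding \<rho>_def using e[of n]
    by (intro continuous_intros continuous_on_compose2[OF S(2)]) auto
  have \<sigma>c: "continuous_on A (\<sigma> n c)" for A n c
    using \<sigma>\<rho> by (meson DERIV_continuous_on has_field_derivative_at_within)
  have \<rho>pos: "0 \<le> \<rho> n c x" for n c x using S(3) e[of n] by (simp add: \<rho>_def)
  have \<rho>0: "\<rho> n c x = 0" if "x \<notin> {c..c + e n}" for n c x
  proof -
    have "(x - c) / e n \<notin> {0..1}" using that e[of n] by (auto simp: field_simps)
    then show ?thesis by (simp add: \<rho>_def S(4))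
  qed
  have \<sigma>0: "\<sigma> n c x = 0" if "x \<le> c" for n c x
    using that e[of n] by (auto simp: \<sigma>_def divide_le_0_iff intro!: S(5))
  have \<sigma>1: "\<sigma> n c x = 1" if "c + e n \<le> x" for n c x
    using that e[of n] by (auto simp: \<sigma>_def field_simps intro!: S(6))
  have cT: "continuous_on {0..T} \<phi>" using cont by (rule continuous_on_subset) auto
  have iv: "set_integrable lborel {s..t} v"
    by (rule set_integrable_subset[OF v]) (use st in auto)
  have cphi: "continuous_on {0..T} (\<lambda>x. \<rho> n c x *\<^sub>R \<phi> x)" for n c
    by (intro continuous_intros \<rho>c cT)
  \<comment> \<open>The kernels \<open>\<rho> n c\<close> have mass 1 on [c, c + e n], so these are
    averages of \<open>\<phi>\<close> over shrinking neighbourhoods of \<open>c\<close>.\<close>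
  have lim: "(\<lambda>n. integral {0..T} (\<lambda>x. \<rho> n c x *\<^sub>R \<phi> x)) \<longlonglongrightarrow> \<phi> c" if c: "0 < c" "c \<le> t" for c
  proof (rule LIMSEQ_I)
    fix r :: real assume r: "0 < r"
    have "c \<in> {0..T}" using c by (auto simp: T_def)
    then obtain d where d: "d > 0" "\<And>x. x \<in> {0..T} \<Longrightarrow> dist x c < d \<Longrightarrow> dist (\<phi> x) (\<phi> c) < r/2"
      using cT r unfolding continuous_on_iff by (metis half_gt_zero)
    obtain N where N: "\<And>n. n \<ge> N \<Longrightarrow> \<bar>e n\<bar> < d"
      using LIMSEQ_D[OF e0 d(1)] by auto
    show "\<exists>no. \<forall>n\<ge>no. norm (integral {0..T} (\<lambda>x. \<rho> n c x *\<^sub>R \<phi> x) - \<phi> c) < r"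
    proof (intro exI allI impI)
      fix n assume n: "n \<ge> N"
      have one: "integral {0..T} (\<rho> n c) = 1"
      proof -
        have "(\<rho> n c has_integral \<sigma> n c T - \<sigma> n c 0) {0..T}"
          by (rule fundamental_theorem_of_calculus)
            (use \<sigma>\<rho> c T_def in \<open>auto simp: has_real_derivative_iff_has_vector_derivative[symmetric] intro: has_field_derivative_at_within\<close>)
        moreover have "\<sigma> n c T = 1" "\<sigma> n c 0 = 0"
          using c e[of n] by (auto intro!: \<sigma>0 \<sigma>1 simp: T_def)
        ultimately show ?thesis by (simp add: integral_unique)
      qed
      have i\<rho>: "\<rho> n c integrable_on {0..T}" by (intro integrable_continuous_real \<rho>c)
      have "integral {0..T} (\<lambda>x. \<rho> n c x *\<^sub>R \<phi> x) - \<phi> c =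
          integral {0..T} (\<lambda>x. \<rho> n c x *\<^sub>R \<phi> x) - integral {0..T} (\<lambda>x. \<rho> n c x *\<^sub>R \<phi> c)"
        using integral_linear[OF i\<rho> bounded_linear_scaleR_left[of "\<phi> c"]] one by (simp add: o_def)
      also have "\<dots> = integral {0..T} (\<lambda>x. \<rho> n c x *\<^sub>R \<phi> x - \<rho> n c x *\<^sub>R \<phi> c)"
        by (rule Henstock_Kurzweil_Integration.integral_diff[symmetric]; intro integrable_continuous_real continuous_intros \<rho>c cT)
      also have "norm \<dots> \<le> integral {0..T} (\<lambda>x. \<rho> n c x * (r / 2))"
      proof (rule integral_norm_bound_integral)
        fix x assume x: "x \<in> {0..T}"
        show "norm (\<rho> n c x *\<^sub>R \<phi> x - \<rho> n c x *\<^sub>R \<phi> c) \<le> \<rho> n c x * (r / 2)"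
        proof (cases "x \<in> {c..c + e n}")
          case True
          then have "dist x c < d" using N[OF n] by (auto simp: dist_real_def)
          then have "norm (\<phi> x - \<phi> c) \<le> r / 2" using d(2)[OF x] by (simp add: dist_norm)
          then show ?thesis
            using mult_left_mono[OF _ \<rho>pos, of "norm (\<phi> x - \<phi> c)" "r / 2" n c x]
            by (simp add: scaleR_diff_right[symmetric] \<rho>pos)
        qed (simp add: \<rho>0)
      qed (intro integrable_continuous_real continuous_intros \<rho>c cT)+
      also have "\<dots> = r / 2" using one by simp
      also have "\<dots> < r" using r by simp
      finally show "norm (integral {0..T} (\<lambda>x. \<rho> n c x *\<^sub>R \<phi> x) - \<phi> c) < r" .
    qed
  qed
  have eq: "integral {0..T} (\<lambda>x. \<rho> n s x *\<^sub>R \<phi> x) - integral {0..T} (\<lambda>x. \<rho> n t x *\<^sub>R \<phi> x) =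
     - (LINT x:{0<..<T}|lborel. (\<sigma> n s x - \<sigma> n t x) *\<^sub>R v x)" for n
  proof -
    have "(LINT x:{0<..<T}|lborel. (\<rho> n s x - \<rho> n t x) *\<^sub>R \<phi> x) =
       - (LINT x:{0<..<T}|lborel. (\<sigma> n s x - \<sigma> n t x) *\<^sub>R v x)"
    proof (rule weak[unfolded weak_derivative_on_def, rule_format, folded T_def, of _ _ "{s..t + 1}"], intro conjI allI impI)
      show "((\<lambda>x. \<sigma> n s x - \<sigma> n t x) has_real_derivative \<rho> n s x - \<rho> n t x) (at x)" for x
        by (intro DERIV_diff \<sigma>\<rho>)
      show "continuous_on UNIV (\<lambda>x. \<rho> n s x - \<rho> n t x)" by (intro continuous_intros \<rho>c)
      show "{s..t + 1} \<subseteq> {0<..<T}" using st by (auto simp: T_def)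
      show "\<sigma> n s x - \<sigma> n t x = 0" if "x \<notin> {s..t + 1}" for x
      proof (cases "x < s")
        case True
        then show ?thesis using st by (simp add: \<sigma>0)
      next
        case False
        then have "x > t + 1" using that by auto
        then show ?thesis using e[of n] st by (simp add: \<sigma>1)
      qed
    qed simp
    moreover have "(LINT x:{0<..<T}|lborel. (\<rho> n s x - \<rho> n t x) *\<^sub>R \<phi> x) =
        integral {0..T} (\<lambda>x. (\<rho> n s x - \<rho> n t x) *\<^sub>R \<phi> x)"
      by (intro set_lebesgue_integral_open_interval borel_integrable_atLeastAtMost' continuous_intros \<rho>c cT)
    moreover have "\<dots> = integral {0..T} (\<lambda>x. \<rho> n s x *\<^sub>R \<phi> x) - integral {0..T} (\<lambda>x. \<rho> n t x *\<^sub>R \<phi> x)"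
      unfolding scaleR_diff_left
      by (rule Henstock_Kurzweil_Integration.integral_diff; intro integrable_continuous_real cphi)
    ultimately show ?thesis by simp
  qed
  \<comment> \<open>Dominated convergence: both steps are bounded by 1, so twice the norm of
    \<open>v\<close> is a majorant.\<close>
  have "(\<lambda>n. LINT x:{0<..<T}|lborel. (\<sigma> n s x - \<sigma> n t x) *\<^sub>R v x) \<longlonglongrightarrow> (LINT x|lborel. indicator {s<..t} x *\<^sub>R v x)"
    (is "?f \<longlonglongrightarrow> ?l")
    unfolding set_lebesgue_integral_def
  proof (rule integral_dominated_convergence)
    have vi: "integrable lborel (\<lambda>x. indicator {0<..<T} x *\<^sub>R v x)"
      using v by (simp add: set_integrable_def T_def)
    have [measurable]: "(\<lambda>x. indicator {0<..<T} x *\<^sub>R v x) \<in> borel_measurable borel"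
      using vi by auto
    have [measurable]: "\<sigma> n c \<in> borel_measurable borel" for n c
      by (rule borel_measurable_continuous_onI[OF \<sigma>c])
    show "integrable lborel (\<lambda>x. 2 * norm (indicator {0<..<T} x *\<^sub>R v x))"
      using vi by (intro integrable_mult_right integrable_norm)
    have "(\<lambda>x. indicator {s<..t} x *\<^sub>R (indicator {0<..<T} x *\<^sub>R v x)) \<in> borel_measurable lborel" 
      by measurable
    also have "(\<lambda>x. indicator {s<..t} x *\<^sub>R (indicator {0<..<T} x *\<^sub>R v x)) = (\<lambda>x. indicator {s<..t} x *\<^sub>R v x)"
      using st by (auto simp: fun_eq_iff T_def indicator_def)
    finally show "(\<lambda>x. indicator {s<..t} x *\<^sub>R v x) \<in> borel_measurable lborel" .
    have "(\<lambda>x. (\<sigma> n s x - \<sigma> n t x) *\<^sub>R (indicator {0<..<T} x *\<^sub>R v x)) \<in> borel_measurable lborel" for n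
      by measurable
    then show "(\<lambda>x. indicator {0<..<T} x *\<^sub>R (\<sigma> n s x - \<sigma> n t x) *\<^sub>R v x) \<in> borel_measurable lborel" for n
      by (simp add: mult.commute)
    show "AE x in lborel. norm (indicator {0<..<T} x *\<^sub>R (\<sigma> n s x - \<sigma> n t x) *\<^sub>R v x) \<le> 2 * norm (indicator {0<..<T} x *\<^sub>R v x)" for n
    proof (rule AE_I2)
      fix x
      have "\<bar>\<sigma> n s x - \<sigma> n t x\<bar> \<le> 2"
        using S(7)[of "(x - s) / e n"] S(7)[of "(x - t) / e n"] unfolding \<sigma>_def by linarith
      then show "norm (indicator {0<..<T} x *\<^sub>R (\<sigma> n s x - \<sigma> n t x) *\<^sub>R v x) \<le> 2 * norm (indicator {0<..<T} x *\<^sub>R v x)"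
        by (cases "x \<in> {0<..<T}") (auto intro: mult_right_mono)
    qed
    have "(\<lambda>n. indicator {0<..<T} x *\<^sub>R (\<sigma> n s x - \<sigma> n t x) *\<^sub>R v x) \<longlonglongrightarrow> indicator {s<..t} x *\<^sub>R v x" for x
    proof -
      have ev: "\<forall>\<^sub>F n in sequentially. \<sigma> n c x = (if x \<le> c then 0 else 1)" for c
      proof (cases "x \<le> c")
        case False
        then have "\<forall>\<^sub>F n in sequentially. e n < x - c"
          using e0 by (intro order_tendstoD) auto
        then show ?thesis by eventually_elim (use False in \<open>auto intro!: \<sigma>1\<close>)
      qed (simp add: \<sigma>0)
      have "\<forall>\<^sub>F n in sequentially. indicator {0<..<T} x *\<^sub>R (\<sigma> n s x - \<sigma> n t x) *\<^sub>R v x = indicator {s<..t} x *\<^sub>R v x"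
        using ev[of s] ev[of t] by eventually_elim (use st in \<open>auto simp: indicator_def T_def\<close>)
      then show ?thesis by (rule tendsto_eventually)
    qed
    then show "AE x in lborel. (\<lambda>n. indicator {0<..<T} x *\<^sub>R (\<sigma> n s x - \<sigma> n t x) *\<^sub>R v x) \<longlonglongrightarrow> indicator {s<..t} x *\<^sub>R v x"
      by simp
  qed
  then have l1: "(\<lambda>n. - ?f n) \<longlonglongrightarrow> - ?l" by (rule tendsto_minus)
  have l2: "(\<lambda>n. integral {0..T} (\<lambda>x. \<rho> n s x *\<^sub>R \<phi> x) - integral {0..T} (\<lambda>x. \<rho> n t x *\<^sub>R \<phi> x)) \<longlonglongrightarrow> \<phi> s - \<phi> t"
    using st by (intro tendsto_diff lim) auto
  have "\<phi> s - \<phi> t = - ?l"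
    by (rule LIMSEQ_unique[OF l2[unfolded eq] l1])
  also have "(LINT x|lborel. indicator {s<..t} x *\<^sub>R v x) = integral {s<..t} v"
  proof -
    have "set_integrable lborel {s<..t} v" by (rule set_integrable_subset[OF iv]) auto
    then show ?thesis
      using set_borel_integral_eq_integral(2) by (fastforce simp: set_lebesgue_integral_def)
  qed
  also have "\<dots> = integral {s..t} v"
    by (rule integral_spike_set) (rule negligible_subset[of "{s}"], use st in auto)+
  finally show ?thesis by (simp add: algebra_simps)
qed

text \<open>Nothing is known about \<open>v\<close> at nonpositive times, hence the cut-off, which
  becomes Borel as a limit of cut-offs to bounded intervals. The increments are known only from
  positive times on and are extended to 0 by continuity.\<close>

lemma primitive_curve_of_weak_velocity:
  fixes \<phi> v :: "real \<Rightarrow> 'a::euclidean_space"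
  assumes cont: "continuous_on {0..} \<phi>"
    and v: "\<And>T. T > 0 \<Longrightarrow> L2_on {0<..<T} v"
    and weak: "\<And>T. T > 0 \<Longrightarrow> weak_derivative_on {0<..<T} \<phi> v"
  shows "primitive_curve \<phi> (\<lambda>t. indicator {0<..} t *\<^sub>R v t)" (is "primitive_curve \<phi> ?V")
proof -
  have meas: "?V \<in> borel_measurable borel"
  proof (rule borel_measurable_LIMSEQ_metric)
    show "(\<lambda>t. indicator {0<..<real (Suc n)} t *\<^sub>R v t) \<in> borel_measurable borel" for n
      using v[of "real (Suc n)"] by (simp add: L2_on_def set_borel_measurable_def)
    show "(\<lambda>n. indicator {0<..<real (Suc n)} t *\<^sub>R v t) \<longlonglongrightarrow> ?V t" for t
    proof -
      obtain N :: nat where "t < real N" using reals_Archimedean2 by blast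
      then have "\<forall>\<^sub>F n in sequentially. indicator {0<..<real (Suc n)} t *\<^sub>R v t = ?V t"
        by (intro eventually_sequentiallyI[of N]) (auto simp: indicator_def)
      then show ?thesis by (rule tendsto_eventually)
    qed
  qed
  have sq: "set_integrable lborel {0..T} (\<lambda>t. (norm (?V t))\<^sup>2)" for T
  proof (cases "T \<ge> 0")
    case True
    have "set_integrable lborel {0<..<T + 1} (\<lambda>t. (norm (v t))\<^sup>2)"
      using v[of "T + 1"] True by (simp add: L2_on_def)
    then have "set_integrable lborel {0<..T} (\<lambda>t. (norm (v t))\<^sup>2)"
      by (rule set_integrable_subset) auto
    then show ?thesis
      unfolding set_integrable_def
      by (rule Bochner_Integration.integrable_cong[THEN iffD1, rotated 2]) (auto simp: indicator_def)
  qed (simp add: set_integrable_def)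
  have int: "set_integrable lborel {s..t} ?V" if "0 \<le> s" for s t
    by (rule set_integrable_sq_imp_integrable[OF meas], rule set_integrable_subset[OF sq[of t]])
       (use that in auto)
  have inc: "\<phi> t - \<phi> s = integral {s..t} ?V" if "0 < s" "s < t" for s t
  proof -
    have "set_integrable lborel {0<..<t + 2} ?V"
      by (rule set_integrable_subset[OF int[of 0 "t + 2"]]) auto
    then have "set_integrable lborel {0<..<t + 2} v"
      unfolding set_integrable_def
      by (rule Bochner_Integration.integrable_cong[THEN iffD1, rotated 2]) (auto simp: indicator_def)
    then have "\<phi> t - \<phi> s = integral {s..t} v"
      using weak[of "t + 2"] that by (intro weak_derivative_increment[OF cont]) auto
    also have "\<dots> = integral {s..t} ?V"
      by (rule Henstock_Kurzweil_Integration.integral_cong) (use that in auto)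
    finally show ?thesis .
  qed
  have "\<phi> t = \<phi> 0 + integral {0..t} ?V" if t: "0 \<le> t" for t
  proof (cases "t = 0")
    case False
    \<comment> \<open>Constant on the open interval and continuous on its closure, hence the same at
      0 and at \<open>t\<close>.\<close>
    define u where "u = (\<lambda>s. \<phi> s - integral {0..s} ?V)"
    have "continuous_on {0..t} u"
      unfolding u_def
      by (intro continuous_intros indefinite_integral_continuous_1 continuous_on_subset[OF cont]
          set_borel_integral_eq_integral(1)[OF int]) auto
    moreover have "u s = u t" if s: "s \<in> {0<..<t}" for s
    proof -
      have "integral {0..s} ?V + integral {s..t} ?V = integral {0..t} ?V"
        using s by (intro Henstock_Kurzweil_Integration.integral_combine
            set_borel_integral_eq_integral(1)[OF int]) auto
      then show ?thesis using inc[of s t] s by (simp add: u_def algebra_simps)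
    qed
    moreover have "closure {0<..<t} = {0..t}" using False t by simp
    ultimately have "u 0 = u t"
      using continuous_constant_on_closure[of "{0<..<t}" u "u t" 0] t by auto
    then show ?thesis by (simp add: u_def algebra_simps)
  qed simp
  then show ?thesis using meas sq unfolding primitive_curve_def by blast
qed

lemma L2_on_continuous:
  fixes f :: "real \<Rightarrow> 'a::euclidean_space"
  assumes "continuous_on {a..b} f"
  shows "L2_on {a<..<b} f"
proof -
  have "set_integrable lborel {a..b} f" "set_integrable lborel {a..b} (\<lambda>t. (norm (f t))\<^sup>2)"
    by (intro borel_integrable_atLeastAtMost' continuous_intros assms)+
  then have "set_integrable lborel {a<..<b} f" "set_integrable lborel {a<..<b} (\<lambda>t. (norm (f t))\<^sup>2)"
    by (auto intro: set_integrable_subset)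
  then show ?thesis
    by (auto simp: L2_on_def set_borel_measurable_def set_integrable_def)
qed

lemma primitive_curve_imp_weak_velocity:
  fixes \<phi> v :: "real \<Rightarrow> real ^ 'n"
  assumes "primitive_curve \<phi> v"
  shows "has_weak_velocity (\<lambda>t. torus_of (\<phi> t)) v"
  unfolding has_weak_velocity_def
proof (intro exI[of _ \<phi>] conjI allI impI)
  show "is_lift \<phi> (\<lambda>t. torus_of (\<phi> t))"
    using primitive_curve_continuous[OF assms] by (simp add: is_lift_def)
  fix T :: real assume T: "T > 0"
  show "L2_on {0<..<T} \<phi>"
    by (intro L2_on_continuous continuous_on_subset[OF primitive_curve_continuous[OF assms]]) auto
  have [measurable]: "v \<in> borel_measurable borel" by (rule primitive_curve_measurable[OF assms])
  have "set_integrable lborel {0<..<T} (\<lambda>t. (norm (v t))\<^sup>2)"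
    by (rule set_integrable_subset[OF primitive_curve_sq_integrable[OF assms, of 0 T]]) auto
  then show "L2_on {0<..<T} v"
    by (simp add: L2_on_def set_borel_measurable_def)
  show "weak_derivative_on {0<..<T} \<phi> v"
    by (rule primitive_curve_weak_derivative[OF assms T])
qed

text \<open>\<open>weak_velocity\<close> is an arbitrary choice, possibly made for another lift.
  Lifts differ by a constant, so the choice agrees with \<open>v\<close> almost everywhere at
  positive times.\<close>

lemma weak_velocity_of_primitive_curve:
  fixes \<phi> v :: "real \<Rightarrow> real ^ 'n"
  assumes \<phi>: "primitive_curve \<phi> v" and \<Phi>: "\<And>t. t \<ge> 0 \<Longrightarrow> torus_of (\<phi> t) = \<Phi> t"
  shows "AE t in lborel. t \<in> {0<..} \<longrightarrow> weak_velocity \<Phi> t = v t"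
    and "\<Phi> \<in> H1_loc"
    and "(\<lambda>t. indicator {0<..} t *\<^sub>R weak_velocity \<Phi> t) \<in> borel_measurable borel"
proof -
  have lift: "is_lift \<phi> \<Phi>"
    using primitive_curve_continuous[OF \<phi>] \<Phi> by (simp add: is_lift_def)
  have hv: "has_weak_velocity \<Phi> v"
    using primitive_curve_imp_weak_velocity[OF \<phi>] lift is_lift_unique
    unfolding has_weak_velocity_def
  proof (elim exE conjE)
    fix \<psi> assume "is_lift \<psi> (\<lambda>t. torus_of (\<phi> t))"
      and a: "\<forall>T>0. L2_on {0<..<T} \<psi> \<and> L2_on {0<..<T} v \<and> weak_derivative_on {0<..<T} \<psi> v"
    then have "is_lift \<psi> \<Phi>" using \<Phi> by (simp add: is_lift_def)
    then show "\<exists>\<phi>. is_lift \<phi> \<Phi> \<and> (\<forall>T>0. L2_on {0<..<T} \<phi> \<and> L2_on {0<..<T} v \<and> weak_derivative_on {0<..<T} \<phi> v)"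
      using a by blast
  qed
  then show "\<Phi> \<in> H1_loc" by (auto simp: H1_loc_def)
  have "has_weak_velocity \<Phi> (weak_velocity \<Phi>)"
    unfolding weak_velocity_def by (rule someI[of "has_weak_velocity \<Phi>", OF hv])
  then obtain \<psi> where \<psi>: "is_lift \<psi> \<Phi>" and w: "\<And>T. T > 0 \<Longrightarrow> L2_on {0<..<T} (weak_velocity \<Phi>)"
    "\<And>T. T > 0 \<Longrightarrow> weak_derivative_on {0<..<T} \<psi> (weak_velocity \<Phi>)"
    unfolding has_weak_velocity_def by blast
  have \<psi>v: "primitive_curve \<psi> (\<lambda>t. indicator {0<..} t *\<^sub>R weak_velocity \<Phi> t)"
    by (rule primitive_curve_of_weak_velocity) (use \<psi> w in \<open>auto simp: is_lift_def\<close>)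
  then show "(\<lambda>t. indicator {0<..} t *\<^sub>R weak_velocity \<Phi> t) \<in> borel_measurable borel"
    by (rule primitive_curve_measurable)
  obtain c where "\<forall>t\<ge>0. \<psi> t = \<phi> t + c" using is_lift_unique[OF \<psi> lift] by blast
  then have "AE t in lborel. t \<in> {0..} \<longrightarrow> indicator {0<..} t *\<^sub>R weak_velocity \<Phi> t = v t"
    by (intro AE_eq_of_primitive_curves[OF \<psi>v \<phi>]) auto
  then show "AE t in lborel. t \<in> {0<..} \<longrightarrow> weak_velocity \<Phi> t = v t"
    by eventually_elim (auto simp: indicator_def)
qed

lemma H1_loc_obtain_lift:
  fixes \<Phi> :: "real \<Rightarrow> angle ^ 'n"
  assumes "\<Phi> \<in> H1_loc"
  obtains \<phi> v where "primitive_curve \<phi> v" "\<And>t. t \<ge> 0 \<Longrightarrow> torus_of (\<phi> t) = \<Phi> t"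
proof -
  obtain v \<phi> where "is_lift \<phi> \<Phi>"
    "\<forall>T>0. L2_on {0<..<T} \<phi> \<and> L2_on {0<..<T} v \<and> weak_derivative_on {0<..<T} \<phi> v"
    using assms by (auto simp: H1_loc_def has_weak_velocity_def)
  then have "primitive_curve \<phi> (\<lambda>t. indicator {0<..} t *\<^sub>R v t)"
    by (intro primitive_curve_of_weak_velocity) (auto simp: is_lift_def)
  with \<open>is_lift \<phi> \<Phi>\<close> show thesis
    using that unfolding is_lift_def by blast
qed

text \<open>The scalar formula summed over a basis. The form \<open>has_integral\<close> also
  records integrability, so that several such identities can be added and subtracted.\<close>

lemma integral_by_parts_inner:
  fixes \<phi> v f f' :: "real \<Rightarrow> 'a::euclidean_space"
  assumes \<phi>: "primitive_curve \<phi> v" and st: "0 \<le> s" "s \<le> t"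
    and f: "\<And>x. x \<in> {s..t} \<Longrightarrow> (f has_vector_derivative f' x) (at x within {s..t})"
    and f': "continuous_on {s..t} f'"
  shows "((\<lambda>x. f x \<bullet> v x) has_integral
    (f t \<bullet> \<phi> t - f s \<bullet> \<phi> s - integral {s..t} (\<lambda>x. f' x \<bullet> \<phi> x))) {s..t}"
proof -
  have cf: "continuous_on {s..t} f" using f continuous_on_vector_derivative by blast
  have cp: "continuous_on {s..t} \<phi>"
    using primitive_curve_continuous[OF \<phi>] by (rule continuous_on_subset) (use st in auto)
  have iv: "set_integrable lborel {s..t} v" by (rule primitive_curve_integrable[OF \<phi> st(1)])
  have ivb: "set_integrable lborel {s..t} (\<lambda>x. v x \<bullet> b)" for b
    using integrable_inner_left[of b lborel "\<lambda>x. indicator {s..t} x *\<^sub>R v x"] iv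
    by (auto simp: set_integrable_def)
  have "((\<lambda>x. (f x \<bullet> b) * (v x \<bullet> b)) has_integral
     (f t \<bullet> b) * (\<phi> t \<bullet> b) - (f s \<bullet> b) * (\<phi> s \<bullet> b) - integral {s..t} (\<lambda>x. (f' x \<bullet> b) * (\<phi> x \<bullet> b))) {s..t}" for b
  proof -
    have "(\<lambda>x. (f x \<bullet> b) *\<^sub>R (v x \<bullet> b)) integrable_on {s..t}"
      by (intro set_borel_integral_eq_integral(1) set_integrable_continuous_mult continuous_intros cf ivb)
    moreover have "integral {s..t} (\<lambda>x. (f x \<bullet> b) * (v x \<bullet> b)) =
     (f t \<bullet> b) * (\<phi> t \<bullet> b) - (f s \<bullet> b) * (\<phi> s \<bullet> b) - integral {s..t} (\<lambda>x. (f' x \<bullet> b) * (\<phi> x \<bullet> b))"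
    proof (rule integral_by_parts_primitive_curve[OF \<phi> st])
      show "((\<lambda>x. f x \<bullet> b) has_real_derivative f' x \<bullet> b) (at x within {s..t})" if "x \<in> {s..t}" for x
        using bounded_linear.has_vector_derivative[OF bounded_linear_inner_left f[OF that]]
        by (simp add: has_real_derivative_iff_has_vector_derivative)
    qed (intro continuous_intros f')
    ultimately show ?thesis by (simp add: has_integral_iff)
  qed
  then have "((\<lambda>x. \<Sum>b\<in>Basis. (f x \<bullet> b) * (v x \<bullet> b)) has_integral
     (\<Sum>b\<in>Basis. (f t \<bullet> b) * (\<phi> t \<bullet> b) - (f s \<bullet> b) * (\<phi> s \<bullet> b) - integral {s..t} (\<lambda>x. (f' x \<bullet> b) * (\<phi> x \<bullet> b)))) {s..t}"
    by (intro has_integral_sum) auto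
  moreover have "(\<Sum>b\<in>Basis. integral {s..t} (\<lambda>x. (f' x \<bullet> b) * (\<phi> x \<bullet> b))) = integral {s..t} (\<lambda>x. f' x \<bullet> \<phi> x)"
    unfolding euclidean_inner[of "f' _" "\<phi> _"]
    by (rule integral_sum[symmetric]) (auto intro!: integrable_continuous_real continuous_intros f' cp)
  ultimately show ?thesis
    by (simp add: sum_subtractf euclidean_inner[symmetric])
qed

section \<open>The action with fixed end points on short time intervals\<close>

text \<open>The Lagrangian is kinetic energy plus \<open>W\<close>, so its extremals move in the
  inverted potential -W and obey \<phi>'' = g(\<phi>) with a plus sign. The zero \<open>z\<close> is
  a resting place of no cost and makes finite action possible.\<close>

locale lagrangian =
  fixes W :: "'a::euclidean_space \<Rightarrow> real" and g :: "'a \<Rightarrow> 'a" and L :: real and z :: 'a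
  assumes W_nonneg: "0 \<le> W x" and L_pos: "L > 0"
    and W_deriv: "(W has_derivative (\<lambda>h. g x \<bullet> h)) (at x)"
    and g_lip: "norm (g x - g y) \<le> L * norm (x - y)"
    and W_zero: "W z = 0"
begin

text \<open>The mean value theorem on the segment costs a factor 2 against the sharp remainder
  L/2.\<close>

lemma taylor: "\<bar>W y - W x - g x \<bullet> (y - x)\<bar> \<le> L * (norm (y - x))\<^sup>2"
proof -
  define k where "k = (\<lambda>t::real. W (x + t *\<^sub>R (y - x)))"
  have "(k has_real_derivative g (x + t *\<^sub>R (y - x)) \<bullet> (y - x)) (at t)" for t
  proof -
    have "((\<lambda>t. x + t *\<^sub>R (y - x)) has_derivative (\<lambda>h. h *\<^sub>R (y - x))) (at t)"
      by (auto intro!: derivative_eq_intros)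
    from has_derivative_compose[OF this W_deriv] show ?thesis
      by (simp add: k_def has_field_derivative_def mult_commute_abs)
  qed
  then obtain t where t: "0 < t" "t < 1" "k 1 - k 0 = (1 - 0) * (g (x + t *\<^sub>R (y - x)) \<bullet> (y - x))"
    using MVT2[of 0 1 k "\<lambda>t. g (x + t *\<^sub>R (y - x)) \<bullet> (y - x)"] by auto
  then have "W y - W x - g x \<bullet> (y - x) = (g (x + t *\<^sub>R (y - x)) - g x) \<bullet> (y - x)"
    by (simp add: k_def inner_diff_left)
  also have "\<bar>\<dots>\<bar> \<le> norm (g (x + t *\<^sub>R (y - x)) - g x) * norm (y - x)"
    by (rule Cauchy_Schwarz_ineq2)
  also have "\<dots> \<le> (L * (t * norm (y - x))) * norm (y - x)"
    using g_lip[of "x + t *\<^sub>R (y - x)" x] t by (intro mult_right_mono) auto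
  also have "\<dots> \<le> (L * (1 * norm (y - x))) * norm (y - x)"
    using t L_pos by (intro mult_right_mono mult_left_mono) auto
  finally show ?thesis by (simp add: power2_eq_square mult_ac)
qed

text \<open>A gradient step from \<open>x\<close> cannot lead below the value 0. The step length
  1/(2L) is the one for which \<open>taylor\<close> predicts the largest decrease.\<close>

lemma g_sq_le: "(norm (g x))\<^sup>2 \<le> 4 * L * W x"
proof -
  define y where "y = x - (1 / (2 * L)) *\<^sub>R g x"
  have "\<bar>W y - W x - g x \<bullet> (y - x)\<bar> \<le> L * (norm (y - x))\<^sup>2" by (rule taylor)
  moreover have "g x \<bullet> (y - x) = - ((norm (g x))\<^sup>2 / (2 * L))"
    by (simp add: y_def power2_norm_eq_inner)
  moreover have "L * (norm (y - x))\<^sup>2 = (norm (g x))\<^sup>2 / (4 * L)"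
    using L_pos by (simp add: y_def power_mult_distrib power_divide power2_eq_square)
  ultimately have "0 \<le> W x - (norm (g x))\<^sup>2 / (2 * L) + (norm (g x))\<^sup>2 / (4 * L)"
    using W_nonneg[of y] by linarith
  then show ?thesis using L_pos by (simp add: field_simps)
qed

lemma continuous_on_g: "continuous_on A f \<Longrightarrow> continuous_on A (\<lambda>x. g (f x))"
proof -
  have "continuous_on UNIV g"
    by (rule lipschitz_on_continuous_on[of L], rule lipschitz_onI) (use g_lip L_pos in \<open>auto simp: dist_norm\<close>)
  then show "continuous_on A f \<Longrightarrow> continuous_on A (\<lambda>x. g (f x))"
    by (rule continuous_on_compose2) auto
qed

lemma continuous_on_W: "continuous_on A f \<Longrightarrow> continuous_on A (\<lambda>x. W (f x))"
proof -
  have "continuous_on UNIV W"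
    using W_deriv by (meson has_derivative_continuous_on has_derivative_at_withinI)
  then show "continuous_on A f \<Longrightarrow> continuous_on A (\<lambda>x. W (f x))"
    by (rule continuous_on_compose2) auto
qed

definition action :: "real \<Rightarrow> real \<Rightarrow> (real \<Rightarrow> 'a) \<Rightarrow> (real \<Rightarrow> 'a) \<Rightarrow> real" where
  "action s t \<phi> v = integral {s..t} (\<lambda>x. (norm (v x))\<^sup>2 / 2 + W (\<phi> x))"

lemma action_integrable:
  assumes "primitive_curve \<phi> v" "0 \<le> s"
  shows "set_integrable lborel {s..t} (\<lambda>x. (norm (v x))\<^sup>2 / 2 + W (\<phi> x))"
proof (rule set_integral_add(1))
  show "set_integrable lborel {s..t} (\<lambda>x. (norm (v x))\<^sup>2 / 2)"
    by (rule set_integrable_divide) (rule primitive_curve_sq_integrable[OF assms])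
  have "continuous_on {s..t} \<phi>"
    using primitive_curve_continuous[OF assms(1)] by (rule continuous_on_subset) (use assms in auto)
  then show "set_integrable lborel {s..t} (\<lambda>x. W (\<phi> x))"
    by (intro borel_integrable_atLeastAtMost' continuous_on_W)
qed

text \<open>Derivatives are taken within the interval, hence one-sided at its ends: solutions on
  adjacent intervals are glued only as continuous curves.\<close>

definition solves :: "real \<Rightarrow> real \<Rightarrow> (real \<Rightarrow> 'a) \<Rightarrow> (real \<Rightarrow> 'a) \<Rightarrow> bool" where
  "solves s t \<psi> p \<longleftrightarrow> (\<forall>x\<in>{s..t}. (\<psi> has_vector_derivative p x) (at x within {s..t}) \<and>
      (p has_vector_derivative g (\<psi> x)) (at x within {s..t}))"

lemma solves_continuous:
  assumes "solves s t \<psi> p" shows "continuous_on {s..t} \<psi>" "continuous_on {s..t} p"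
  by (rule continuous_on_vector_derivative; use assms in \<open>auto simp: solves_def\<close>)+

text \<open>The first-order terms vanish after integration by parts, and the Poincare inequality on a short
  interval lets the kinetic energy absorb the second-order remainder of the potential.\<close>

lemma local_minimality:
  assumes \<phi>: "primitive_curve \<phi> v" and st: "0 \<le> s" "s < t" and small: "L * (t - s)\<^sup>2 \<le> 1/4"
    and \<psi>: "solves s t \<psi> p" and ends: "\<psi> s = \<phi> s" "\<psi> t = \<phi> t"
  shows "action s t \<psi> p + 1/4 * integral {s..t} (\<lambda>x. (norm (v x - p x))\<^sup>2) \<le> action s t \<phi> v"
    and "(norm (\<phi> x - \<psi> x))\<^sup>2 \<le> (t - s) * integral {s..t} (\<lambda>x. (norm (v x - p x))\<^sup>2) \<or> x \<notin> {s..t}"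
proof -
  note c\<psi> = solves_continuous[OF \<psi>]
  have st': "s \<le> t" using st by simp
  have c\<phi>: "continuous_on {s..t} \<phi>"
    using primitive_curve_continuous[OF \<phi>] by (rule continuous_on_subset) (use st in auto)
  have d\<psi>: "\<And>x. x \<in> {s..t} \<Longrightarrow> (\<psi> has_vector_derivative p x) (at x within {s..t})"
    "\<And>x. x \<in> {s..t} \<Longrightarrow> (p has_vector_derivative g (\<psi> x)) (at x within {s..t})"
    using \<psi> by (auto simp: solves_def)
  have cg: "continuous_on {s..t} (\<lambda>x. g (\<psi> x))" by (rule continuous_on_g[OF c\<psi>(1)])
  note hk = set_borel_integral_eq_integral(1)
  have iv: "set_integrable lborel {s..t} v" by (rule primitive_curve_integrable[OF \<phi> st(1)])
  have ip: "set_integrable lborel {s..t} p" by (rule borel_integrable_atLeastAtMost'[OF c\<psi>(2)])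
  have iw: "set_integrable lborel {s..t} (\<lambda>x. v x - p x)" by (rule set_integral_diff(1)[OF iv ip])
  have pv: "((\<lambda>x. p x \<bullet> v x) has_integral
    (p t \<bullet> \<phi> t - p s \<bullet> \<phi> s - integral {s..t} (\<lambda>x. g (\<psi> x) \<bullet> \<phi> x))) {s..t}"
    by (rule integral_by_parts_inner[OF \<phi> st(1) st' d\<psi>(2) cg])
  \<comment> \<open>The identity \<open>pv\<close> for \<open>\<psi>\<close> itself. The end values
    agree, so the boundary terms are the same, and the difference of the two identities is the
    vanishing first variation \<open>cross\<close>.\<close>
  have "((\<lambda>x. g (\<psi> x) \<bullet> \<psi> x + p x \<bullet> p x) has_integral p t \<bullet> \<psi> t - p s \<bullet> \<psi> s) {s..t}"
  proof (rule fundamental_theorem_of_calculus[OF st'])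
    fix x assume x: "x \<in> {s..t}"
    show "((\<lambda>x. p x \<bullet> \<psi> x) has_vector_derivative g (\<psi> x) \<bullet> \<psi> x + p x \<bullet> p x) (at x within {s..t})"
      using has_derivative_inner[OF d\<psi>(2)[OF x, unfolded has_vector_derivative_def] d\<psi>(1)[OF x, unfolded has_vector_derivative_def]]
      by (simp add: has_vector_derivative_def algebra_simps)
  qed
  from has_integral_diff[OF this, of "\<lambda>x. g (\<psi> x) \<bullet> \<psi> x"]
  have pp0: "((\<lambda>x. p x \<bullet> p x) has_integral p t \<bullet> \<psi> t - p s \<bullet> \<psi> s - I) {s..t}"
    if "((\<lambda>x. g (\<psi> x) \<bullet> \<psi> x) has_integral I) {s..t}" for I
    using that by simp
  have "((\<lambda>x. g (\<psi> x) \<bullet> \<psi> x) has_integral integral {s..t} (\<lambda>x. g (\<psi> x) \<bullet> \<psi> x)) {s..t}"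
    by (intro integrable_integral integrable_continuous_real continuous_intros cg c\<psi>)
  from pp0[OF this] have pp: "((\<lambda>x. p x \<bullet> p x) has_integral
      (p t \<bullet> \<phi> t - p s \<bullet> \<phi> s - integral {s..t} (\<lambda>x. g (\<psi> x) \<bullet> \<psi> x))) {s..t}"
    using ends by simp
  have gd: "((\<lambda>x. g (\<psi> x) \<bullet> (\<phi> x - \<psi> x)) has_integral
      integral {s..t} (\<lambda>x. g (\<psi> x) \<bullet> \<phi> x) - integral {s..t} (\<lambda>x. g (\<psi> x) \<bullet> \<psi> x)) {s..t}"
    unfolding inner_diff_right
    by (intro has_integral_diff integrable_integral integrable_continuous_real continuous_intros cg c\<psi> c\<phi>)
  have "((\<lambda>x. (p x \<bullet> v x - p x \<bullet> p x) + g (\<psi> x) \<bullet> (\<phi> x - \<psi> x)) has_integral 0) {s..t}"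
    using has_integral_add[OF has_integral_diff[OF pv pp] gd] by simp
  then have cross: "((\<lambda>x. p x \<bullet> (v x - p x) + g (\<psi> x) \<bullet> (\<phi> x - \<psi> x)) has_integral 0) {s..t}"
    by (simp add: inner_diff_right)
  have vv: "(\<lambda>x. (norm (v x))\<^sup>2) integrable_on {s..t}"
    by (rule hk[OF primitive_curve_sq_integrable[OF \<phi> st(1)]])
  have "(\<lambda>x. ((norm (v x))\<^sup>2 - 2 * (p x \<bullet> v x)) + p x \<bullet> p x) integrable_on {s..t}"
    by (intro integrable_add integrable_diff vv integrable_on_mult_right has_integral_integrable[OF pv] has_integral_integrable[OF pp])
  then have ww: "(\<lambda>x. (norm (v x - p x))\<^sup>2) integrable_on {s..t}"
    by (simp add: power2_norm_eq_inner inner_diff_left inner_diff_right inner_commute algebra_simps)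
  define D where "D = integral {s..t} (\<lambda>x. (norm (v x - p x))\<^sup>2)"
  have D0: "0 \<le> D" unfolding D_def by (rule integral_nonneg[OF ww]) auto
  \<comment> \<open>Poincare inequality in pointwise form: the difference of the curves is the
    integral of the difference of the velocities, starting from 0.\<close>
  have near: "(norm (\<phi> x - \<psi> x))\<^sup>2 \<le> (t - s) * D" if x: "x \<in> {s..t}" for x
  proof -
    have sub: "{s..x} \<subseteq> {s..t}" using x by auto
    have isub: "set_integrable lborel {s..x} (\<lambda>x. v x - p x)" "set_integrable lborel {s..x} v" "set_integrable lborel {s..x} p"
      using set_integrable_subset[OF iw _ sub] set_integrable_subset[OF iv _ sub] set_integrable_subset[OF ip _ sub] by auto
    have "integral {s..x} (\<lambda>x. v x - p x) = integral {s..x} v - integral {s..x} p"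
      by (rule Henstock_Kurzweil_Integration.integral_diff; rule hk) (rule isub)+
    moreover have "integral {s..x} v = \<phi> x - \<phi> s"
      using primitive_curve_diff[OF \<phi> st(1)] x by auto
    moreover have "integral {s..x} p = \<psi> x - \<psi> s"
      by (rule integral_unique, rule fundamental_theorem_of_calculus)
        (use x in \<open>auto intro!: has_vector_derivative_within_subset[OF d\<psi>(1) sub]\<close>)
    ultimately have "\<phi> x - \<psi> x = integral {s..x} (\<lambda>x. v x - p x)" using ends by simp
    also have "(norm \<dots>)\<^sup>2 \<le> (x - s) * integral {s..x} (\<lambda>x. (norm (v x - p x))\<^sup>2)"
      using x by (intro norm_integral_sq_le hk[OF isub(1)] hk[OF set_integrable_norm[OF isub(1)]]
          integrable_subinterval_real[OF ww sub]) auto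
    also have "\<dots> \<le> (t - s) * D"
      unfolding D_def using x
      by (intro mult_mono integral_subset_le integral_nonneg integrable_subinterval_real[OF ww] sub ww) auto
    finally show ?thesis .
  qed
  then show "(norm (\<phi> x - \<psi> x))\<^sup>2 \<le> (t - s) * integral {s..t} (\<lambda>x. (norm (v x - p x))\<^sup>2) \<or> x \<notin> {s..t}"
    by (auto simp: D_def)
  have cpp: "(\<lambda>x. (norm (p x))\<^sup>2 / 2 + W (\<psi> x)) integrable_on {s..t}"
    by (intro integrable_continuous_real continuous_intros continuous_on_W c\<psi>) auto
  \<comment> \<open>The remainder of \<open>taylor\<close> is replaced by its pointwise bound
    \<open>L * ((t - s) * D)\<close>. Integrated over the interval it costs at most
    \<open>D / 4\<close>, half of what the kinetic energy supplies.\<close>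
  have rhs: "((\<lambda>x. (((norm (p x))\<^sup>2 / 2 + W (\<psi> x)) + (p x \<bullet> (v x - p x) + g (\<psi> x) \<bullet> (\<phi> x - \<psi> x)))
      + (1/2 * (norm (v x - p x))\<^sup>2 - L * ((t - s) * D))) has_integral
      (action s t \<psi> p + 0) + (1/2 * D - (t - s) * (L * ((t - s) * D)))) {s..t}"
    using has_integral_const_real[of "L * ((t - s) * D)" s t] st unfolding action_def
    by (intro has_integral_add has_integral_diff cross integrable_integral[OF cpp]
        has_integral_mult_right integrable_integral[OF ww, folded D_def]) simp
  have "(action s t \<psi> p + 0) + (1/2 * D - (t - s) * (L * ((t - s) * D))) \<le> action s t \<phi> v"
    unfolding action_def[of s t \<phi>]
  proof (rule has_integral_le[OF rhs])
    show "((\<lambda>x. (norm (v x))\<^sup>2 / 2 + W (\<phi> x)) has_integral integral {s..t} (\<lambda>x. (norm (v x))\<^sup>2 / 2 + W (\<phi> x))) {s..t}"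
      by (rule integrable_integral) (rule hk[OF action_integrable[OF \<phi> st(1)]])
    fix x assume x: "x \<in> {s..t}"
    have "(norm (v x))\<^sup>2 / 2 = (norm (p x))\<^sup>2 / 2 + p x \<bullet> (v x - p x) + 1/2 * (norm (v x - p x))\<^sup>2"
      by (simp add: power2_norm_eq_inner inner_diff_left inner_diff_right inner_commute field_simps)
    moreover have "W (\<phi> x) \<ge> W (\<psi> x) + g (\<psi> x) \<bullet> (\<phi> x - \<psi> x) - L * (norm (\<phi> x - \<psi> x))\<^sup>2"
      using taylor[of "\<phi> x" "\<psi> x"] by linarith
    moreover have "L * (norm (\<phi> x - \<psi> x))\<^sup>2 \<le> L * ((t - s) * D)"
      using near[OF x] L_pos by simp
    ultimately show "(((norm (p x))\<^sup>2 / 2 + W (\<psi> x)) + (p x \<bullet> (v x - p x) + g (\<psi> x) \<bullet> (\<phi> x - \<psi> x)))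
      + (1/2 * (norm (v x - p x))\<^sup>2 - L * ((t - s) * D)) \<le> (norm (v x))\<^sup>2 / 2 + W (\<phi> x)"
      by linarith
  qed
  moreover have "(t - s) * (L * ((t - s) * D)) \<le> 1/4 * D"
    using mult_right_mono[OF small D0] by (simp add: power2_eq_square mult_ac)
  ultimately show "action s t \<psi> p + 1/4 * integral {s..t} (\<lambda>x. (norm (v x - p x))\<^sup>2) \<le> action s t \<phi> v"
    unfolding D_def[symmetric] by linarith
qed


text \<open>Picard iteration in the sup norm for the equation integrated twice, with an affine term
  that restores the end values. The Lipschitz dependence on these values makes the minimal action
  continuous in the nodes; \<open>p\<close> is continuous on the whole line so that it can be glued
  measurably.\<close>

lemma boundary_value_problem:
  assumes ab: "a < b" and small: "L * (b - a)\<^sup>2 \<le> 1/4"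
  obtains u p C where "\<And>x y. solves a b (u x y) (p x y)"
    "\<And>x y. u x y a = x" "\<And>x y. u x y b = y"
    "\<And>x y. continuous_on UNIV (p x y)"
    "\<And>x y x' y' t. t \<in> {a..b} \<Longrightarrow> norm (u x y t - u x' y' t) \<le> C * (norm (x - x') + norm (y - y'))"
    "\<And>x y x' y' t. t \<in> {a..b} \<Longrightarrow> norm (p x y t - p x' y' t) \<le> C * (norm (x - x') + norm (y - y'))"
proof -
  define d where "d = b - a"
  have d: "d > 0" "L * d\<^sup>2 \<le> 1/4" using ab small by (auto simp: d_def)
  \<comment> \<open>Clamps time to the interval: the complete space of bounded continuous functions
    has the whole line as domain.\<close>
  define c where "c = (\<lambda>t. max a (min b t))"
  have c: "c t \<in> {a..b}" for t using ab by (auto simp: c_def)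
  have cid: "c t = t" if "t \<in> {a..b}" for t using that by (auto simp: c_def)
  have cc: "continuous_on UNIV c" unfolding c_def by (intro continuous_intros)
  define I1 where "I1 = (\<lambda>(u :: real \<Rightarrow>\<^sub>C 'a) t. integral {a..t} (\<lambda>\<tau>. g (u \<tau>)))"
  define I2 where "I2 = (\<lambda>u t. integral {a..t} (I1 u))"
  have cu: "continuous_on A (apply_bcontfun u)" for u :: "real \<Rightarrow>\<^sub>C 'a" and A
    by (rule continuous_on_apply_bcontfun)
  have cg: "continuous_on A (\<lambda>\<tau>. g (u \<tau>))" for u :: "real \<Rightarrow>\<^sub>C 'a" and A
    by (rule continuous_on_g[OF cu])
  have d1: "(I1 u has_vector_derivative g (u t)) (at t within {a..b})" if "t \<in> {a..b}" for u t
    unfolding I1_def by (rule integral_has_vector_derivative[OF cg that])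
  have c1: "continuous_on {a..b} (I1 u)" for u by (rule continuous_on_vector_derivative[OF d1])
  have d2: "(I2 u has_vector_derivative I1 u t) (at t within {a..b})" if "t \<in> {a..b}" for u t
    unfolding I2_def by (rule integral_has_vector_derivative[OF c1 that])
  have c2: "continuous_on {a..b} (I2 u)" for u by (rule continuous_on_vector_derivative[OF d2])
  have z: "I1 u a = 0" "I2 u a = 0" for u by (simp_all add: I1_def I2_def)
  have l1: "norm (I1 u t - I1 w t) \<le> L * dist u w * d" if t: "t \<in> {a..b}" for u w t
  proof -
    have "I1 u t - I1 w t = integral {a..t} (\<lambda>\<tau>. g (u \<tau>) - g (w \<tau>))"
      unfolding I1_def
      by (rule Henstock_Kurzweil_Integration.integral_diff[symmetric]) (intro integrable_continuous_real cg)+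
    also have "norm \<dots> \<le> (L * dist u w) * (t - a)"
    proof (rule integral_bound)
      fix \<tau>
      have "norm (g (u \<tau>) - g (w \<tau>)) \<le> L * dist (u \<tau>) (w \<tau>)" unfolding dist_norm by (rule g_lip)
      also have "\<dots> \<le> L * dist u w" using L_pos by (intro mult_left_mono dist_bounded) auto
      finally show "norm (g (u \<tau>) - g (w \<tau>)) \<le> L * dist u w" .
    qed (use t in \<open>auto intro: continuous_on_diff cg\<close>)
    also have "\<dots> \<le> (L * dist u w) * d"
      using t L_pos by (intro mult_left_mono) (auto simp: d_def)
    finally show ?thesis .
  qed
  have l2: "norm (I2 u t - I2 w t) \<le> dist u w / 4" if t: "t \<in> {a..b}" for u w t
  proof -
    have sub: "{a..t} \<subseteq> {a..b}" using t by auto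
    have "I2 u t - I2 w t = integral {a..t} (\<lambda>\<tau>. I1 u \<tau> - I1 w \<tau>)"
      unfolding I2_def
      by (rule Henstock_Kurzweil_Integration.integral_diff[symmetric])
        (intro integrable_continuous_real continuous_on_subset[OF c1 sub])+
    also have "norm \<dots> \<le> (L * dist u w * d) * (t - a)"
      by (rule integral_bound)
        (use t in \<open>auto intro: continuous_on_diff continuous_on_subset[OF c1 sub] l1\<close>)
    also have "\<dots> \<le> (L * dist u w * d) * d"
      using t L_pos d by (intro mult_left_mono) (auto simp: d_def)
    also have "\<dots> = (L * d\<^sup>2) * dist u w" by (simp add: power2_eq_square)
    also have "\<dots> \<le> 1/4 * dist u w" by (rule mult_right_mono[OF d(2)]) simp
    finally show ?thesis by simp
  qed
  \<comment> \<open>The double primitive \<open>I2 u\<close> plus the affine function that makes the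
    values at \<open>a\<close> and \<open>b\<close> equal to \<open>x\<close> and
    \<open>y\<close>.\<close>
  define F where "F = (\<lambda>x y u t. x + ((c t - a) / d) *\<^sub>R (y - x - I2 u b) + I2 u (c t))"
  have cF: "continuous_on UNIV (F x y u)" for x y u
    unfolding F_def using c d by (intro continuous_intros cc continuous_on_compose2[OF c2 cc]) auto
  have bF: "F x y u \<in> bcontfun" for x y u
  proof -
    have "range (F x y u) \<subseteq> F x y u ` {a..b}"
    proof (rule image_subsetI)
      fix t
      have "F x y u t = F x y u (c t)" by (simp add: F_def cid[OF c])
      then show "F x y u t \<in> F x y u ` {a..b}" using c by blast
    qed
    moreover have "bounded (F x y u ` {a..b})"
      by (intro compact_imp_bounded compact_continuous_image continuous_on_subset[OF cF]) auto
    ultimately show ?thesis using cF bounded_subset by (auto simp: bcontfun_def)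
  qed
  \<comment> \<open>One quarter of \<open>dist u w\<close> comes from \<open>I2\<close> at the
    current time and one quarter from its correction at \<open>b\<close>; together they give the
    contraction factor 1/2.\<close>
  have lF: "norm (F x y u t - F x' y' w t) \<le> norm (x - x') + norm (y - y') + dist u w / 2" for x y u x' y' w t
  proof -
    define \<theta> where "\<theta> = (c t - a) / d"
    have \<theta>: "0 \<le> \<theta>" "\<theta> \<le> 1" using c[of t] d by (auto simp: \<theta>_def d_def field_simps)
    have "F x y u t - F x' y' w t = (1 - \<theta>) *\<^sub>R (x - x') + \<theta> *\<^sub>R (y - y') - \<theta> *\<^sub>R (I2 u b - I2 w b) + (I2 u (c t) - I2 w (c t))"
      by (simp add: F_def \<theta>_def[symmetric] algebra_simps)
    also have "norm \<dots> \<le> norm ((1 - \<theta>) *\<^sub>R (x - x')) + norm (\<theta> *\<^sub>R (y - y')) + norm (\<theta> *\<^sub>R (I2 u b - I2 w b)) + norm (I2 u (c t) - I2 w (c t))"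
      by (intro norm_triangle_le norm_triangle_le_diff order_refl add_mono)
    also have "\<dots> \<le> 1 * norm (x - x') + 1 * norm (y - y') + 1 * (dist u w / 4) + dist u w / 4"
      unfolding norm_scaleR using \<theta> l2[of b u w] l2[OF c] ab by (intro add_mono mult_mono) auto
    finally show ?thesis by simp
  qed
  have "\<exists>U. \<forall>t. apply_bcontfun U t = F x y U t" for x y
  proof -
    have "\<exists>!U. Bcontfun (F x y U) = U"
    proof (rule banach_fix_type[of "1/2"])
      show "\<forall>u w. dist (Bcontfun (F x y u)) (Bcontfun (F x y w)) \<le> 1/2 * dist u w"
      proof (intro allI dist_bound)
        fix u w t
        show "dist (Bcontfun (F x y u) t) (Bcontfun (F x y w) t) \<le> 1/2 * dist u w"
          using lF[of x y u t x y w] by (simp add: Bcontfun_inverse[OF bF] dist_norm[of "F x y u t"])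
      qed
    qed auto
    then obtain U where "Bcontfun (F x y U) = U" by blast
    then have "apply_bcontfun U = F x y U" using Bcontfun_inverse[OF bF] by metis
    then show ?thesis by (intro exI[of _ U]) simp
  qed
  then obtain U where U: "\<And>x y t. apply_bcontfun (U x y) t = F x y (U x y) t" by metis
  have lU: "dist (U x y) (U x' y') \<le> 2 * (norm (x - x') + norm (y - y'))" for x y x' y'
  proof -
    have "dist (U x y) (U x' y') \<le> norm (x - x') + norm (y - y') + dist (U x y) (U x' y') / 2"
    proof (rule dist_bound)
      fix t
      show "dist (U x y t) (U x' y' t) \<le> norm (x - x') + norm (y - y') + dist (U x y) (U x' y') / 2"
        unfolding U[of x y t] U[of x' y' t] dist_norm[of "F x y (U x y) t"] by (rule lF)
    qed
    then show ?thesis by simp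
  qed
  define p where "p = (\<lambda>x y t. (1 / d) *\<^sub>R (y - x - I2 (U x y) b) + I1 (U x y) (c t))"
  \<comment> \<open>For the curve the factor is 1 / (1 - 1/2) = 2. For the momentum, 3/2 from the
    slope of the affine term and 1/2 from \<open>I1\<close> add up to 2, both divided by
    \<open>d\<close>.\<close>
  define C where "C = max 2 (2 / d)"
  show thesis
  proof (rule that[of "\<lambda>x y. apply_bcontfun (U x y)" p C])
    fix x y
    show "solves a b (U x y) (p x y)"
      unfolding solves_def
    proof (intro ballI conjI)
      fix t assume t: "t \<in> {a..b}"
      have "((\<lambda>t. x + ((t - a) / d) *\<^sub>R (y - x - I2 (U x y) b) + I2 (U x y) t) has_vector_derivative
         p x y t) (at t within {a..b})"
        by (rule derivative_eq_intros d2[OF t] refl | use d t in \<open>simp add: p_def cid\<close>)+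
      then show "(U x y has_vector_derivative p x y t) (at t within {a..b})"
        by (rule has_vector_derivative_transform[OF t, rotated]) (simp add: U F_def cid)
      have "((\<lambda>t. (1 / d) *\<^sub>R (y - x - I2 (U x y) b) + I1 (U x y) t) has_vector_derivative
         g (U x y t)) (at t within {a..b})"
        by (rule derivative_eq_intros d1[OF t] refl | simp)+
      then show "(p x y has_vector_derivative g (U x y t)) (at t within {a..b})"
        by (rule has_vector_derivative_transform[OF t, rotated]) (simp add: p_def cid)
    qed
    show "U x y a = x" "U x y b = y"
      using ab d by (simp_all add: U F_def c_def z) (simp_all add: d_def)
    show "continuous_on UNIV (p x y)"
      unfolding p_def using c d by (intro continuous_intros continuous_on_compose2[OF c1 cc]) auto
    fix x' y' t assume t: "t \<in> {a..b}"
    define e where "e = norm (x - x') + norm (y - y')"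
    have e: "0 \<le> e" by (simp add: e_def)
    have "norm (U x y t - U x' y' t) \<le> dist (U x y) (U x' y')"
      unfolding dist_norm[symmetric] by (rule dist_bounded)
    also have "\<dots> \<le> 2 * e" using lU by (simp add: e_def)
    also have "\<dots> \<le> C * e" using e by (intro mult_right_mono) (auto simp: C_def)
    finally show "norm (U x y t - U x' y' t) \<le> C * (norm (x - x') + norm (y - y'))" by (simp add: e_def)
    have D: "dist (U x y) (U x' y') \<le> 2 * e" using lU by (simp add: e_def)
    have "p x y t - p x' y' t = (1 / d) *\<^sub>R ((y - y') - (x - x') - (I2 (U x y) b - I2 (U x' y') b)) +
       (I1 (U x y) t - I1 (U x' y') t)"
      using t by (simp add: p_def cid algebra_simps)
    also have "norm \<dots> \<le> norm ((1 / d) *\<^sub>R ((y - y') - (x - x') - (I2 (U x y) b - I2 (U x' y') b))) +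
       norm (I1 (U x y) t - I1 (U x' y') t)"
      by (rule norm_triangle_ineq)
    finally have 1: "norm (p x y t - p x' y' t) \<le> norm ((1 / d) *\<^sub>R ((y - y') - (x - x') - (I2 (U x y) b - I2 (U x' y') b))) +
       norm (I1 (U x y) t - I1 (U x' y') t)" .
    have 2: "norm ((1 / d) *\<^sub>R ((y - y') - (x - x') - (I2 (U x y) b - I2 (U x' y') b))) =
        1 / d * norm ((y - y') - (x - x') - (I2 (U x y) b - I2 (U x' y') b))"
      using d by simp
    have 3: "norm ((y - y') - (x - x') - (I2 (U x y) b - I2 (U x' y') b)) \<le> (norm (y - y') + norm (x - x')) + e / 2"
      by (rule norm_triangle_le_diff, intro add_mono norm_triangle_ineq4)
         (use l2[of b "U x y" "U x' y'"] D ab in auto)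
    have 4: "norm (I1 (U x y) t - I1 (U x' y') t) \<le> e / 2 / d"
    proof -
      have "norm (I1 (U x y) t - I1 (U x' y') t) \<le> L * dist (U x y) (U x' y') * d" by (rule l1[OF t])
      also have "\<dots> \<le> L * (2 * e) * d" using D L_pos d by (intro mult_left_mono mult_right_mono) auto
      also have "\<dots> = (L * d\<^sup>2) * (2 * e) / d" using d by (simp add: power2_eq_square)
      also have "\<dots> \<le> 1/4 * (2 * e) / d" using d e by (intro divide_right_mono mult_right_mono) auto
      finally show ?thesis by simp
    qed
    have "norm (p x y t - p x' y' t) \<le> 1 / d * ((norm (y - y') + norm (x - x')) + e / 2) + e / 2 / d"
      using 1 4 mult_left_mono[OF 3, of "1 / d"] d unfolding 2 by simp
    also have "1 / d * ((norm (y - y') + norm (x - x')) + e / 2) + e / 2 / d = 2 / d * e"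
      using d by (simp add: e_def field_simps)
    also have "\<dots> \<le> C * e" using e by (intro mult_right_mono) (auto simp: C_def)
    finally show "norm (p x y t - p x' y' t) \<le> C * (norm (x - x') + norm (y - y'))"
      by (simp add: e_def)
  qed
qed

end

section \<open>Existence of a minimizer by discretization in time\<close>

text \<open>Coercivity confines each node of a minimizing sequence to a ball, a countable product of
  balls is sequentially compact, and nonnegative terms make the series lower semicontinuous under
  nodewise convergence.\<close>

lemma discrete_minimizer:
  fixes l :: "nat \<Rightarrow> 'a::euclidean_space \<Rightarrow> 'a \<Rightarrow> real"
  assumes nonneg: "\<And>k x y. 0 \<le> l k x y"
    and cont: "\<And>k X Y x y. X \<longlonglongrightarrow> x \<Longrightarrow> Y \<longlonglongrightarrow> y \<Longrightarrow> (\<lambda>n. l k (X n) (Y n)) \<longlonglongrightarrow> l k x y"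
    and coercive: "\<And>k x y. (norm (y - x))\<^sup>2 \<le> K * l k x y" and K: "0 \<le> K"
    and feasible: "X0 0 = x0" "summable (\<lambda>k. l k (X0 k) (X0 (Suc k)))"
  obtains X where "X 0 = x0" "summable (\<lambda>k. l k (X k) (X (Suc k)))"
    "\<And>Y. Y 0 = x0 \<Longrightarrow> summable (\<lambda>k. l k (Y k) (Y (Suc k))) \<Longrightarrow>
       (\<Sum>k. l k (X k) (X (Suc k))) \<le> (\<Sum>k. l k (Y k) (Y (Suc k)))"
proof -
  define A where "A = {X. X 0 = x0 \<and> summable (\<lambda>k. l k (X k) (X (Suc k)))}"
  define S where "S = (\<lambda>X. \<Sum>k. l k (X k) (X (Suc k)))"
  have X0: "X0 \<in> A" using feasible by (simp add: A_def)
  have S0: "0 \<le> S X" if "X \<in> A" for X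
    unfolding S_def by (rule suminf_nonneg) (use that nonneg in \<open>auto simp: A_def\<close>)
  have bdd: "bdd_below (S ` A)" by (rule bdd_belowI2[of _ 0]) (rule S0)
  define m where "m = Inf (S ` A)"
  have mle: "m \<le> S X" if "X \<in> A" for X
    unfolding m_def by (rule cInf_lower) (use that bdd in auto)
  have "\<exists>X\<in>A. S X < m + 1 / real (Suc n)" for n
    using cInf_lessD[of "S ` A" "m + 1 / real (Suc n)"] X0 by (auto simp: m_def)
  then obtain Xs where Xs: "\<And>n. Xs n \<in> A" "\<And>n. S (Xs n) < m + 1 / real (Suc n)" by metis
  \<comment> \<open>Along the minimizing sequence every single term is at most \<open>m + 1\<close>,
    so coercivity bounds each step by \<open>R\<close>, and the node \<open>k\<close> stays within
    \<open>real k * R\<close> of \<open>x0\<close>.\<close>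
  define R where "R = sqrt (K * (m + 1))"
  have m0: "0 \<le> m" unfolding m_def by (rule cInf_greatest) (use X0 S0 in auto)
  have step: "norm (Xs n (Suc k) - Xs n k) \<le> R" for n k
  proof -
    have "l k (Xs n k) (Xs n (Suc k)) = (\<Sum>j\<in>{k}. l j (Xs n j) (Xs n (Suc j)))" by simp
    also have "\<dots> \<le> S (Xs n)"
      unfolding S_def by (rule sum_le_suminf) (use Xs(1)[of n] nonneg in \<open>auto simp: A_def\<close>)
    also have "\<dots> \<le> m + 1"
    proof -
      have "1 / real (Suc n) \<le> 1" by simp
      then show ?thesis using Xs(2)[of n] by linarith
    qed
    finally have "(norm (Xs n (Suc k) - Xs n k))\<^sup>2 \<le> K * (m + 1)"
      using coercive[where x = "Xs n k" and y = "Xs n (Suc k)" and k = k] K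
      by (meson mult_left_mono order_trans)
    then show ?thesis unfolding R_def by (rule real_le_rsqrt)
  qed
  have bound: "norm (Xs n k - x0) \<le> real k * R" for n k
  proof (induction k)
    case 0
    show ?case using Xs(1)[of n] by (simp add: A_def)
  next
    case (Suc k)
    have "norm (Xs n (Suc k) - x0) \<le> norm (Xs n (Suc k) - Xs n k) + norm (Xs n k - x0)"
      using norm_triangle_ineq[of "Xs n (Suc k) - Xs n k" "Xs n k - x0"] by simp
    then show ?case using step[of n k] Suc by (simp add: algebra_simps)
  qed
  define Q where "Q = (\<Pi>\<^sub>E k\<in>UNIV. cball x0 (real k * R))"
  have "compactin (product_topology (\<lambda>_. euclidean) UNIV) Q"
    unfolding Q_def by (subst compactin_PiE) auto
  then have "compact Q" by (simp add: euclidean_product_topology)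
  then have "seq_compact Q" by (simp add: compact_eq_seq_compact_metric)
  moreover have "Xs n \<in> Q" for n
    using bound[of n] by (auto simp: Q_def dist_norm norm_minus_commute)
  ultimately obtain X r where r: "strict_mono (r :: nat \<Rightarrow> nat)" "(Xs \<circ> r) \<longlonglongrightarrow> X"
    by (meson seq_compactE)
  have pt: "(\<lambda>n. Xs (r n) k) \<longlonglongrightarrow> X k" for k
  proof -
    have "continuous_on UNIV (\<lambda>f :: nat \<Rightarrow> 'a. f k)" by (rule continuous_on_product_coordinates)
    then show ?thesis
      using continuous_on_tendsto_compose[OF _ r(2), of UNIV "\<lambda>f. f k"] by (simp add: o_def)
  qed
  have X00: "X 0 = x0"
  proof -
    have "(\<lambda>n. Xs (r n) 0) = (\<lambda>n. x0)" using Xs(1) by (auto simp: A_def)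
    then show ?thesis using pt[of 0] by (simp add: LIMSEQ_const_iff)
  qed
  \<comment> \<open>Only finite sums pass to the limit directly. Each is bounded by the full cost,
    and the bound \<open>m\<close> then carries over to the series.\<close>
  have part: "(\<Sum>k<N. l k (X k) (X (Suc k))) \<le> m" for N
  proof (rule LIMSEQ_le)
    show "(\<lambda>n. \<Sum>k<N. l k (Xs (r n) k) (Xs (r n) (Suc k))) \<longlonglongrightarrow> (\<Sum>k<N. l k (X k) (X (Suc k)))"
      by (intro tendsto_sum cont pt)
    have "(\<lambda>n. m + 1 / real (Suc n)) \<longlonglongrightarrow> m + 0"
      using LIMSEQ_inverse_real_of_nat by (intro tendsto_add) (auto simp: inverse_eq_divide)
    then have "((\<lambda>n. m + 1 / real (Suc n)) \<circ> r) \<longlonglongrightarrow> m + 0"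
      by (rule LIMSEQ_subseq_LIMSEQ[OF _ r(1)])
    then show "(\<lambda>n. m + 1 / real (Suc (r n))) \<longlonglongrightarrow> m" by (simp add: o_def)
    have "(\<Sum>k<N. l k (Xs (r n) k) (Xs (r n) (Suc k))) \<le> m + 1 / real (Suc (r n))" for n
    proof -
      have "(\<Sum>k<N. l k (Xs (r n) k) (Xs (r n) (Suc k))) \<le> S (Xs (r n))"
        unfolding S_def by (rule sum_le_suminf) (use Xs(1)[of "r n"] nonneg in \<open>auto simp: A_def\<close>)
      then show ?thesis using Xs(2)[of "r n"] by linarith
    qed
    then show "\<exists>N'. \<forall>n\<ge>N'. (\<Sum>k<N. l k (Xs (r n) k) (Xs (r n) (Suc k))) \<le> m + 1 / real (Suc (r n))"
      by blast
  qed
  have sX: "summable (\<lambda>k. l k (X k) (X (Suc k)))"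
    by (rule summableI_nonneg_bounded[OF nonneg part])
  have Xm: "(\<Sum>k. l k (X k) (X (Suc k))) \<le> m"
    by (rule suminf_le_const[OF sX part])
  show thesis
  proof (rule that[OF X00 sX])
    fix Y assume "Y 0 = x0" "summable (\<lambda>k. l k (Y k) (Y (Suc k)))"
    then have "m \<le> S Y" by (intro mle) (simp add: A_def)
    then show "(\<Sum>k. l k (X k) (X (Suc k))) \<le> (\<Sum>k. l k (Y k) (Y (Suc k)))"
      using Xm by (simp add: S_def)
  qed
qed

context lagrangian
begin

lemma stationary_curve: "primitive_curve (\<lambda>_. x) (\<lambda>_. 0)"
  by (auto simp: primitive_curve_def set_integrable_def)

lemma action_nonneg:
  assumes "primitive_curve \<phi> v" "0 \<le> s"
  shows "0 \<le> action s t \<phi> v"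
  unfolding action_def
  by (rule integral_nonneg[OF set_borel_integral_eq_integral(1)[OF action_integrable[OF assms]]])
     (simp add: W_nonneg)

lemma action_combine:
  assumes "primitive_curve \<phi> v" "0 \<le> s" "s \<le> t" "t \<le> u"
  shows "action s t \<phi> v + action t u \<phi> v = action s u \<phi> v"
  unfolding action_def
  by (rule Henstock_Kurzweil_Integration.integral_combine[OF assms(3,4)])
     (rule set_borel_integral_eq_integral(1)[OF action_integrable[OF assms(1,2)]])

lemma action_mono:
  assumes "primitive_curve \<phi> v" "0 \<le> s" "s \<le> t" "t \<le> u"
  shows "action s t \<phi> v \<le> action s u \<phi> v"
  using action_combine[OF assms] action_nonneg[OF assms(1), of t u] assms by linarith

lemma action_sum:
  assumes "primitive_curve \<phi> v" "0 \<le> h"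
  shows "(\<Sum>k<N. action (real k * h) (real (Suc k) * h) \<phi> v) = action 0 (real N * h) \<phi> v"
proof (induction N)
  case (Suc N)
  have "action 0 (real N * h) \<phi> v + action (real N * h) (real (Suc N) * h) \<phi> v = action 0 (real (Suc N) * h) \<phi> v"
    by (rule action_combine[OF assms(1)]) (use assms in \<open>auto simp: mult_right_mono\<close>)
  then show ?case using Suc by simp
qed (simp add: action_def)

text \<open>The coercivity required by \<open>discrete_minimizer\<close>: the action dominates the
  kinetic energy, which controls the displacement by Cauchy-Schwarz.\<close>

lemma solves_action_ge:
  assumes ab: "a < b" and s: "solves a b u p"
  shows "(norm (u b - u a))\<^sup>2 \<le> 2 * (b - a) * action a b u p" "0 \<le> action a b u p"
proof -
  note c = solves_continuous[OF s]
  have ip: "(\<lambda>x. (norm (p x))\<^sup>2) integrable_on {a..b}" by (intro integrable_continuous_real continuous_intros c)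
  have iW: "(\<lambda>x. (norm (p x))\<^sup>2 / 2 + W (u x)) integrable_on {a..b}"
    by (intro integrable_continuous_real continuous_intros continuous_on_W c) auto
  show "0 \<le> action a b u p"
    unfolding action_def by (rule integral_nonneg[OF iW]) (simp add: W_nonneg)
  have "u b - u a = integral {a..b} p"
    by (rule integral_unique[symmetric], rule fundamental_theorem_of_calculus)
      (use ab s in \<open>auto simp: solves_def\<close>)
  also have "(norm \<dots>)\<^sup>2 \<le> (b - a) * integral {a..b} (\<lambda>x. (norm (p x))\<^sup>2)"
    using ab by (intro norm_integral_sq_le ip integrable_continuous_real continuous_intros c) auto
  also have "(b - a) * integral {a..b} (\<lambda>x. (norm (p x))\<^sup>2) \<le> (b - a) * (2 * action a b u p)"
  proof (rule mult_left_mono)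
    have "integral {a..b} (\<lambda>x. (norm (p x))\<^sup>2) \<le> integral {a..b} (\<lambda>x. 2 * ((norm (p x))\<^sup>2 / 2 + W (u x)))"
      by (rule integral_le[OF ip integrable_on_mult_right[OF iW]]) (simp add: W_nonneg)
    also have "\<dots> = 2 * action a b u p" by (simp only: action_def integral_mult_right)
    finally show "integral {a..b} (\<lambda>x. (norm (p x))\<^sup>2) \<le> 2 * action a b u p" .
  qed (use ab in simp)
  finally show "(norm (u b - u a))\<^sup>2 \<le> 2 * (b - a) * action a b u p"
    by (simp add: algebra_simps)
qed

text \<open>Continuity of the minimal action in the nodes; the rate \<open>e n\<close> will be the
  Lipschitz bound of \<open>boundary_value_problem\<close>.\<close>

lemma solves_action_tendsto:
  assumes ab: "a < b" and s: "solves a b u p" and sn: "\<And>n. solves a b (un n) (pn n)"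
    and e: "e \<longlonglongrightarrow> 0"
    and un: "\<And>n t. t \<in> {a..b} \<Longrightarrow> norm (un n t - u t) \<le> e n"
    and pn: "\<And>n t. t \<in> {a..b} \<Longrightarrow> norm (pn n t - p t) \<le> e n"
  shows "(\<lambda>n. action a b (un n) (pn n)) \<longlonglongrightarrow> action a b u p"
proof -
  note c = solves_continuous[OF s]
  note cn = solves_continuous[OF sn]
  have e0: "0 \<le> e n" for n using un[of a n] ab norm_ge_zero order_trans by (metis atLeastAtMost_iff less_imp_le order_refl)
  have "bounded (p ` {a..b})" "bounded ((\<lambda>x. g (u x)) ` {a..b})"
    by (intro compact_imp_bounded compact_continuous_image c continuous_on_g; simp)+
  then obtain B1 B2 where "\<And>t. t \<in> {a..b} \<Longrightarrow> norm (p t) \<le> B1" "\<And>t. t \<in> {a..b} \<Longrightarrow> norm (g (u t)) \<le> B2"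
    unfolding bounded_iff by (metis imageI)
  then obtain B where B: "\<And>t. t \<in> {a..b} \<Longrightarrow> norm (p t) \<le> B" "\<And>t. t \<in> {a..b} \<Longrightarrow> norm (g (u t)) \<le> B"
    by (metis max.coboundedI1 max.coboundedI2)
  \<comment> \<open>The first summand bounds the kinetic difference through |a|^2 - |b|^2 = (a - b)
    . (a + b), the second the potential difference through \<open>taylor\<close>.\<close>
  define D where "D = (\<lambda>n. e n * (2 * B + e n) / 2 + (B * e n + L * (e n)\<^sup>2))"
  have iW: "(\<lambda>x. (norm (p x))\<^sup>2 / 2 + W (u x)) integrable_on {a..b}"
    by (intro integrable_continuous_real continuous_intros continuous_on_W c) auto
  have iWn: "(\<lambda>x. (norm (pn n x))\<^sup>2 / 2 + W (un n x)) integrable_on {a..b}" for n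
    by (intro integrable_continuous_real continuous_intros continuous_on_W cn) auto
  have "norm (action a b (un n) (pn n) - action a b u p) \<le> D n * (b - a)" for n
  proof -
    have "action a b (un n) (pn n) - action a b u p =
       integral {a..b} (\<lambda>x. ((norm (pn n x))\<^sup>2 / 2 + W (un n x)) - ((norm (p x))\<^sup>2 / 2 + W (u x)))"
      unfolding action_def by (rule Henstock_Kurzweil_Integration.integral_diff[symmetric, OF iWn iW])
    also have "norm \<dots> \<le> D n * (b - a)"
    proof (rule integral_bound)
      show "continuous_on {a..b} (\<lambda>x. ((norm (pn n x))\<^sup>2 / 2 + W (un n x)) - ((norm (p x))\<^sup>2 / 2 + W (u x)))"
        by (intro continuous_intros continuous_on_W cn c) auto
      fix t assume t: "t \<in> {a..b}"
      have pe: "norm (pn n t - p t) \<le> e n" by (rule pn[OF t])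
      have "\<bar>(norm (pn n t))\<^sup>2 - (norm (p t))\<^sup>2\<bar> = \<bar>(pn n t - p t) \<bullet> (pn n t + p t)\<bar>"
        by (simp add: power2_norm_eq_inner inner_diff_left inner_add_right inner_diff_right inner_commute algebra_simps)
      also have "\<dots> \<le> norm (pn n t - p t) * norm (pn n t + p t)" by (rule Cauchy_Schwarz_ineq2)
      also have "norm (pn n t + p t) \<le> 2 * B + e n"
      proof -
        have "norm (pn n t + p t) \<le> norm (pn n t - p t) + norm (2 *\<^sub>R p t)"
          using norm_triangle_ineq[of "pn n t - p t" "2 *\<^sub>R p t"] by (simp add: scaleR_2)
        then show ?thesis using pe B(1)[OF t] by simp
      qed
      then have "norm (pn n t - p t) * norm (pn n t + p t) \<le> e n * (2 * B + e n)"
        using pe e0[of n] by (intro mult_mono) auto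
      finally have 1: "\<bar>(norm (pn n t))\<^sup>2 - (norm (p t))\<^sup>2\<bar> \<le> e n * (2 * B + e n)" .
      have "\<bar>W (un n t) - W (u t) - g (u t) \<bullet> (un n t - u t)\<bar> \<le> L * (norm (un n t - u t))\<^sup>2"
        by (rule taylor)
      also have "\<dots> \<le> L * (e n)\<^sup>2" using un[OF t] L_pos by (intro mult_left_mono power_mono) auto
      moreover have "\<bar>g (u t) \<bullet> (un n t - u t)\<bar> \<le> B * e n"
        using Cauchy_Schwarz_ineq2[of "g (u t)" "un n t - u t"] mult_mono[OF B(2)[OF t] un[OF t, of n]] B(2)[OF t]
        by (meson norm_ge_zero order_trans)
      ultimately have 2: "\<bar>W (un n t) - W (u t)\<bar> \<le> B * e n + L * (e n)\<^sup>2" by linarith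
      show "norm (((norm (pn n t))\<^sup>2 / 2 + W (un n t)) - ((norm (p t))\<^sup>2 / 2 + W (u t))) \<le> D n"
        using 1 2 unfolding D_def real_norm_def by linarith
    qed (use ab in auto)
    finally show ?thesis .
  qed
  moreover have "(\<lambda>n. D n * (b - a)) \<longlonglongrightarrow> 0"
    unfolding D_def by (rule tendsto_eq_intros e | simp)+
  ultimately have "(\<lambda>n. action a b (un n) (pn n) - action a b u p) \<longlonglongrightarrow> 0"
    by (rule Lim_null_comparison[OF always_eventually[OF allI]])
  then show ?thesis by (rule LIM_zero_cancel)
qed

end

lemma at_within_halfline_nontrivial:
  fixes t :: real assumes "0 \<le> t" shows "at t within {0..} \<noteq> bot"
proof -
  have "at_right t \<le> at t within {0..}" by (rule at_le) (use assms in auto)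
  then show ?thesis using trivial_limit_at_right_real[of t] by (metis bot.extremum_uniqueI)
qed

context lagrangian
begin

text \<open>The total action is described by its upper bounds: actions over [0, T] increase with T,
  so comparing bounds \<open>m\<close> and \<open>m'\<close> compares total actions without improper
  integrals.\<close>

definition minimizing :: "(real \<Rightarrow> 'a) \<Rightarrow> (real \<Rightarrow> 'a) \<Rightarrow> bool" where
  "minimizing \<phi> v \<longleftrightarrow> primitive_curve \<phi> v \<and>
     (\<exists>m. (\<forall>T\<ge>0. action 0 T \<phi> v \<le> m) \<and>
        (\<forall>\<psi> w m'. primitive_curve \<psi> w \<longrightarrow> \<psi> 0 = \<phi> 0 \<longrightarrow> (\<forall>T\<ge>0. action 0 T \<psi> w \<le> m') \<longrightarrow> m \<le> m'))"

lemma small_step: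
  obtains h where "h > 0" "L * h\<^sup>2 \<le> 1/4"
proof
  show "1 / (2 * sqrt L) > 0" using L_pos by simp
  show "L * (1 / (2 * sqrt L))\<^sup>2 \<le> 1/4" using L_pos by (simp add: power_divide power_mult_distrib)
qed

text \<open>With nodes at the multiples of \<open>h\<close>, joining them by boundary value
  solutions never costs more than a given curve through the same nodes. Minimizing over curves is
  thus minimizing over node sequences.\<close>

lemma minimizing_exists: "\<exists>\<phi> v. minimizing \<phi> v \<and> \<phi> 0 = x0"
proof -
  obtain h where h: "h > 0" "L * h\<^sup>2 \<le> 1/4" by (rule small_step)
  define \<tau> where "\<tau> = (\<lambda>k. real k * h)"
  have \<tau>: "\<tau> k < \<tau> (Suc k)" "\<tau> (Suc k) - \<tau> k = h" "0 \<le> \<tau> k" for k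
    using h by (auto simp: \<tau>_def algebra_simps)
  have small: "L * (\<tau> (Suc k) - \<tau> k)\<^sup>2 \<le> 1/4" for k using h \<tau> by simp
  \<comment> \<open>One predicate for all properties, so that a single choice over \<open>k\<close>
    yields \<open>u\<close>, \<open>p\<close> and \<open>C\<close> together.\<close>
  define bvp where "bvp = (\<lambda>k u p C. (\<forall>x y. solves (\<tau> k) (\<tau> (Suc k)) (u x y) (p x y) \<and>
     u x y (\<tau> k) = x \<and> u x y (\<tau> (Suc k)) = y \<and> continuous_on UNIV (p x y)) \<and>
     (\<forall>x y x' y'. \<forall>t\<in>{\<tau> k..\<tau> (Suc k)}. norm (u x y t - u x' y' t) \<le> C * (norm (x - x') + norm (y - y')) \<and>
        norm (p x y t - p x' y' t) \<le> C * (norm (x - x') + norm (y - y'))))"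
  have "\<exists>u p C. bvp k u p C" for k
    unfolding bvp_def using boundary_value_problem[OF \<tau>(1) small] by metis
  then obtain u p C where bvp: "\<And>k. bvp k (u k) (p k) (C k)" by metis
  have S: "solves (\<tau> k) (\<tau> (Suc k)) (u k x y) (p k x y)" for k x y using bvp[of k] by (simp add: bvp_def)
  have ends: "u k x y (\<tau> k) = x" "u k x y (\<tau> (Suc k)) = y" for k x y using bvp[of k] by (auto simp: bvp_def)
  have cp: "continuous_on A (p k x y)" for A k x y
    using bvp[of k] continuous_on_subset[OF _ subset_UNIV] by (auto simp: bvp_def)
  define l where "l = (\<lambda>k x y. action (\<tau> k) (\<tau> (Suc k)) (u k x y) (p k x y))"
  have l0: "0 \<le> l k x y" and lq: "(norm (y - x))\<^sup>2 \<le> (2 * h) * l k x y" for k x y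
    using solves_action_ge[OF \<tau>(1) S[of k x y]] by (simp_all add: l_def ends \<tau>(2))
  have lc: "(\<lambda>n. l k (X n) (Y n)) \<longlonglongrightarrow> l k x y" if "X \<longlonglongrightarrow> x" "Y \<longlonglongrightarrow> y" for k X Y x y
    unfolding l_def
  proof (rule solves_action_tendsto[OF \<tau>(1) S S])
    have "(\<lambda>n. C k * (norm (X n - x) + norm (Y n - y))) \<longlonglongrightarrow> C k * (norm (x - x) + norm (y - y))"
      by (intro tendsto_intros that)
    then show "(\<lambda>n. C k * (norm (X n - x) + norm (Y n - y))) \<longlonglongrightarrow> 0" by simp
    show "norm (u k (X n) (Y n) t - u k x y t) \<le> C k * (norm (X n - x) + norm (Y n - y))"
      "norm (p k (X n) (Y n) t - p k x y t) \<le> C k * (norm (X n - x) + norm (Y n - y))"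
      if "t \<in> {\<tau> k..\<tau> (Suc k)}" for n t
      using bvp[of k] that by (auto simp: bvp_def)
  qed
  have lmin: "l k (\<psi> (\<tau> k)) (\<psi> (\<tau> (Suc k))) \<le> action (\<tau> k) (\<tau> (Suc k)) \<psi> w"
    if \<psi>: "primitive_curve \<psi> w" for k \<psi> w
  proof -
    let ?u = "u k (\<psi> (\<tau> k)) (\<psi> (\<tau> (Suc k)))" and ?p = "p k (\<psi> (\<tau> k)) (\<psi> (\<tau> (Suc k)))"
    have "action (\<tau> k) (\<tau> (Suc k)) ?u ?p + 1/4 * integral {\<tau> k..\<tau> (Suc k)} (\<lambda>x. (norm (w x - ?p x))\<^sup>2)
        \<le> action (\<tau> k) (\<tau> (Suc k)) \<psi> w"
      by (rule local_minimality(1)[OF \<psi> \<tau>(3) \<tau>(1) small S]) (simp_all add: ends)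
    \<comment> \<open>If the integral does not exist its value is 0 by convention, so the sign holds
      in either case.\<close>
    moreover have "0 \<le> integral {\<tau> k..\<tau> (Suc k)} (\<lambda>x. (norm (w x - ?p x))\<^sup>2)"
    proof (cases "(\<lambda>x. (norm (w x - ?p x))\<^sup>2) integrable_on {\<tau> k..\<tau> (Suc k)}")
      case True then show ?thesis by (rule integral_nonneg) simp
    qed (simp add: not_integrable_integral)
    ultimately show ?thesis by (simp add: l_def)
  qed
  have lz: "l k z z = 0" for k
  proof -
    have "l k z z \<le> action (\<tau> k) (\<tau> (Suc k)) (\<lambda>_. z) (\<lambda>_. 0)"
      using lmin[OF stationary_curve[of z]] by simp
    also have "\<dots> = 0" by (simp add: action_def W_zero)
    finally show ?thesis using l0[of k z z] by simp
  qed
  \<comment> \<open>Go to the zero \<open>z\<close> in the first step and rest there: only the first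
    term can be nonzero.\<close>
  define X0 where "X0 = (\<lambda>k::nat. if k = 0 then x0 else z)"
  have f2: "summable (\<lambda>k. l k (X0 k) (X0 (Suc k)))"
    by (rule summable_finite[of "{0}"]) (auto simp: X0_def lz)
  have f1: "X0 0 = x0" by (simp add: X0_def)
  have K0: "0 \<le> 2 * h" using h by simp
  obtain X where X: "X 0 = x0" "summable (\<lambda>k. l k (X k) (X (Suc k)))"
    "\<And>Y. Y 0 = x0 \<Longrightarrow> summable (\<lambda>k. l k (Y k) (Y (Suc k))) \<Longrightarrow>
       (\<Sum>k. l k (X k) (X (Suc k))) \<le> (\<Sum>k. l k (Y k) (Y (Suc k)))"
    by (rule discrete_minimizer[of l, OF l0 lc lq K0 f1 f2]; (assumption | rule that))
  define m where "m = (\<Sum>k. l k (X k) (X (Suc k)))"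
  define \<kappa> where "\<kappa> = (\<lambda>t. nat \<lfloor>t / h\<rfloor>)"
  have \<kappa>: "\<kappa> t = k" if "\<tau> k \<le> t" "t < \<tau> (Suc k)" for t k
  proof -
    have "\<lfloor>t / h\<rfloor> = int k"
      using that h by (intro floor_unique) (auto simp: \<tau>_def field_simps)
    then show ?thesis by (simp add: \<kappa>_def)
  qed
  define q where "q = (\<lambda>k. p k (X k) (X (Suc k)))"
  \<comment> \<open>Near a node the momenta of the two adjacent segments need not match yet.
    Countably many continuous pieces selected by a measurable index still form a Borel
    function.\<close>
  define V where "V = (\<lambda>t. q (\<kappa> t) t)"
  have Vm: "V \<in> borel_measurable borel"
    unfolding V_def
  proof (rule measurable_compose_countable)
    show "q i \<in> borel_measurable borel" for i
      unfolding q_def by (rule borel_measurable_continuous_onI[OF cp])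
    show "\<kappa> \<in> measurable borel (count_space UNIV)" unfolding \<kappa>_def by measurable
  qed
  have Vsq: "set_integrable lborel {0..T} (\<lambda>t. (norm (V t))\<^sup>2)" for T
  proof -
    obtain N :: nat where N: "T / h < real N" using reals_Archimedean2 by blast
    have "\<exists>B. \<forall>t\<in>{0..T}. norm (q k t) \<le> B" for k
    proof -
      have "bounded (q k ` {0..T})"
        unfolding q_def by (intro compact_imp_bounded compact_continuous_image cp) auto
      then show ?thesis unfolding bounded_iff by (meson imageI)
    qed
    then obtain B where B: "\<And>k t. t \<in> {0..T} \<Longrightarrow> norm (q k t) \<le> B k" by metis
    have "norm (V t) \<le> (\<Sum>k\<in>{..N}. \<bar>B k\<bar>)" if t: "t \<in> {0..T}" for t
    proof -
      have "t / h \<le> T / h" using t h by (intro divide_right_mono) auto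
      then have "t / h < real N" using N by linarith
      then have "\<lfloor>t / h\<rfloor> \<le> int N" by linarith
      then have "\<kappa> t \<le> N" by (simp add: \<kappa>_def)
      then have "\<bar>B (\<kappa> t)\<bar> \<le> (\<Sum>k\<in>{..N}. \<bar>B k\<bar>)" by (intro member_le_sum) auto
      moreover have "norm (V t) \<le> B (\<kappa> t)" unfolding V_def by (rule B[OF t])
      ultimately show ?thesis by linarith
    qed
    then have "norm ((norm (V t))\<^sup>2) \<le> (\<Sum>k\<in>{..N}. \<bar>B k\<bar>)\<^sup>2" if "t \<in> {0..T}" for t
      using that by (simp add: power_mono)
    then show ?thesis
      unfolding set_integrable_def using Vm
      by (intro integrableI_bounded_set_indicator[where B = "(\<Sum>k\<in>{..N}. \<bar>B k\<bar>)\<^sup>2"])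
        (auto simp: emeasure_lborel_Icc_eq)
  qed
  define \<phi> where "\<phi> = (\<lambda>t. x0 + integral {0..t} V)"
  have \<phi>V: "primitive_curve \<phi> V"
    using Vm Vsq by (simp add: primitive_curve_def \<phi>_def)
  have \<phi>0: "\<phi> 0 = x0" by (simp add: \<phi>_def)
  \<comment> \<open>At its right end \<open>V\<close> already follows the next segment; a single
    point does not affect the integrals below.\<close>
  have spike: "V t = q k t" if "t \<in> {\<tau> k..\<tau> (Suc k)} - {\<tau> (Suc k)}" for t k
    using that \<kappa>[of k t] by (auto simp: V_def)
  have piece: "\<phi> t = u k (X k) (X (Suc k)) t" if Xk: "\<phi> (\<tau> k) = X k" and t: "t \<in> {\<tau> k..\<tau> (Suc k)}" for k t
  proof -
    have "\<phi> t - \<phi> (\<tau> k) = integral {\<tau> k..t} V"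
      by (rule primitive_curve_diff[OF \<phi>V \<tau>(3)]) (use t in auto)
    also have "\<dots> = integral {\<tau> k..t} (q k)"
      by (rule integral_spike[of "{\<tau> (Suc k)}"]) (use t spike[of _ k] in auto)
    also have "\<dots> = u k (X k) (X (Suc k)) t - u k (X k) (X (Suc k)) (\<tau> k)"
    proof (rule integral_unique, rule fundamental_theorem_of_calculus)
      fix x assume x: "x \<in> {\<tau> k..t}"
      then have "(u k (X k) (X (Suc k)) has_vector_derivative q k x) (at x within {\<tau> k..\<tau> (Suc k)})"
        using S[of k "X k" "X (Suc k)"] t by (auto simp: solves_def q_def)
      then show "(u k (X k) (X (Suc k)) has_vector_derivative q k x) (at x within {\<tau> k..t})"
        by (rule has_vector_derivative_within_subset) (use t in auto)
    qed (use t in auto)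
    finally show ?thesis by (simp add: ends Xk)
  qed
  have node: "\<phi> (\<tau> k) = X k" for k
  proof (induction k)
    case 0
    show ?case by (simp add: \<tau>_def \<phi>0 X)
  next
    case (Suc k)
    then show ?case using piece[of k "\<tau> (Suc k)"] \<tau>(1)[of k] by (simp add: ends)
  qed
  have act: "action (\<tau> k) (\<tau> (Suc k)) \<phi> V = l k (X k) (X (Suc k))" for k
    unfolding action_def l_def
    by (rule integral_spike[of "{\<tau> (Suc k)}"]) (use spike[of _ k] piece[OF node] in \<open>auto simp: q_def\<close>)
  have le_m: "action 0 T \<phi> V \<le> m" if "T \<ge> 0" for T
  proof -
    obtain N :: nat where N: "T / h < real N" using reals_Archimedean2 by blast
    have "action 0 T \<phi> V \<le> action 0 (real N * h) \<phi> V"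
      by (rule action_mono[OF \<phi>V]) (use that N h in \<open>auto simp: field_simps\<close>)
    also have "\<dots> = (\<Sum>k<N. l k (X k) (X (Suc k)))"
      using action_sum[OF \<phi>V, of h N] h act by (simp add: \<tau>_def)
    also have "\<dots> \<le> m" unfolding m_def by (rule sum_le_suminf[OF X(2)]) (use l0 in auto)
    finally show ?thesis .
  qed
  have m_le: "m \<le> m'" if \<psi>: "primitive_curve \<psi> w" "\<psi> 0 = x0" "\<forall>T\<ge>0. action 0 T \<psi> w \<le> m'" for \<psi> w m'
  proof -
    define Y where "Y = (\<lambda>k. \<psi> (\<tau> k))"
    have part: "(\<Sum>k<N. l k (Y k) (Y (Suc k))) \<le> m'" for N
    proof -
      have "(\<Sum>k<N. l k (Y k) (Y (Suc k))) \<le> (\<Sum>k<N. action (\<tau> k) (\<tau> (Suc k)) \<psi> w)"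
        unfolding Y_def by (intro sum_mono lmin \<psi>)
      also have "\<dots> = action 0 (real N * h) \<psi> w"
        unfolding \<tau>_def using h by (intro action_sum[OF \<psi>(1)]) auto
      also have "\<dots> \<le> m'" using \<psi>(3) h by simp
      finally show ?thesis .
    qed
    have sY: "summable (\<lambda>k. l k (Y k) (Y (Suc k)))"
      by (rule summableI_nonneg_bounded[OF l0 part])
    have "m \<le> (\<Sum>k. l k (Y k) (Y (Suc k)))"
      unfolding m_def by (rule X(3)[OF _ sY]) (simp add: Y_def \<tau>_def \<psi>)
    also have "\<dots> \<le> m'" by (rule suminf_le_const[OF sY part])
    finally show ?thesis .
  qed
  show ?thesis
    unfolding minimizing_def using \<phi>V \<phi>0 le_m m_le by blast
qed

section \<open>Minimizers solve the Euler-Lagrange equation\<close>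

text \<open>The surgery is done on the velocity. Since \<open>u\<close> has the displacement of
  \<open>\<phi>\<close> over the segment, the new primitive joins \<open>\<phi>\<close> again at
  \<open>e\<close>, and the action changes only on the segment.\<close>

lemma replace_segment:
  assumes \<phi>: "primitive_curve \<phi> v" and st: "0 \<le> s" "s < e"
    and u: "solves s e u p" "continuous_on UNIV p" and ends: "u s = \<phi> s" "u e = \<phi> e"
  obtains \<psi> w where "primitive_curve \<psi> w" "\<psi> 0 = \<phi> 0"
    "\<And>T. T \<ge> e \<Longrightarrow> action 0 T \<psi> w = action 0 T \<phi> v - action s e \<phi> v + action s e u p"
proof -
  note vm[measurable] = primitive_curve_measurable[OF \<phi>]
  have pm[measurable]: "p \<in> borel_measurable borel" by (rule borel_measurable_continuous_onI[OF u(2)])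
  define w where "w = (\<lambda>t. if t \<in> {s..<e} then p t else v t)"
  have wm[measurable]: "w \<in> borel_measurable borel" unfolding w_def by measurable
  have wsq: "set_integrable lborel {0..T} (\<lambda>t. (norm (w t))\<^sup>2)" for T
  proof (rule set_integrable_bound)
    have "continuous_on {0..T} p" using u(2) by (rule continuous_on_subset) auto
    then have "continuous_on {0..T} (\<lambda>t. (norm (p t))\<^sup>2)" by (intro continuous_intros)
    then have "set_integrable lborel {0..T} (\<lambda>t. (norm (p t))\<^sup>2)"
      by (rule borel_integrable_atLeastAtMost')
    then show "set_integrable lborel {0..T} (\<lambda>t. (norm (v t))\<^sup>2 + (norm (p t))\<^sup>2)"
      using primitive_curve_sq_integrable[OF \<phi>, of 0 T] by (intro set_integral_add) auto
    show "set_borel_measurable lborel {0..T} (\<lambda>t. (norm (w t))\<^sup>2)"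
      unfolding set_borel_measurable_def by measurable
  qed (auto simp: w_def)
  define \<psi> where "\<psi> = (\<lambda>t. \<phi> 0 + integral {0..t} w)"
  have \<psi>w: "primitive_curve \<psi> w" using wm wsq by (simp add: primitive_curve_def \<psi>_def)
  have \<psi>0: "\<psi> 0 = \<phi> 0" by (simp add: \<psi>_def)
  have w1: "w t = v t" if "t \<in> {0..s} - {s}" for t using that by (auto simp: w_def)
  have w2: "w t = p t" if "t \<in> {s..e} - {e}" for t using that by (auto simp: w_def)
  have w3: "w t = v t" if "t \<ge> e" for t using that by (auto simp: w_def)
  have 1: "\<psi> t = \<phi> t" if "t \<in> {0..s}" for t
  proof -
    have "\<psi> t - \<psi> 0 = integral {0..t} w" by (rule primitive_curve_diff[OF \<psi>w]) (use that in auto)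
    also have "\<dots> = integral {0..t} v"
      by (rule integral_spike[of "{s}"]) (use that w1 in auto)
    also have "\<dots> = \<phi> t - \<phi> 0" using primitive_curve_diff[OF \<phi>, of 0 t] that by simp
    finally show ?thesis using \<psi>0 by simp
  qed
  have 2: "\<psi> t = u t" if t: "t \<in> {s..e}" for t
  proof -
    have "\<psi> t - \<psi> s = integral {s..t} w" by (rule primitive_curve_diff[OF \<psi>w st(1)]) (use t in auto)
    also have "\<dots> = integral {s..t} p"
      by (rule integral_spike[of "{e}"]) (use t w2 in auto)
    also have "\<dots> = u t - u s"
    proof (rule integral_unique, rule fundamental_theorem_of_calculus)
      fix x assume x: "x \<in> {s..t}"
      then have "(u has_vector_derivative p x) (at x within {s..e})"
        using u(1) t by (auto simp: solves_def)
      then show "(u has_vector_derivative p x) (at x within {s..t})"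
        by (rule has_vector_derivative_within_subset) (use t in auto)
    qed (use t in auto)
    finally show ?thesis using 1[of s] st ends by simp
  qed
  have 3: "\<psi> t = \<phi> t" if "t \<ge> e" for t
  proof -
    have "\<psi> t - \<psi> e = integral {e..t} w" by (rule primitive_curve_diff[OF \<psi>w]) (use that st in auto)
    also have "\<dots> = integral {e..t} v"
      by (rule Henstock_Kurzweil_Integration.integral_cong) (use w3 in auto)
    also have "\<dots> = \<phi> t - \<phi> e" using primitive_curve_diff[OF \<phi>, of e t] that st by simp
    finally show ?thesis using 2[of e] st ends by simp
  qed
  show thesis
  proof (rule that[OF \<psi>w \<psi>0])
    fix T assume T: "T \<ge> e"
    have "action 0 s \<psi> w = action 0 s \<phi> v"
      unfolding action_def by (rule integral_spike[of "{s}"]) (use w1 1 in auto)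
    moreover have "action s e \<psi> w = action s e u p"
      unfolding action_def by (rule integral_spike[of "{e}"]) (use w2 2 in auto)
    moreover have "action e T \<psi> w = action e T \<phi> v"
      unfolding action_def by (rule Henstock_Kurzweil_Integration.integral_cong) (use w3 3 in auto)
    moreover have "action 0 s f y + action s e f y + action e T f y = action 0 T f y"
      if "primitive_curve f y" for f y
      using action_combine[OF that, of 0 s e] action_combine[OF that, of 0 e T] st T by simp
    note this[OF \<psi>w] this[OF \<phi>]
    ultimately show "action 0 T \<psi> w = action 0 T \<phi> v - action s e \<phi> v + action s e u p"
      by linarith
  qed
qed

text \<open>Replacing a short segment by the boundary value solution saves at least a quarter of the
  squared L2 distance \<open>D\<close> of the velocities. A minimizer leaves nothing to save, so
  \<open>D\<close> is not positive and the curves coincide.\<close>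

lemma minimizing_solves_locally:
  assumes min: "minimizing \<phi> v" and h: "h > 0" "L * h\<^sup>2 \<le> 1/4" and s: "0 \<le> s"
  obtains p where "solves s (s + h) \<phi> p"
proof -
  have \<phi>: "primitive_curve \<phi> v" using min by (simp add: minimizing_def)
  obtain m where m: "\<And>T. T \<ge> 0 \<Longrightarrow> action 0 T \<phi> v \<le> m"
    "\<And>\<psi> w m'. primitive_curve \<psi> w \<Longrightarrow> \<psi> 0 = \<phi> 0 \<Longrightarrow> \<forall>T\<ge>0. action 0 T \<psi> w \<le> m' \<Longrightarrow> m \<le> m'"
    using min unfolding minimizing_def by blast
  have small: "L * (s + h - s)\<^sup>2 \<le> 1/4" and se: "s < s + h" using h by auto
  obtain U P where "\<And>x y. solves s (s + h) (U x y) (P x y)" "\<And>x y. U x y s = (x::'a)" "\<And>x y. U x y (s + h) = (y::'a)"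
    "\<And>x y. continuous_on UNIV (P x y)"
    using boundary_value_problem[OF se small] by metis
  then obtain u p where u: "solves s (s + h) u p" "u s = \<phi> s" "u (s + h) = \<phi> (s + h)" "continuous_on UNIV p"
    by metis
  define D where "D = integral {s..s + h} (\<lambda>x. (norm (v x - p x))\<^sup>2)"
  have lm: "action s (s + h) u p + 1/4 * D \<le> action s (s + h) \<phi> v"
    and near: "\<And>x. (norm (\<phi> x - u x))\<^sup>2 \<le> (s + h - s) * D \<or> x \<notin> {s..s + h}"
    unfolding D_def using local_minimality[OF \<phi> s se small u(1-3)] by blast+
  obtain \<psi> w where \<psi>: "primitive_curve \<psi> w" "\<psi> 0 = \<phi> 0"
    "\<And>T. T \<ge> s + h \<Longrightarrow> action 0 T \<psi> w = action 0 T \<phi> v - action s (s + h) \<phi> v + action s (s + h) u p"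
    using replace_segment[OF \<phi> s se u(1,4,2,3)] by metis
  have "m \<le> m - 1/4 * D"
  proof (rule m(2)[OF \<psi>(1,2)], intro allI impI)
    fix T :: real assume T: "T \<ge> 0"
    \<comment> \<open>The surgery formula holds from \<open>s + h\<close> on; enlarging the horizon
      can only increase the action.\<close>
    have "action 0 T \<psi> w \<le> action 0 (T + (s + h)) \<psi> w"
      by (rule action_mono[OF \<psi>(1)]) (use T s h in auto)
    also have "\<dots> \<le> action 0 (T + (s + h)) \<phi> v - 1/4 * D" using \<psi>(3)[of "T + (s + h)"] lm T by simp
    also have "\<dots> \<le> m - 1/4 * D" using m(1)[of "T + (s + h)"] T s h by simp
    finally show "action 0 T \<psi> w \<le> m - 1/4 * D" .
  qed
  then have "h * D \<le> 0" using h by (simp add: mult_nonneg_nonpos)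
  then have eq: "\<phi> x = u x" if "x \<in> {s..s + h}" for x
    using near[of x] that by (auto dest: order_trans)
  have "solves s (s + h) \<phi> p"
    unfolding solves_def
  proof (intro ballI conjI)
    fix x assume x: "x \<in> {s..s + h}"
    have d: "(u has_vector_derivative p x) (at x within {s..s + h})" "(p has_vector_derivative g (u x)) (at x within {s..s + h})"
      using u(1) x by (auto simp: solves_def)
    show "(\<phi> has_vector_derivative p x) (at x within {s..s + h})"
      by (rule has_vector_derivative_transform[OF x _ d(1)]) (simp add: eq)
    show "(p has_vector_derivative g (\<phi> x)) (at x within {s..s + h})"
      using d(2) eq[OF x] by simp
  qed
  then show thesis by (rule that)
qed

text \<open>Momenta from overlapping windows agree because each is the derivative of
  \<open>\<phi>\<close> within \<open>{0..}\<close>. The global \<open>P\<close> is therefore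
  defined as this derivative, with no gluing.\<close>

lemma minimizing_euler_lagrange:
  assumes min: "minimizing \<phi> v"
  obtains P where "\<And>t. t \<ge> 0 \<Longrightarrow> (\<phi> has_vector_derivative P t) (at t within {0..})"
    "\<And>t. t \<ge> 0 \<Longrightarrow> (P has_vector_derivative g (\<phi> t)) (at t within {0..})"
proof -
  obtain h where h: "h > 0" "L * h\<^sup>2 \<le> 1/4" by (rule small_step)
  define P where "P = (\<lambda>t. vector_derivative \<phi> (at t within {0..}))"
  have loc: "(\<phi> has_vector_derivative P t) (at t within {0..}) \<and>
      (P has_vector_derivative g (\<phi> t)) (at t within {0..})" if t: "t \<ge> 0" for t
  proof -
    \<comment> \<open>The window is centred at \<open>t\<close> when possible. Only for
      \<open>t = 0\<close> does \<open>t\<close> become its left end.\<close>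
    define s where "s = max 0 (t - h / 2)"
    have s: "0 \<le> s" "s < t \<or> s = t \<and> s = 0" "t < s + h" using t h by (auto simp: s_def)
    obtain p where p: "solves s (s + h) \<phi> p" by (rule minimizing_solves_locally[OF min h s(1)])
    have eq: "(\<phi> has_vector_derivative p x) (at x within {0..})" "(p has_vector_derivative g (\<phi> x)) (at x within {0..})" "P x = p x"
      if x: "s < x \<or> s = x \<and> s = 0" "x < s + h" for x
    proof -
      have at: "at x within {s..s + h} = at x within {0..}"
        by (rule at_within_halfline[OF x(1) s(1) x(2)])
      show "(\<phi> has_vector_derivative p x) (at x within {0..})" "(p has_vector_derivative g (\<phi> x)) (at x within {0..})"
        using p x unfolding solves_def at[symmetric] by auto
      then show "P x = p x"
        unfolding P_def using x s by (intro vector_derivative_within at_within_halfline_nontrivial) auto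
    qed
    \<comment> \<open>A radius on which \<open>p\<close> and \<open>P\<close> agree; at time 0 only
      the right side counts, so the whole window qualifies.\<close>
    define d where "d = (if s < t then min (t - s) (s + h - t) else h)"
    have d: "d > 0" using s h by (auto simp: d_def)
    have "(P has_vector_derivative g (\<phi> t)) (at t within {0..})"
    proof (rule has_vector_derivative_transform_within[OF eq(2)[OF s(2,3)] d])
      fix x assume x: "x \<in> {0..}" "dist x t < d"
      have "s < x \<or> s = x \<and> s = 0" "x < s + h"
        using x s by (auto simp: d_def dist_real_def split: if_splits)
      then show "p x = P x" using eq(3) by simp
    qed (use t in auto)
    then show ?thesis using eq(1,3)[OF s(2,3)] by simp
  qed
  then show thesis using that by blast
qed

end

section \<open>Convergence and comparison on the half-line\<close>

lemma tendsto_at_top_cauchyI: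
  fixes f :: "real \<Rightarrow> 'a::complete_space"
  assumes "\<And>e. e > 0 \<Longrightarrow> \<exists>T. \<forall>s\<ge>T. \<forall>t\<ge>T. dist (f s) (f t) < e"
  shows "\<exists>l. (f \<longlongrightarrow> l) at_top"
proof -
  have "Cauchy (\<lambda>n::nat. f (real n))"
  proof (rule metric_CauchyI)
    fix e :: real assume "e > 0"
    then obtain T where T: "\<forall>s\<ge>T. \<forall>t\<ge>T. dist (f s) (f t) < e" using assms by blast
    obtain N :: nat where "T \<le> real N" using real_arch_simple by blast
    then show "\<exists>M. \<forall>m\<ge>M. \<forall>n\<ge>M. dist (f (real m)) (f (real n)) < e"
      using T by (intro exI[of _ N]) auto
  qed
  then obtain l where l: "(\<lambda>n. f (real n)) \<longlonglongrightarrow> l" using Cauchy_convergent convergent_def by blast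
  have "(f \<longlongrightarrow> l) at_top"
  proof (rule tendstoI)
    fix e :: real assume e: "e > 0"
    then obtain T where T: "\<forall>s\<ge>T. \<forall>t\<ge>T. dist (f s) (f t) < e / 2"
      using assms[of "e / 2"] by auto
    obtain N where N: "\<And>n. n \<ge> N \<Longrightarrow> dist (f (real n)) l < e / 2"
      using metric_LIMSEQ_D[OF l, of "e / 2"] e by auto
    obtain M :: nat where M: "T \<le> real M" using real_arch_simple by blast
    have "dist (f t) l < e" if "t \<ge> T" for t
    proof -
      have "dist (f t) (f (real (max N M))) < e / 2" using T that M by auto
      moreover have "dist (f (real (max N M))) l < e / 2" using N by simp
      ultimately show ?thesis using dist_triangle[of "f t" l "f (real (max N M))"] by linarith
    qed
    then show "\<forall>\<^sub>F x in at_top. dist (f x) l < e" by (rule eventually_at_top_linorderI)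
  qed
  then show ?thesis by blast
qed

lemma halfline_nondecreasing:
  fixes f f' :: "real \<Rightarrow> real"
  assumes d: "\<And>x. x \<ge> s \<Longrightarrow> (f has_real_derivative f' x) (at x within {0..})"
    and nonneg: "\<And>x. x \<ge> s \<Longrightarrow> 0 \<le> f' x" and st: "0 \<le> s" "s \<le> t"
  shows "f s \<le> f t"
proof (rule DERIV_nonneg_imp_increasing_open[OF st(2)])
  have "continuous_on {s..} f"
    by (rule DERIV_continuous_on, rule DERIV_subset, rule d) (use st in auto)
  then show "continuous_on {s..t} f" by (rule continuous_on_subset) auto
  fix x assume x: "s < x" "x < t"
  then have "at x within {0..} = at x" by (intro at_within_interior) (use st in auto)
  then show "\<exists>y. (f has_real_derivative y) (at x) \<and> 0 \<le> y"
    using d[of x] nonneg[of x] x by auto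
qed

text \<open>Multiplication by exp (- \<kappa> t) gives a nondecreasing function. The sign of
  \<kappa> is free: growth and bounded loss are both instances.\<close>

lemma exponential_growth_comparison:
  fixes u u' :: "real \<Rightarrow> real"
  assumes u: "\<And>t. t \<ge> s \<Longrightarrow> (u has_real_derivative u' t) (at t within {0..})"
    and ge: "\<And>t. t \<ge> s \<Longrightarrow> u' t \<ge> \<kappa> * u t" and st: "0 \<le> s" "s \<le> t"
  shows "u s * exp (\<kappa> * (t - s)) \<le> u t"
proof -
  have "u s * exp (- \<kappa> * s) \<le> u t * exp (- \<kappa> * t)"
  proof (rule halfline_nondecreasing[OF _ _ st])
    fix x assume x: "x \<ge> s"
    show "((\<lambda>x. u x * exp (- \<kappa> * x)) has_real_derivative (u' x - \<kappa> * u x) * exp (- \<kappa> * x)) (at x within {0..})"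
      by (auto intro!: derivative_eq_intros u x simp: algebra_simps)
    show "0 \<le> (u' x - \<kappa> * u x) * exp (- \<kappa> * x)" using ge[OF x] by simp
  qed
  then have "u s * exp (- \<kappa> * s) * exp (\<kappa> * t) \<le> u t * exp (- \<kappa> * t) * exp (\<kappa> * t)"
    by (rule mult_right_mono) simp
  then show ?thesis
    by (simp add: mult.assoc exp_add[symmetric] algebra_simps)
qed

text \<open>Factor the second order operator: q = w' + \<mu> w satisfies q' >= \<mu> q, so a
  positive value of q could never decrease to the limit 0. Hence w' <= - \<mu> w.\<close>

lemma second_order_exponential_decay:
  fixes w w' w'' :: "real \<Rightarrow> real"
  assumes w: "\<And>t. t \<ge> T \<Longrightarrow> (w has_real_derivative w' t) (at t within {0..})"
    and w': "\<And>t. t \<ge> T \<Longrightarrow> (w' has_real_derivative w'' t) (at t within {0..})"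
    and ge: "\<And>t. t \<ge> T \<Longrightarrow> w'' t \<ge> \<mu>\<^sup>2 * w t" and \<mu>: "\<mu> > 0" and T: "T \<ge> 0"
    and lim: "(w \<longlongrightarrow> 0) at_top" "(w' \<longlongrightarrow> 0) at_top" and t: "t \<ge> T"
  shows "w t \<le> w T * exp (- \<mu> * (t - T))"
proof -
  have q: "w' s + \<mu> * w s \<le> 0" if s: "s \<ge> T" for s
  proof (rule ccontr)
    assume "\<not> w' s + \<mu> * w s \<le> 0"
    then have pos: "0 < w' s + \<mu> * w s" by simp
    have "((\<lambda>x. w' x + \<mu> * w x) \<longlongrightarrow> 0 + \<mu> * 0) at_top"
      by (intro tendsto_intros lim)
    then have "((\<lambda>x. w' x + \<mu> * w x) \<longlongrightarrow> 0) at_top" by simp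
    then have "\<forall>\<^sub>F x in at_top. w' x + \<mu> * w x < w' s + \<mu> * w s"
      using pos by (rule order_tendstoD(2))
    then obtain x where x: "x \<ge> s" "w' x + \<mu> * w x < w' s + \<mu> * w s"
      unfolding eventually_at_top_linorder by (metis max.cobounded1 max.cobounded2)
    have "(w' s + \<mu> * w s) * exp (\<mu> * (x - s)) \<le> w' x + \<mu> * w x"
    proof (rule exponential_growth_comparison[of s "\<lambda>x. w' x + \<mu> * w x" "\<lambda>x. w'' x + \<mu> * w' x"])
      fix y assume y: "y \<ge> s"
      then have y': "y \<ge> T" using s by simp
      show "((\<lambda>x. w' x + \<mu> * w x) has_real_derivative w'' y + \<mu> * w' y) (at y within {0..})"
        by (auto intro!: derivative_eq_intros w w' y')
      show "\<mu> * (w' y + \<mu> * w y) \<le> w'' y + \<mu> * w' y"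
        using ge[OF y'] by (simp add: algebra_simps power2_eq_square)
    qed (use s T x in auto)
    from order_trans[OF _ this] have "w' s + \<mu> * w s \<le> w' x + \<mu> * w x"
      if "(w' s + \<mu> * w s) * 1 \<le> (w' s + \<mu> * w s) * exp (\<mu> * (x - s))" using that by simp
    moreover have "(w' s + \<mu> * w s) * 1 \<le> (w' s + \<mu> * w s) * exp (\<mu> * (x - s))"
      using pos \<mu> x by (intro mult_left_mono) auto
    ultimately show False using x(2) by simp
  qed
  have "- w T * exp (- \<mu> * (t - T)) \<le> - w t"
  proof (rule exponential_growth_comparison[of T "\<lambda>x. - w x" "\<lambda>x. - w' x"])
    fix y assume y: "y \<ge> T"
    show "((\<lambda>x. - w x) has_real_derivative - w' y) (at y within {0..})"
      by (auto intro!: derivative_eq_intros w y)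
    show "- \<mu> * - w y \<le> - w' y" using q[OF y] by simp
  qed (use T t in auto)
  then show ?thesis by simp
qed

text \<open>The speed is integrated over [t, s] and s tends to infinity, whence the factor
  1/\<nu>.\<close>

lemma tendsto_exponential_rate:
  fixes \<phi> P :: "real \<Rightarrow> 'a::euclidean_space"
  assumes \<phi>: "\<And>t. t \<ge> 0 \<Longrightarrow> (\<phi> has_vector_derivative P t) (at t within {0..})"
    and P: "\<And>t. t \<ge> 0 \<Longrightarrow> norm (P t) \<le> C * exp (- \<nu> * t)" and \<nu>: "\<nu> > 0"
    and lim: "(\<phi> \<longlongrightarrow> l) at_top" and t: "t \<ge> 0"
  shows "norm (\<phi> t - l) \<le> C / \<nu> * exp (- \<nu> * t)"
proof -
  have C: "0 \<le> C" using order_trans[OF norm_ge_zero P[of 0]] by simp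
  have "norm (\<phi> t - \<phi> s) \<le> C / \<nu> * exp (- \<nu> * t)" if s: "s \<ge> t" for s
  proof -
    have I: "(P has_integral (\<phi> s - \<phi> t)) {t..s}"
    proof (rule fundamental_theorem_of_calculus[OF s])
      fix x assume "x \<in> {t..s}"
      then show "(\<phi> has_vector_derivative P x) (at x within {t..s})"
        using t by (intro has_vector_derivative_within_subset[OF \<phi>]) auto
    qed
    have J: "((\<lambda>x. C * exp (- \<nu> * x)) has_integral (- (C / \<nu>) * exp (- \<nu> * s) - - (C / \<nu>) * exp (- \<nu> * t))) {t..s}"
    proof (rule fundamental_theorem_of_calculus[OF s])
      fix x
      have "((\<lambda>x. - (C / \<nu>) * exp (- \<nu> * x)) has_real_derivative C * exp (- \<nu> * x)) (at x within {t..s})"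
        using \<nu> by (auto intro!: derivative_eq_intros)
      then show "((\<lambda>x. - (C / \<nu>) * exp (- \<nu> * x)) has_vector_derivative C * exp (- \<nu> * x)) (at x within {t..s})"
        by (simp add: has_real_derivative_iff_has_vector_derivative)
    qed
    have "norm (\<phi> s - \<phi> t) \<le> integral {t..s} (\<lambda>x. C * exp (- \<nu> * x))"
      unfolding integral_unique[OF I, symmetric]
      by (rule integral_norm_bound_integral[OF has_integral_integrable[OF I] has_integral_integrable[OF J]])
        (use P t in auto)
    also have "\<dots> \<le> C / \<nu> * exp (- \<nu> * t)"
      unfolding integral_unique[OF J] using C \<nu> by simp
    finally show ?thesis by (simp add: norm_minus_commute)
  qed
  then have ev: "\<forall>\<^sub>F s in at_top. norm (\<phi> t - \<phi> s) \<le> C / \<nu> * exp (- \<nu> * t)"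
    by (rule eventually_at_top_linorderI)
  have "((\<lambda>s. norm (\<phi> t - \<phi> s)) \<longlongrightarrow> norm (\<phi> t - l)) at_top"
    by (intro tendsto_intros lim)
  then show ?thesis by (rule tendsto_upperbound[OF _ ev]) simp
qed

section \<open>Asymptotics of solutions with finite action\<close>

context lagrangian
begin

lemma W_along_curve_derivative:
  assumes "(\<phi> has_vector_derivative P) (at t within S)"
  shows "((\<lambda>t. W (\<phi> t)) has_real_derivative g (\<phi> t) \<bullet> P) (at t within S)"
  using has_derivative_compose[OF assms[unfolded has_vector_derivative_def] W_deriv]
  by (simp add: has_field_derivative_def mult_commute_abs)

context
  fixes \<phi> P :: "real \<Rightarrow> 'a" and m :: real
  assumes \<phi>: "\<And>t. t \<ge> 0 \<Longrightarrow> (\<phi> has_vector_derivative P t) (at t within {0..})"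
    and P: "\<And>t. t \<ge> 0 \<Longrightarrow> (P has_vector_derivative g (\<phi> t)) (at t within {0..})"
    and m: "\<And>T. T \<ge> 0 \<Longrightarrow> action 0 T \<phi> P \<le> m"
begin

lemma curve_continuous: "continuous_on {0..} \<phi>" "continuous_on {0..} P"
  by (rule continuous_on_vector_derivative, use \<phi> P in force)+

lemma lagrangian_integrable:
  "0 \<le> s \<Longrightarrow> (\<lambda>x. (norm (P x))\<^sup>2 / 2 + W (\<phi> x)) integrable_on {s..T}"
  by (intro integrable_continuous_real continuous_intros continuous_on_W
      continuous_on_subset[OF curve_continuous(1)] continuous_on_subset[OF curve_continuous(2)]) auto

text \<open>In the inverted potential the conserved energy is |P|^2/2 - W. Its absolute value is at
  most the Lagrangian, whose integral stays bounded as the horizon grows.\<close>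

lemma zero_energy:
  assumes t: "t \<ge> 0" shows "(norm (P t))\<^sup>2 = 2 * W (\<phi> t)"
proof -
  define E where "E = (\<lambda>t. (P t \<bullet> P t) / 2 - W (\<phi> t))"
  have "(E has_real_derivative 0) (at x within {0..})" if "x \<in> {0..}" for x
  proof -
    have x: "x \<ge> 0" using that by simp
    have "((\<lambda>x. P x \<bullet> P x) has_real_derivative 2 * (g (\<phi> x) \<bullet> P x)) (at x within {0..})"
      using has_derivative_inner[OF P[OF x, unfolded has_vector_derivative_def] P[OF x, unfolded has_vector_derivative_def]]
      by (simp add: has_field_derivative_def inner_commute algebra_simps mult_commute_abs)
    from DERIV_diff[OF DERIV_cdivide[OF this, of 2] W_along_curve_derivative[OF \<phi>[OF x]]]
    show ?thesis by (simp add: E_def)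
  qed
  then obtain c where c: "\<And>x. x \<ge> 0 \<Longrightarrow> E x = c"
    using has_field_derivative_zero_constant[of "{0..}" E] by auto
  have "T * \<bar>c\<bar> \<le> m" if T: "T \<ge> 0" for T
  proof -
    have "T * \<bar>c\<bar> = integral {0..T} (\<lambda>_. \<bar>c\<bar>)" using T by simp
    also have "\<dots> \<le> action 0 T \<phi> P"
      unfolding action_def
    proof (rule integral_le[OF integrable_const_ivl lagrangian_integrable])
      fix x assume "x \<in> {0..T}"
      then have "\<bar>c\<bar> = \<bar>(norm (P x))\<^sup>2 / 2 - W (\<phi> x)\<bar>" using c[of x] by (simp add: E_def power2_norm_eq_inner)
      also have "\<dots> \<le> \<bar>(norm (P x))\<^sup>2 / 2\<bar> + \<bar>W (\<phi> x)\<bar>" by (rule abs_triangle_ineq4)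
      finally show "\<bar>c\<bar> \<le> (norm (P x))\<^sup>2 / 2 + W (\<phi> x)" using W_nonneg[of "\<phi> x"] by simp
    qed simp
    also have "\<dots> \<le> m" by (rule m[OF T])
    finally show ?thesis .
  qed
  \<comment> \<open>For a nonzero \<open>c\<close> this horizon would give
    \<open>\<bar>m\<bar> + 1 \<le> m\<close>.\<close>
  note * = this[of "(\<bar>m\<bar> + 1) / \<bar>c\<bar>"]
  have "c = 0"
  proof (rule ccontr)
    assume "c \<noteq> 0"
    then show False using * by simp
  qed
  then show ?thesis using c[OF t] by (simp add: E_def power2_norm_eq_inner)
qed

text \<open>Both factors are of the order of the square root of W: |g|^2 <= 4 L W and |P|^2 = 2 W,
  whence 8 L.\<close>

lemma W_along_curve_Lipschitz:
  assumes t: "t \<ge> 0" shows "\<bar>g (\<phi> t) \<bullet> P t\<bar> \<le> sqrt (8 * L) * W (\<phi> t)"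
proof -
  have "\<bar>g (\<phi> t) \<bullet> P t\<bar>\<^sup>2 \<le> (norm (g (\<phi> t)) * norm (P t))\<^sup>2"
    by (intro power_mono Cauchy_Schwarz_ineq2) auto
  also have "\<dots> = (norm (g (\<phi> t)))\<^sup>2 * (2 * W (\<phi> t))" by (simp add: power_mult_distrib zero_energy[OF t])
  also have "\<dots> \<le> (4 * L * W (\<phi> t)) * (2 * W (\<phi> t))"
    using W_nonneg by (intro mult_right_mono g_sq_le) auto
  also have "\<dots> = (sqrt (8 * L) * W (\<phi> t))\<^sup>2"
    using L_pos by (simp add: power_mult_distrib power2_eq_square)
  finally show ?thesis
    by (rule power2_le_imp_le) (use W_nonneg[of "\<phi> t"] L_pos in simp)
qed

lemma W_along_curve_tendsto: "((\<lambda>t. W (\<phi> t)) \<longlongrightarrow> 0) at_top"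
proof (rule tendstoI)
  fix e :: real assume e: "e > 0"
  define \<kappa> where "\<kappa> = sqrt (8 * L)"
  have \<kappa>: "\<kappa> > 0" using L_pos by (simp add: \<kappa>_def)
  define F where "F = (\<lambda>T. action 0 T \<phi> P)"
  have F: "F s - F t = action t s \<phi> P" if "0 \<le> t" "t \<le> s" for s t
    using Henstock_Kurzweil_Integration.integral_combine[OF that lagrangian_integrable[of 0 s]] by (simp add: F_def action_def)
  have bdd: "bdd_above (F ` {0..})" by (rule bdd_aboveI2[of _ _ m]) (use m in \<open>simp add: F_def\<close>)
  \<comment> \<open>Within one unit of time \<open>W\<close> loses at most the factor exp (-
    \<kappa>). A value of at least \<open>e\<close> at time \<open>t\<close> would thus consume
    \<delta> of the action, more than is left after \<open>T\<close>.\<close>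
  define \<delta> where "\<delta> = e * exp (- \<kappa>)"
  have "\<delta> > 0" using e by (simp add: \<delta>_def)
  then obtain T where T: "T \<ge> 0" "F T > Sup (F ` {0..}) - \<delta>"
    using less_cSupD[of "F ` {0..}" "Sup (F ` {0..}) - \<delta>"] by auto
  have "dist (W (\<phi> t)) 0 < e" if t: "t \<ge> T" for t
  proof -
    have t0: "t \<ge> 0" using t T by simp
    have lower: "W (\<phi> t) * exp (- \<kappa>) \<le> W (\<phi> x)" if x: "x \<in> {t..t + 1}" for x
    proof -
      have "W (\<phi> t) * exp (- \<kappa> * (x - t)) \<le> W (\<phi> x)"
      proof (rule exponential_growth_comparison[of t "\<lambda>x. W (\<phi> x)" "\<lambda>x. g (\<phi> x) \<bullet> P x"])
        fix y assume "y \<ge> t"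
        then have y: "y \<ge> 0" using t0 by simp
        show "((\<lambda>x. W (\<phi> x)) has_real_derivative g (\<phi> y) \<bullet> P y) (at y within {0..})"
          by (rule W_along_curve_derivative[OF \<phi>[OF y]])
        show "- \<kappa> * W (\<phi> y) \<le> g (\<phi> y) \<bullet> P y"
          using W_along_curve_Lipschitz[OF y] by (simp add: \<kappa>_def)
      qed (use x t0 in auto)
      moreover have "W (\<phi> t) * exp (- \<kappa>) \<le> W (\<phi> t) * exp (- \<kappa> * (x - t))"
        using W_nonneg x \<kappa> by (intro mult_left_mono) (auto simp: mult_left_le)
      ultimately show ?thesis by linarith
    qed
    have "W (\<phi> t) * exp (- \<kappa>) = integral {t..t + 1} (\<lambda>_. W (\<phi> t) * exp (- \<kappa>))" by simp
    also have "\<dots> \<le> action t (t + 1) \<phi> P"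
      unfolding action_def
    proof (rule integral_le[OF integrable_const_ivl lagrangian_integrable[OF t0]])
      fix x assume "x \<in> {t..t + 1}"
      from lower[OF this] show "W (\<phi> t) * exp (- \<kappa>) \<le> (norm (P x))\<^sup>2 / 2 + W (\<phi> x)"
        by (simp add: add_increasing)
    qed
    also have "\<dots> = F (t + 1) - F t" using F[of t "t + 1"] t0 by simp
    finally have 1: "W (\<phi> t) * exp (- \<kappa>) \<le> F (t + 1) - F t" .
    have 2: "F (t + 1) \<le> Sup (F ` {0..})" by (rule cSup_upper[OF _ bdd]) (use t0 in auto)
    have 3: "F T \<le> F t"
    proof -
      have "0 \<le> action T t \<phi> P"
        unfolding action_def by (rule integral_nonneg[OF lagrangian_integrable[OF T(1)]]) (simp add: W_nonneg)
      then show ?thesis using F[OF T(1) t] by simp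
    qed
    have "W (\<phi> t) * exp (- \<kappa>) < \<delta>" using T(2) 1 2 3 by linarith
    then show ?thesis using W_nonneg[of "\<phi> t"] by (simp add: \<delta>_def)
  qed
  then show "\<forall>\<^sub>F t in at_top. dist (W (\<phi> t)) 0 < e" by (rule eventually_at_top_linorderI)
qed

lemma velocity_tendsto: "(P \<longlongrightarrow> 0) at_top"
proof -
  have "((\<lambda>t. sqrt (2 * W (\<phi> t))) \<longlongrightarrow> sqrt (2 * 0)) at_top"
    by (intro tendsto_intros W_along_curve_tendsto)
  then have l: "((\<lambda>t. sqrt (2 * W (\<phi> t))) \<longlongrightarrow> 0) at_top" by simp
  have "\<forall>\<^sub>F t in at_top. norm (P t) \<le> sqrt (2 * W (\<phi> t))"
    by (rule eventually_at_top_linorderI[of 0]) (simp add: zero_energy[symmetric])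
  then show ?thesis using l by (rule Lim_null_comparison)
qed

end

end

section \<open>Transfer between the torus and its universal cover\<close>

text \<open>Monotone convergence turns a uniform bound on gauge integrals over [0, T] into Lebesgue
  integrability over the half-line.\<close>

lemma halfline_integral_bounded:
  fixes f :: "real \<Rightarrow> real"
  assumes f: "\<And>T. set_integrable lborel {0..T} f" and nonneg: "\<And>t. t \<ge> 0 \<Longrightarrow> 0 \<le> f t"
    and le: "\<And>T. T \<ge> 0 \<Longrightarrow> integral {0..T} f \<le> m"
  shows "set_integrable lborel {0<..} f" "(LINT t:{0<..}|lborel. f t) \<le> m"
proof -
  define F where "F = (\<lambda>(i::nat) t. indicator {0<..real i} t *\<^sub>R f t)"
  have "set_integrable lborel {0<..real i} f" for i
    by (rule set_integrable_subset[OF f[of "real i"]]) auto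
  then have iF: "integrable lborel (F i)" for i
    by (simp add: F_def set_integrable_def)
  have Fle: "integral\<^sup>L lborel (F i) \<le> m" for i
  proof -
    have "integral\<^sup>L lborel (F i) \<le> (LINT t:{0..real i}|lborel. f t)"
      unfolding set_lebesgue_integral_def
      by (rule integral_mono[OF iF f[unfolded set_integrable_def]])
        (auto simp: F_def indicator_def nonneg)
    also have "\<dots> = integral {0..real i} f" by (rule set_borel_integral_eq_integral(2)[OF f])
    also have "\<dots> \<le> m" by (rule le) simp
    finally show ?thesis .
  qed
  have mono: "F i t \<le> F j t" if "i \<le> j" for i j t
    using that nonneg[of t] by (auto simp: F_def indicator_def)
  have lim: "(\<lambda>i. F i t) \<longlonglongrightarrow> indicator {0<..} t *\<^sub>R f t" for t
  proof -
    obtain N :: nat where "t \<le> real N" using real_arch_simple by blast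
    then have "\<forall>\<^sub>F i in sequentially. F i t = indicator {0<..} t *\<^sub>R f t"
      by (intro eventually_sequentiallyI[of N]) (auto simp: F_def indicator_def)
    then show ?thesis by (rule tendsto_eventually)
  qed
  have meas: "(\<lambda>t. indicator {0<..} t *\<^sub>R f t) \<in> borel_measurable lborel"
    by (rule borel_measurable_LIMSEQ_metric[of F]) (use iF lim in auto)
  have "incseq (\<lambda>i. integral\<^sup>L lborel (F i))"
    by (intro incseq_SucI integral_mono iF mono) simp
  then obtain x where x: "(\<lambda>i. integral\<^sup>L lborel (F i)) \<longlonglongrightarrow> x"
    using incseq_convergent[of "\<lambda>i. integral\<^sup>L lborel (F i)" m] Fle by blast
  have xm: "x \<le> m" by (rule LIMSEQ_le_const2[OF x]) (use Fle in auto)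
  have "mono (\<lambda>i. F i t)" for t by (rule monoI) (rule mono)
  then show "set_integrable lborel {0<..} f"
    unfolding set_integrable_def
    by (intro integrable_monotone_convergence[OF iF _ _ x meas]) (use lim in auto)
  have "(LINT t:{0<..}|lborel. f t) = x"
    unfolding set_lebesgue_integral_def
    by (intro integral_monotone_convergence[OF iF _ _ x meas]) (use lim \<open>\<And>t. mono (\<lambda>i. F i t)\<close> in auto)
  then show "(LINT t:{0<..}|lborel. f t) \<le> m" using xm by simp
qed

lemma torus_of_eq_iff_translate:
  assumes "torus_of x = torus_of y"
  shows "torus_of (u + (x - y)) = torus_of u"
proof -
  have "angle_of ((u + (x - y)) $ i) = angle_of (u $ i)" for i
  proof -
    have "angle_of (x $ i) = angle_of (y $ i)" using assms by (auto simp: torus_of_def vec_eq_iff)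
    then show ?thesis by (simp add: angle_of_eq_iff)
  qed
  then show ?thesis by (simp add: torus_of_def vec_eq_iff)
qed

lemma torus_of_surj: "\<exists>x. torus_of x = p"
proof -
  have "\<forall>i. \<exists>x. p $ i = angle_of x" using angle_of_surj by blast
  then obtain f where "\<And>i. p $ i = angle_of (f i)" by metis
  then have "torus_of (\<chi> i. f i) = p" by (simp add: torus_of_def vec_eq_iff)
  then show ?thesis by blast
qed

locale torus_lagrangian = lagrangian W g L z
  for W :: "real ^ 'n \<Rightarrow> real" and g :: "real ^ 'n \<Rightarrow> real ^ 'n" and L z +
  fixes G :: "angle ^ 'n \<Rightarrow> real" and \<beta> :: real
  assumes W_eq: "W x = \<beta> / 2 * excess G (torus_of x)"
begin

context
  fixes \<phi> v :: "real \<Rightarrow> real ^ 'n" and \<Phi> :: "real \<Rightarrow> angle ^ 'n"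
  assumes \<phi>: "primitive_curve \<phi> v" and \<Phi>: "\<And>t. t \<ge> 0 \<Longrightarrow> torus_of (\<phi> t) = \<Phi> t"
begin

lemma lift_velocity:
  "AE t in lborel. t \<in> {0<..} \<longrightarrow> weak_velocity \<Phi> t = v t" "\<Phi> \<in> H1_loc"
  "(\<lambda>t. indicator {0<..} t *\<^sub>R weak_velocity \<Phi> t) \<in> borel_measurable borel"
  by (rule weak_velocity_of_primitive_curve[OF \<phi>]; simp add: \<Phi>)+

lemma running_cost_AE:
  "AE t in lborel. indicator {0<..} t *\<^sub>R running_cost \<beta> G \<Phi> t =
     indicator {0<..} t *\<^sub>R ((norm (v t))\<^sup>2 / 2 + W (\<phi> t))"
  using lift_velocity(1)
  by eventually_elim (auto simp: indicator_def running_cost_def W_eq \<Phi> field_simps)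

lemma running_cost_measurable:
  "(\<lambda>t. indicator {0<..} t *\<^sub>R running_cost \<beta> G \<Phi> t) \<in> borel_measurable lborel"
  "(\<lambda>t. indicator {0<..} t *\<^sub>R ((norm (v t))\<^sup>2 / 2 + W (\<phi> t))) \<in> borel_measurable lborel"
proof -
  have "continuous_on {0<..} (\<lambda>t. W (\<phi> t))"
    by (intro continuous_on_W continuous_on_subset[OF primitive_curve_continuous[OF \<phi>]]) auto
  then have Wm: "(\<lambda>t. indicator {0<..} t *\<^sub>R W (\<phi> t)) \<in> borel_measurable borel"
    by (intro borel_measurable_continuous_on_indicator) auto
  note vm = primitive_curve_measurable[OF \<phi>]
  note um = lift_velocity(3)
  have eq1: "(\<lambda>t. indicator {0<..} t *\<^sub>R running_cost \<beta> G \<Phi> t) =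
      (\<lambda>t. (norm (indicator {0<..} t *\<^sub>R weak_velocity \<Phi> t))\<^sup>2 / 2 + indicator {0<..} t *\<^sub>R W (\<phi> t))"
    by (auto simp: indicator_def running_cost_def W_eq \<Phi> field_simps fun_eq_iff)
  have eq2: "(\<lambda>t. indicator {0<..} t *\<^sub>R ((norm (v t))\<^sup>2 / 2 + W (\<phi> t))) =
      (\<lambda>t. indicator {0<..} t * (norm (v t))\<^sup>2 / 2 + indicator {0<..} t *\<^sub>R W (\<phi> t))"
    by (auto simp: indicator_def fun_eq_iff)
  show "(\<lambda>t. indicator {0<..} t *\<^sub>R running_cost \<beta> G \<Phi> t) \<in> borel_measurable lborel"
    unfolding eq1 measurable_lborel1 using um Wm by measurable
  show "(\<lambda>t. indicator {0<..} t *\<^sub>R ((norm (v t))\<^sup>2 / 2 + W (\<phi> t))) \<in> borel_measurable lborel"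
    unfolding eq2 measurable_lborel1 using vm Wm by measurable
qed

text \<open>The integrands agree almost everywhere only, because \<open>weak_velocity\<close> is a
  choice; both cut-offs are measurable by \<open>running_cost_measurable\<close>.\<close>

lemma cost_eq:
  "set_integrable lborel {0<..} (running_cost \<beta> G \<Phi>) \<longleftrightarrow>
     set_integrable lborel {0<..} (\<lambda>t. (norm (v t))\<^sup>2 / 2 + W (\<phi> t))"
  "cost \<beta> G \<Phi> = (LINT t:{0<..}|lborel. (norm (v t))\<^sup>2 / 2 + W (\<phi> t))"
  unfolding set_integrable_def cost_def set_lebesgue_integral_def
  by (rule integrable_cong_AE integral_cong_AE; rule running_cost_measurable running_cost_AE)+

text \<open>With \<open>cost_le\<close> this identifies the cost with the least upper bound of the
  truncated actions, the form in which \<open>minimizing\<close> compares curves.\<close>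

lemma action_le_cost:
  assumes i: "set_integrable lborel {0<..} (running_cost \<beta> G \<Phi>)"
  shows "action 0 T \<phi> v \<le> cost \<beta> G \<Phi>"
proof -
  let ?f = "\<lambda>t. (norm (v t))\<^sup>2 / 2 + W (\<phi> t)"
  have i': "set_integrable lborel {0<..} ?f" using i by (simp add: cost_eq)
  have a: "set_integrable lborel {0..T} ?f" by (rule action_integrable[OF \<phi>]) simp
  have a': "set_integrable lborel {0<..T} ?f" by (rule set_integrable_subset[OF a]) auto
  have "action 0 T \<phi> v = integral {0<..T} ?f"
    unfolding action_def by (rule integral_spike_set) (rule negligible_subset[of "{0}"], auto)+
  also have "\<dots> = (LINT t:{0<..T}|lborel. ?f t)" by (rule set_borel_integral_eq_integral(2)[OF a', symmetric])
  also have "\<dots> \<le> (LINT t:{0<..}|lborel. ?f t)"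
    unfolding set_lebesgue_integral_def
    by (rule integral_mono[OF a'[unfolded set_integrable_def] i'[unfolded set_integrable_def]])
      (auto simp: indicator_def W_nonneg)
  finally show ?thesis by (simp add: cost_eq)
qed

lemma cost_le:
  assumes m: "\<And>T. T \<ge> 0 \<Longrightarrow> action 0 T \<phi> v \<le> m"
  shows "\<Phi> \<in> admissible \<beta> G (\<Phi> 0)" "cost \<beta> G \<Phi> \<le> m"
proof -
  have "set_integrable lborel {0..T} (\<lambda>t. (norm (v t))\<^sup>2 / 2 + W (\<phi> t))" for T
    by (rule action_integrable[OF \<phi>]) simp
  note * = halfline_integral_bounded[OF this, of m]
  show "\<Phi> \<in> admissible \<beta> G (\<Phi> 0)"
    using *(1) m lift_velocity(2) W_nonneg
    by (simp add: admissible_def cost_eq action_def)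
  show "cost \<beta> G \<Phi> \<le> m" using *(2) m W_nonneg by (simp add: cost_eq action_def)
qed

end

text \<open>A competitor on the cover projects to an admissible torus curve whose cost is at most
  any bound of its actions.\<close>

lemma optimal_lift:
  assumes "optimal \<beta> G \<Phi>\<^sub>0 \<Phi>"
  obtains \<phi> v where "minimizing \<phi> v" "\<And>t. t \<ge> 0 \<Longrightarrow> torus_of (\<phi> t) = \<Phi> t"
proof -
  have adm: "\<Phi> \<in> admissible \<beta> G \<Phi>\<^sub>0"
    and opt: "\<And>\<Psi>. \<Psi> \<in> admissible \<beta> G \<Phi>\<^sub>0 \<Longrightarrow> cost \<beta> G \<Phi> \<le> cost \<beta> G \<Psi>"
    using assms by (auto simp: optimal_def is_arg_min_linorder)
  then obtain \<phi> v where \<phi>: "primitive_curve \<phi> v" "\<And>t. t \<ge> 0 \<Longrightarrow> torus_of (\<phi> t) = \<Phi> t"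
    using H1_loc_obtain_lift[of \<Phi>] by (auto simp: admissible_def)
  have "minimizing \<phi> v"
    unfolding minimizing_def
  proof (intro conjI exI[of _ "cost \<beta> G \<Phi>"] allI impI \<phi>(1))
    fix T :: real
    show "action 0 T \<phi> v \<le> cost \<beta> G \<Phi>"
      by (rule action_le_cost[OF \<phi>]) (use adm in \<open>auto simp: admissible_def\<close>)
  next
    fix \<psi> w m' assume \<psi>: "primitive_curve \<psi> w" "\<psi> 0 = \<phi> 0" "\<forall>T\<ge>0. action 0 T \<psi> w \<le> m'"
    have "torus_of (\<psi> 0) = \<Phi>\<^sub>0" using \<psi>(2) \<phi>(2)[of 0] adm by (simp add: admissible_def)
    then show "cost \<beta> G \<Phi> \<le> m'"
      using opt[of "\<lambda>t. torus_of (\<psi> t)"] cost_le[OF \<psi>(1), of "\<lambda>t. torus_of (\<psi> t)" m'] \<psi>(3)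
      by fastforce
  qed
  then show thesis using that \<phi> by blast
qed

text \<open>A torus competitor is lifted and then translated by a period so that it starts where
  \<open>\<phi>\<close> does. Competitors of every winding are thereby included.\<close>

lemma minimizing_optimal:
  assumes "minimizing \<phi> v"
  shows "optimal \<beta> G (torus_of (\<phi> 0)) (\<lambda>t. torus_of (\<phi> t))"
proof -
  let ?\<Phi> = "\<lambda>t. torus_of (\<phi> t)"
  obtain m where \<phi>: "primitive_curve \<phi> v" and m: "\<And>T. T \<ge> 0 \<Longrightarrow> action 0 T \<phi> v \<le> m"
    "\<And>\<psi> w m'. primitive_curve \<psi> w \<Longrightarrow> \<psi> 0 = \<phi> 0 \<Longrightarrow> \<forall>T\<ge>0. action 0 T \<psi> w \<le> m' \<Longrightarrow> m \<le> m'"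
    using assms unfolding minimizing_def by blast
  have adm: "?\<Phi> \<in> admissible \<beta> G (?\<Phi> 0)" and le: "cost \<beta> G ?\<Phi> \<le> m"
    using cost_le[OF \<phi>, of ?\<Phi> m] m(1) by auto
  have "cost \<beta> G ?\<Phi> \<le> cost \<beta> G \<Psi>" if \<Psi>: "\<Psi> \<in> admissible \<beta> G (?\<Phi> 0)" for \<Psi>
  proof -
    obtain \<psi> w where \<psi>: "primitive_curve \<psi> w" "\<And>t. t \<ge> 0 \<Longrightarrow> torus_of (\<psi> t) = \<Psi> t"
      using \<Psi> H1_loc_obtain_lift[of \<Psi>] by (auto simp: admissible_def)
    \<comment> \<open>The two starting points lie over the same torus point, so the translation
      changes neither the projection nor the velocity.\<close>
    define \<psi>' where "\<psi>' = (\<lambda>t. \<psi> t + (\<phi> 0 - \<psi> 0))"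
    have "torus_of (\<phi> 0) = torus_of (\<psi> 0)" using \<psi>(2)[of 0] \<Psi> by (simp add: admissible_def)
    then have t': "torus_of (\<psi>' t) = \<Psi> t" if "t \<ge> 0" for t
      using torus_of_eq_iff_translate \<psi>(2)[OF that] by (metis \<psi>'_def)
    have *: "\<psi> t = \<psi> 0 + integral {0..t} w" if "t \<ge> 0" for t
      using \<psi>(1) that unfolding primitive_curve_def by blast
    have "\<psi>' t = \<psi>' 0 + integral {0..t} w" if "t \<ge> 0" for t
      unfolding \<psi>'_def by (subst *[OF that]) simp
    then have p': "primitive_curve \<psi>' w"
      using \<psi>(1) unfolding primitive_curve_def by blast
    have "m \<le> cost \<beta> G \<Psi>"
    proof (rule m(2)[OF p'])
      show "\<psi>' 0 = \<phi> 0" by (simp add: \<psi>'_def)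
      show "\<forall>T\<ge>0. action 0 T \<psi>' w \<le> cost \<beta> G \<Psi>"
        by (intro allI impI, rule action_le_cost[OF p']) (use t' \<Psi> in \<open>auto simp: admissible_def\<close>)
    qed
    then show ?thesis using le by simp
  qed
  then show ?thesis using adm by (auto simp: optimal_def is_arg_min_linorder)
qed

lemma optimal_exists: "\<exists>\<Phi>. optimal \<beta> G \<Phi>\<^sub>0 \<Phi>"
proof -
  obtain x where x: "torus_of x = \<Phi>\<^sub>0" using torus_of_surj by blast
  obtain \<phi> v where "minimizing \<phi> v" "\<phi> 0 = x" using minimizing_exists by blast
  then show ?thesis using minimizing_optimal x by blast
qed

end

section \<open>From convergence of the cosine to convergence of the angle\<close>

text \<open>The cosine is constant on no interval. A continuous function that kept moving by a fixed
  amount would pass through three equally spaced values whose cosines cannot all be close to the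
  limit.\<close>

lemma tendsto_of_cos_tendsto:
  fixes u :: "real \<Rightarrow> real"
  assumes cont: "continuous_on {0..} u" and lim: "((\<lambda>t. cos (u t)) \<longlongrightarrow> l) at_top"
  shows "\<exists>a. (u \<longlongrightarrow> a) at_top"
proof (rule tendsto_at_top_cauchyI)
  fix e :: real assume e: "e > 0"
  \<comment> \<open>Half the tolerance, capped at 1/2 to keep \<open>h\<close> below \<pi>, where 1
    - cos h and sin h are positive.\<close>
  define h where "h = min e 1 / 2"
  have h: "0 < h" "h < pi" "2 * h \<le> e" using e pi_gt3 by (auto simp: h_def)
  define \<rho> where "\<rho> = min (1 - cos h) (sin h)"
  have "cos h < cos 0" using h by (intro cos_monotone_0_pi) auto
  then have \<rho>: "\<rho> > 0" using sin_gt_zero[OF h(1,2)] by (simp add: \<rho>_def)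
  \<comment> \<open>In \<open>osc\<close> the second difference contributes an error 2 \<delta> and
    the first difference an error \<delta>, against (|cos x| + |sin x|) \<rho>, which is at least
    \<rho>.\<close>
  define \<delta> where "\<delta> = \<rho> / 3"
  have \<delta>: "\<delta> > 0" using \<rho> by (simp add: \<delta>_def)
  obtain T0 where T0: "\<And>t. t \<ge> T0 \<Longrightarrow> \<bar>cos (u t) - l\<bar> < \<delta>"
    using tendstoD[OF lim \<delta>] by (auto simp: eventually_at_top_linorder dist_real_def)
  define T where "T = max T0 0"
  \<comment> \<open>On a long interval the cosine cannot be almost constant: its first and second differences
    control the sine and the cosine at the midpoint.\<close>
  have osc: False if y: "\<bar>cos (x - k) - l\<bar> < \<delta>" "\<bar>cos x - l\<bar> < \<delta>" "\<bar>cos (x + k) - l\<bar> < \<delta>" and k: "\<bar>k\<bar> = h" for x k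
  proof -
    have ck: "cos k = cos h" "\<bar>sin k\<bar> = sin h"
      using k sin_gt_zero[OF h(1,2)] by (auto simp: abs_if split: if_splits)
    have "2 * cos x * (1 - cos h) = (cos x - cos (x - k)) + (cos x - cos (x + k))"
      by (simp add: cos_add cos_diff ck algebra_simps)
    then have "\<bar>2 * cos x * (1 - cos h)\<bar> < 4 * \<delta>" using y by linarith
    then have a: "\<bar>cos x\<bar> * (1 - cos h) < 2 * \<delta>" by (simp add: abs_mult)
    have "2 * sin x * sin k = cos (x - k) - cos (x + k)"
      by (simp add: cos_add cos_diff)
    then have "\<bar>2 * sin x * sin k\<bar> < 2 * \<delta>" using y by linarith
    then have b: "\<bar>sin x\<bar> * sin h < \<delta>" by (simp add: abs_mult ck)
    have "\<bar>cos x\<bar> * \<rho> \<le> \<bar>cos x\<bar> * (1 - cos h)" "\<bar>sin x\<bar> * \<rho> \<le> \<bar>sin x\<bar> * sin h"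
      by (intro mult_left_mono; simp add: \<rho>_def)+
    then have "(\<bar>cos x\<bar> + \<bar>sin x\<bar>) * \<rho> < 3 * \<delta>" using a b by (simp add: algebra_simps)
    moreover have "1 \<le> \<bar>cos x\<bar> + \<bar>sin x\<bar>"
    proof -
      have "1 = \<bar>cos x\<bar> * \<bar>cos x\<bar> + \<bar>sin x\<bar> * \<bar>sin x\<bar>"
        by (simp add: sin_cos_squared_add3)
      also have "\<dots> \<le> \<bar>cos x\<bar> + \<bar>sin x\<bar>"
        by (intro add_mono mult_left_le) auto
      finally show ?thesis .
    qed
    then have "1 * \<rho> \<le> (\<bar>cos x\<bar> + \<bar>sin x\<bar>) * \<rho>" using \<rho> by (intro mult_right_mono) auto
    ultimately show False by (simp add: \<delta>_def)
  qed
  have "dist (u s) (u t) < e" if st: "s \<ge> T" "t \<ge> T" for s t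
  proof (rule ccontr)
    assume "\<not> dist (u s) (u t) < e"
    then have far: "\<bar>u t - u s\<bar> \<ge> 2 * h" using h by (simp add: dist_real_def)
    have "connected (u ` {T..})"
      by (intro connected_continuous_image continuous_on_subset[OF cont]) (auto simp: T_def)
    then have iv: "is_interval (u ` {T..})" by (simp add: is_interval_connected_1)
    \<comment> \<open>Intermediate values: the late part of the curve has an interval as
      image.\<close>
    have mem: "y \<in> u ` {T..}" if "min (u s) (u t) \<le> y" "y \<le> max (u s) (u t)" for y
      by (rule mem_is_interval_1_I[OF iv, of "min (u s) (u t)" "max (u s) (u t)"])
        (use that st in \<open>auto simp: min_def max_def\<close>)
    have near: "\<bar>cos y - l\<bar> < \<delta>" if "y \<in> u ` {T..}" for y
      using that T0 by (auto simp: T_def)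
    define x where "x = min (u s) (u t) + h"
    have "x - h \<in> u ` {T..}" "x \<in> u ` {T..}" "x + h \<in> u ` {T..}"
      using far h(1) by (auto intro!: mem simp: x_def min_def max_def split: if_splits)
    then show False using osc[of x h] near h by simp
  qed
  then show "\<exists>T. \<forall>s\<ge>T. \<forall>t\<ge>T. dist (u s) (u t) < e" by blast
qed

section \<open>The imbalance of one plane\<close>

text \<open>Let e be the unit vector at angle \<alpha>. \<open>tangential\<close> and
  \<open>radial\<close> are the components of c + cos \<gamma> e orthogonal to e and along e; this
  vector is the total force in a plane divided by
  \<open>2 * m * r * \<omega>\<^sup>2\<close>.\<close>

definition tangential :: "real ^ 2 \<Rightarrow> real \<Rightarrow> real" where
  "tangential c \<alpha> = - c $ 1 * sin \<alpha> + c $ 2 * cos \<alpha>"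

definition radial :: "real ^ 2 \<Rightarrow> real \<Rightarrow> real \<Rightarrow> real" where
  "radial c \<alpha> \<gamma> = c $ 1 * cos \<alpha> + c $ 2 * sin \<alpha> + cos \<gamma>"

text \<open>The squared length of c + cos \<gamma> e. Splitting it in the moving frame pays off in
  the gradient: its entries are 2 cos \<gamma> times the tangential and -2 sin \<gamma> times the
  radial component.\<close>

definition residual :: "real ^ 2 \<Rightarrow> real \<Rightarrow> real \<Rightarrow> real" where
  "residual c \<alpha> \<gamma> = (tangential c \<alpha>)\<^sup>2 + (radial c \<alpha> \<gamma>)\<^sup>2"

text \<open>As the angles vary, - cos \<gamma> e sweeps out the closed unit disc; this is the
  squared distance of \<open>c\<close> from it.\<close>

definition residual_min :: "real ^ 2 \<Rightarrow> real" where
  "residual_min c = (max (norm c - 1) 0)\<^sup>2"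

lemma norm_sq_vec2: "(norm (c :: real ^ 2))\<^sup>2 = (c $ 1)\<^sup>2 + (c $ 2)\<^sup>2"
  unfolding power2_norm_eq_inner by (simp add: inner_vec_def sum_2 power2_eq_square)

lemma polar_vec2:
  obtains \<theta> where "(c :: real ^ 2) $ 1 = norm c * cos \<theta>" "c $ 2 = norm c * sin \<theta>"
proof (cases "c = 0")
  case False
  then have "(c $ 1 / norm c)\<^sup>2 + (c $ 2 / norm c)\<^sup>2 = 1"
    by (simp add: power_divide add_divide_distrib[symmetric] norm_sq_vec2[symmetric])
  then obtain \<theta> where "c $ 1 / norm c = cos \<theta>" "c $ 2 / norm c = sin \<theta>"
    using sincos_total_2pi by metis
  with False show thesis by (intro that[of \<theta>]) (auto simp: field_simps)
qed (use that in auto)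

lemma radial_polar:
  "c $ 1 = norm c * cos \<theta> \<Longrightarrow> c $ 2 = norm c * sin \<theta> \<Longrightarrow>
     radial c \<alpha> \<gamma> = norm c * cos (\<alpha> - \<theta>) + cos \<gamma>"
  by (simp add: radial_def cos_diff algebra_simps)

text \<open>\<open>radial c \<alpha> \<gamma> - cos \<gamma>\<close> is the inner product of c and
  e. Being affine in it, the residual later determines cos (\<alpha> - \<theta>).\<close>

lemma residual_expand:
  "residual c \<alpha> \<gamma> = (cos \<gamma>)\<^sup>2 + 2 * cos \<gamma> * (radial c \<alpha> \<gamma> - cos \<gamma>) + (norm c)\<^sup>2"
proof -
  obtain \<theta> where \<theta>: "c $ 1 = norm c * cos \<theta>" "c $ 2 = norm c * sin \<theta>" by (rule polar_vec2)
  have t: "tangential c \<alpha> = - norm c * sin (\<alpha> - \<theta>)"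
    unfolding tangential_def \<theta> by (simp add: sin_diff algebra_simps)
  have "(- norm c * sin (\<alpha> - \<theta>))\<^sup>2 = (norm c)\<^sup>2 - (norm c * cos (\<alpha> - \<theta>))\<^sup>2"
    by (simp add: power_mult_distrib sin_squared_eq right_diff_distrib)
  then show ?thesis
    unfolding residual_def t radial_polar[OF \<theta>]
    by (simp add: power2_sum)
qed

lemma abs_radial_diff_le: "\<bar>radial c \<alpha> \<gamma> - cos \<gamma>\<bar> \<le> norm c"
proof -
  obtain \<theta> where \<theta>: "c $ 1 = norm c * cos \<theta>" "c $ 2 = norm c * sin \<theta>" by (rule polar_vec2)
  show ?thesis unfolding radial_polar[OF \<theta>] by (simp add: abs_mult mult_left_le)
qed

text \<open>The second summand measures how far c and cos \<gamma> e are from pointing in opposite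
  directions; its sign is Cauchy-Schwarz.\<close>

lemma residual_decomp:
  "residual c \<alpha> \<gamma> = (norm c - \<bar>cos \<gamma>\<bar>)\<^sup>2 + 2 * (\<bar>cos \<gamma>\<bar> * norm c + cos \<gamma> * (radial c \<alpha> \<gamma> - cos \<gamma>))"
  "0 \<le> \<bar>cos \<gamma>\<bar> * norm c + cos \<gamma> * (radial c \<alpha> \<gamma> - cos \<gamma>)"
proof -
  show "residual c \<alpha> \<gamma> = (norm c - \<bar>cos \<gamma>\<bar>)\<^sup>2 + 2 * (\<bar>cos \<gamma>\<bar> * norm c + cos \<gamma> * (radial c \<alpha> \<gamma> - cos \<gamma>))"
    unfolding residual_expand by (simp add: power2_diff algebra_simps)
  have "\<bar>cos \<gamma> * (radial c \<alpha> \<gamma> - cos \<gamma>)\<bar> \<le> \<bar>cos \<gamma>\<bar> * norm c"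
    unfolding abs_mult by (intro mult_left_mono abs_radial_diff_le) auto
  then show "0 \<le> \<bar>cos \<gamma>\<bar> * norm c + cos \<gamma> * (radial c \<alpha> \<gamma> - cos \<gamma>)" by linarith
qed

lemma residual_ge: "(norm c - \<bar>cos \<gamma>\<bar>)\<^sup>2 \<le> residual c \<alpha> \<gamma>"
  using residual_decomp(2)[where c = c and \<alpha> = \<alpha> and \<gamma> = \<gamma>] unfolding residual_decomp(1)[where \<alpha> = \<alpha>] by simp

lemma residual_min_le: "residual_min c \<le> residual c \<alpha> \<gamma>"
proof -
  have "residual_min c \<le> (norm c - \<bar>cos \<gamma>\<bar>)\<^sup>2"
  proof (cases "norm c \<le> 1")
    case False
    then show ?thesis unfolding residual_min_def using abs_cos_le_one[of \<gamma>] by (intro power_mono) auto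
  qed (simp add: residual_min_def)
  then show ?thesis using residual_ge by (rule order_trans)
qed

lemma residual_min_attained: "\<exists>\<alpha> \<gamma>. residual c \<alpha> \<gamma> = residual_min c"
proof -
  obtain \<theta> where \<theta>: "c $ 1 = norm c * cos \<theta>" "c $ 2 = norm c * sin \<theta>" by (rule polar_vec2)
  define s where "s = min (norm c) 1"
  have s: "-1 \<le> s" "s \<le> 1" by (auto simp: s_def intro: order_trans[OF _ norm_ge_zero])
  \<comment> \<open>The balancing force points against \<open>c\<close>, with amplitude as close to
    \<open>norm c\<close> as a cosine can be.\<close>
  have "residual c (\<theta> + pi) (arccos s) = (norm c - s)\<^sup>2"
    using s unfolding residual_expand radial_polar[OF \<theta>]
    by (simp add: cos_arccos power2_diff algebra_simps)
  also have "\<dots> = residual_min c" by (auto simp: residual_min_def s_def min_def max_def)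
  finally show ?thesis by blast
qed

text \<open>Only |cos \<gamma>| is determined, since (\<alpha> + \<pi>, \<pi> - \<gamma>) gives the
  same force. For norm c <= 1 the minimum is 0 and a square root suffices; otherwise it lies at |cos
  \<gamma>| = 1, where the residual grows at least linearly, with slope 2 (norm c - 1).\<close>

lemma abs_cos_tendsto:
  assumes "((\<lambda>t. residual c (\<alpha> t) (\<gamma> t)) \<longlongrightarrow> residual_min c) F"
  shows "((\<lambda>t. \<bar>cos (\<gamma> t)\<bar>) \<longlongrightarrow> min (norm c) 1) F"
proof -
  have z: "((\<lambda>t. residual c (\<alpha> t) (\<gamma> t) - residual_min c) \<longlongrightarrow> 0) F"
    using tendsto_diff[OF assms tendsto_const[of "residual_min c"]] by simp
  have "((\<lambda>t. \<bar>cos (\<gamma> t)\<bar> - min (norm c) 1) \<longlongrightarrow> 0) F"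
  proof (cases "norm c \<le> 1")
    case True
    have "((\<lambda>t. sqrt (residual c (\<alpha> t) (\<gamma> t) - residual_min c)) \<longlongrightarrow> sqrt 0) F"
      by (intro tendsto_intros z)
    then have l: "((\<lambda>t. sqrt (residual c (\<alpha> t) (\<gamma> t) - residual_min c)) \<longlongrightarrow> 0) F" by simp
    have "norm (\<bar>cos (\<gamma> t)\<bar> - min (norm c) 1) \<le> sqrt (residual c (\<alpha> t) (\<gamma> t) - residual_min c)" for t
    proof (rule real_le_rsqrt)
      have "(norm c - \<bar>cos (\<gamma> t)\<bar>)\<^sup>2 \<le> residual c (\<alpha> t) (\<gamma> t)"
        by (rule residual_ge)
      then show "(norm (\<bar>cos (\<gamma> t)\<bar> - min (norm c) 1))\<^sup>2 \<le> residual c (\<alpha> t) (\<gamma> t) - residual_min c"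
        using True by (simp add: residual_min_def power2_commute)
    qed
    from Lim_null_comparison[OF always_eventually[OF allI, OF this] l] show ?thesis .
  next
    case False
    have l: "((\<lambda>t. (residual c (\<alpha> t) (\<gamma> t) - residual_min c) / (2 * (norm c - 1))) \<longlongrightarrow> 0) F"
      using tendsto_divide[OF z tendsto_const[of "2 * (norm c - 1)"]] False by simp
    have "norm (\<bar>cos (\<gamma> t)\<bar> - min (norm c) 1) \<le> (residual c (\<alpha> t) (\<gamma> t) - residual_min c) / (2 * (norm c - 1))" for t
    proof -
      define s where "s = \<bar>cos (\<gamma> t)\<bar>"
      have s: "0 \<le> s" "s \<le> 1" by (auto simp: s_def)
      have "2 * (norm c - 1) * (1 - s) \<le> (norm c - s)\<^sup>2 - (norm c - 1)\<^sup>2"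
      proof -
        have "(norm c - s)\<^sup>2 - (norm c - 1)\<^sup>2 - 2 * (norm c - 1) * (1 - s) = (1 - s)\<^sup>2"
          by (simp add: power2_eq_square algebra_simps)
        then show ?thesis using zero_le_power2[of "1 - s"] by linarith
      qed
      also have "\<dots> \<le> residual c (\<alpha> t) (\<gamma> t) - residual_min c"
        using residual_ge[where c = c and \<alpha> = "\<alpha> t" and \<gamma> = "\<gamma> t"] False by (simp add: residual_min_def s_def)
      finally have "(1 - s) \<le> (residual c (\<alpha> t) (\<gamma> t) - residual_min c) / (2 * (norm c - 1))"
        using False by (simp add: pos_le_divide_eq mult_ac)
      moreover have "norm (s - 1) = 1 - s" using s by simp
      ultimately show ?thesis using False by (simp add: s_def min_def)
    qed
    from Lim_null_comparison[OF always_eventually[OF allI, OF this] l] show ?thesis .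
  qed
  then show ?thesis by (rule LIM_zero_cancel)
qed

text \<open>First \<gamma>, from its doubled cosine, then \<alpha>, by solving the residual for cos
  (\<alpha> - \<theta>). If c = 0 the residual does not see \<alpha>, so constancy must be supplied
  by the dynamics.\<close>

lemma plane_angles_converge:
  fixes \<alpha> \<gamma> :: "real \<Rightarrow> real"
  assumes cont: "continuous_on {0..} \<alpha>" "continuous_on {0..} \<gamma>"
    and lim: "((\<lambda>t. residual c (\<alpha> t) (\<gamma> t)) \<longlongrightarrow> residual_min c) at_top"
    and const: "c = 0 \<Longrightarrow> \<exists>a. \<forall>t\<ge>0. \<alpha> t = a"
  shows "\<exists>a. (\<alpha> \<longlongrightarrow> a) at_top" "\<exists>b. (\<gamma> \<longlongrightarrow> b) at_top"
proof -
  have ac: "((\<lambda>t. \<bar>cos (\<gamma> t)\<bar>) \<longlongrightarrow> min (norm c) 1) at_top" by (rule abs_cos_tendsto[OF lim])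
  \<comment> \<open>Doubling the angle removes the unknown sign of cos \<gamma>.\<close>
  have "((\<lambda>t. 2 * \<bar>cos (\<gamma> t)\<bar>\<^sup>2 - 1) \<longlongrightarrow> 2 * (min (norm c) 1)\<^sup>2 - 1) at_top"
    by (intro tendsto_intros ac)
  moreover have "2 * \<bar>cos x\<bar>\<^sup>2 - 1 = cos (2 * x)" for x :: real by (simp add: cos_double_cos)
  ultimately have "((\<lambda>t. cos (2 * \<gamma> t)) \<longlongrightarrow> 2 * (min (norm c) 1)\<^sup>2 - 1) at_top" by simp
  moreover have "continuous_on {0..} (\<lambda>t. 2 * \<gamma> t)" by (intro continuous_intros cont)
  ultimately obtain b where "((\<lambda>t. 2 * \<gamma> t) \<longlongrightarrow> b) at_top"
    using tendsto_of_cos_tendsto by blast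
  then have "((\<lambda>t. (2 * \<gamma> t) / 2) \<longlongrightarrow> b / 2) at_top" by (intro tendsto_intros) auto
  then have \<gamma>: "(\<gamma> \<longlongrightarrow> b / 2) at_top" by simp
  then show "\<exists>b. (\<gamma> \<longlongrightarrow> b) at_top" by blast
  show "\<exists>a. (\<alpha> \<longlongrightarrow> a) at_top"
  proof (cases "c = 0")
    case True
    then obtain a where "\<forall>t\<ge>0. \<alpha> t = a" using const by blast
    then have "\<forall>\<^sub>F t in at_top. \<alpha> t = a" by (auto intro: eventually_at_top_linorderI[of 0])
    then show ?thesis using tendsto_eventually by blast
  next
    case False
    obtain \<theta> where \<theta>: "c $ 1 = norm c * cos \<theta>" "c $ 2 = norm c * sin \<theta>" by (rule polar_vec2)
    define s where "s = cos (b / 2)"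
    have cg: "((\<lambda>t. cos (\<gamma> t)) \<longlongrightarrow> s) at_top" unfolding s_def by (intro tendsto_intros \<gamma>)
    have "((\<lambda>t. \<bar>cos (\<gamma> t)\<bar>) \<longlongrightarrow> \<bar>s\<bar>) at_top" by (intro tendsto_intros cg)
    from tendsto_unique[OF _ this ac] have s: "s \<noteq> 0" using False by (auto simp: min_def split: if_splits)
    \<comment> \<open>The limit of cos (\<alpha> - \<theta>) according to
      \<open>residual_expand\<close>; the division is possible because neither \<open>c\<close> nor
      the limit \<open>s\<close> of cos \<gamma> is zero.\<close>
    define K where "K = (residual_min c - s\<^sup>2 - (norm c)\<^sup>2) / (2 * s * norm c)"
    have l: "((\<lambda>t. (residual c (\<alpha> t) (\<gamma> t) - (cos (\<gamma> t))\<^sup>2 - (norm c)\<^sup>2) / (2 * cos (\<gamma> t) * norm c)) \<longlongrightarrow> K) at_top"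
      unfolding K_def using s False by (intro tendsto_intros lim cg) auto
    have "\<forall>\<^sub>F t in at_top. cos (\<gamma> t) \<noteq> 0"
      using cg s by (rule tendsto_imp_eventually_ne)
    then have "\<forall>\<^sub>F t in at_top. (residual c (\<alpha> t) (\<gamma> t) - (cos (\<gamma> t))\<^sup>2 - (norm c)\<^sup>2) / (2 * cos (\<gamma> t) * norm c) = cos (\<alpha> t - \<theta>)"
    proof eventually_elim
      case (elim t)
      then show ?case
        unfolding residual_expand radial_polar[OF \<theta>] using False by (simp add: field_simps)
    qed
    from tendsto_cong[THEN iffD1, OF this l] have "((\<lambda>t. cos (\<alpha> t - \<theta>)) \<longlongrightarrow> K) at_top" .
    moreover have "continuous_on {0..} (\<lambda>t. \<alpha> t - \<theta>)" by (intro continuous_intros cont)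
    ultimately obtain a where a: "((\<lambda>t. \<alpha> t - \<theta>) \<longlongrightarrow> a) at_top"
      using tendsto_of_cos_tendsto by blast
    have "((\<lambda>t. (\<alpha> t - \<theta>) + \<theta>) \<longlongrightarrow> a + \<theta>) at_top" by (intro tendsto_intros a)
    then show ?thesis by auto
  qed
qed

text \<open>A Lojasiewicz inequality.  It also covers \<open>c = 0\<close>, where the minimizers form circles and the
  Hessian degenerates, because the tangential part then vanishes identically.\<close>

lemma gradient_dominates_residual:
  assumes lim: "((\<lambda>t. residual c (\<alpha> t) (\<gamma> t)) \<longlongrightarrow> residual_min c) F" and c: "norm c < 1"
  shows "\<exists>\<sigma>>0. \<forall>\<^sub>F t in F. \<sigma> * residual c (\<alpha> t) (\<gamma> t) \<le>
     (cos (\<gamma> t))\<^sup>2 * (tangential c (\<alpha> t))\<^sup>2 + (sin (\<gamma> t))\<^sup>2 * (radial c (\<alpha> t) (\<gamma> t))\<^sup>2"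
proof -
  have "((\<lambda>t. \<bar>cos (\<gamma> t)\<bar>\<^sup>2) \<longlongrightarrow> (min (norm c) 1)\<^sup>2) F"
    by (intro tendsto_intros abs_cos_tendsto[OF lim])
  moreover have "min (norm c) 1 = norm c" using c by simp
  ultimately have c2: "((\<lambda>t. (cos (\<gamma> t))\<^sup>2) \<longlongrightarrow> (norm c)\<^sup>2) F" by (simp only: power2_abs)
  from tendsto_diff[OF tendsto_const[of 1] this]
  have "((\<lambda>t. 1 - (cos (\<gamma> t))\<^sup>2) \<longlongrightarrow> 1 - (norm c)\<^sup>2) F" .
  then have s2: "((\<lambda>t. (sin (\<gamma> t))\<^sup>2) \<longlongrightarrow> 1 - (norm c)\<^sup>2) F" by (simp add: sin_squared_eq)
  \<comment> \<open>Half the limit of the squared sine, hence an eventual lower bound; it is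
    positive because norm c < 1. For nonzero c, \<open>b\<close> does the same for the squared
    cosine.\<close>
  define a where "a = (1 - (norm c)\<^sup>2) / 2"
  have "(norm c)\<^sup>2 < 1" using c by (simp add: power_less_one_iff)
  then have a: "0 < a" "a < 1 - (norm c)\<^sup>2" by (auto simp: a_def)
  have es: "\<forall>\<^sub>F t in F. a < (sin (\<gamma> t))\<^sup>2" by (rule order_tendstoD(1)[OF s2 a(2)])
  show ?thesis
  proof (cases "c = 0")
    case True
    have "\<forall>\<^sub>F t in F. a * residual c (\<alpha> t) (\<gamma> t) \<le>
     (cos (\<gamma> t))\<^sup>2 * (tangential c (\<alpha> t))\<^sup>2 + (sin (\<gamma> t))\<^sup>2 * (radial c (\<alpha> t) (\<gamma> t))\<^sup>2"
      using es by eventually_elim (simp add: residual_def tangential_def True mult_right_mono)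
    then show ?thesis using a by blast
  next
    case False
    define b where "b = (norm c)\<^sup>2 / 2"
    have b: "0 < b" "b < (norm c)\<^sup>2" using False by (auto simp: b_def)
    have "\<forall>\<^sub>F t in F. b < (cos (\<gamma> t))\<^sup>2" by (rule order_tendstoD(1)[OF c2 b(2)])
    with es have "\<forall>\<^sub>F t in F. min a b * residual c (\<alpha> t) (\<gamma> t) \<le>
     (cos (\<gamma> t))\<^sup>2 * (tangential c (\<alpha> t))\<^sup>2 + (sin (\<gamma> t))\<^sup>2 * (radial c (\<alpha> t) (\<gamma> t))\<^sup>2"
    proof eventually_elim
      case (elim t)
      then show ?case
        unfolding residual_def distrib_left by (intro add_mono mult_right_mono) auto
    qed
    then show ?thesis using a b by (intro exI[of _ "min a b"]) auto
  qed
qed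

section \<open>The potential on the universal cover\<close>

text \<open>Lipschitz functions are not closed under products; together with boundedness they are,
  so trigonometric polynomials are covered by closure rules.\<close>

definition bounded_lipschitz :: "('a::real_normed_vector \<Rightarrow> real) \<Rightarrow> bool" where
  "bounded_lipschitz f \<longleftrightarrow> (\<exists>B. \<forall>x. \<bar>f x\<bar> \<le> B) \<and> (\<exists>L. \<forall>x y. \<bar>f x - f y\<bar> \<le> L * norm (x - y))"

lemma bounded_lipschitz_const: "bounded_lipschitz (\<lambda>_. a)"
  unfolding bounded_lipschitz_def
  by (rule conjI, rule exI[of _ "\<bar>a\<bar>"], simp, rule exI[of _ 0], simp)

lemma bounded_lipschitz_add:
  assumes "bounded_lipschitz f" "bounded_lipschitz h"
  shows "bounded_lipschitz (\<lambda>x. f x + h x)"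
proof -
  obtain B L B' L' where f: "\<And>x. \<bar>f x\<bar> \<le> B" "\<And>x y. \<bar>f x - f y\<bar> \<le> L * norm (x - y)"
    and h: "\<And>x. \<bar>h x\<bar> \<le> B'" "\<And>x y. \<bar>h x - h y\<bar> \<le> L' * norm (x - y)"
    using assms unfolding bounded_lipschitz_def by blast
  have "\<bar>f x + h x\<bar> \<le> B + B'" for x using f(1)[of x] h(1)[of x] by linarith
  moreover have "\<bar>(f x + h x) - (f y + h y)\<bar> \<le> (L + L') * norm (x - y)" for x y
    using f(2)[of x y] h(2)[of x y] unfolding distrib_right by linarith
  ultimately show ?thesis unfolding bounded_lipschitz_def by blast
qed

lemma bounded_lipschitz_mult:
  assumes "bounded_lipschitz f" "bounded_lipschitz h"
  shows "bounded_lipschitz (\<lambda>x. f x * h x)"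
proof -
  obtain B L B' L' where f: "\<And>x. \<bar>f x\<bar> \<le> B" "\<And>x y. \<bar>f x - f y\<bar> \<le> L * norm (x - y)"
    and h: "\<And>x. \<bar>h x\<bar> \<le> B'" "\<And>x y. \<bar>h x - h y\<bar> \<le> L' * norm (x - y)"
    using assms unfolding bounded_lipschitz_def by blast
  have B: "0 \<le> B" "0 \<le> B'" using order_trans[OF abs_ge_zero f(1)] order_trans[OF abs_ge_zero h(1)] by auto
  have "\<bar>f x * h x\<bar> \<le> B * B'" for x unfolding abs_mult by (intro mult_mono f h B) auto
  moreover have "\<bar>f x * h x - f y * h y\<bar> \<le> (L * B' + B * L') * norm (x - y)" for x y
  proof -
    have "\<bar>f x * h x - f y * h y\<bar> = \<bar>(f x - f y) * h x + f y * (h x - h y)\<bar>" by (simp add: algebra_simps)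
    also have "\<dots> \<le> \<bar>f x - f y\<bar> * \<bar>h x\<bar> + \<bar>f y\<bar> * \<bar>h x - h y\<bar>"
      unfolding abs_mult[symmetric] by (rule abs_triangle_ineq)
    also have "\<dots> \<le> (L * norm (x - y)) * B' + B * (L' * norm (x - y))"
      by (intro add_mono mult_mono f h B order_trans[OF abs_ge_zero f(2)]) auto
    finally show ?thesis by (simp add: algebra_simps)
  qed
  ultimately show ?thesis unfolding bounded_lipschitz_def by blast
qed

lemma bounded_lipschitz_trig:
  fixes j :: "'n::finite"
  shows "bounded_lipschitz (\<lambda>x :: real ^ 'n. sin (x $ j))" "bounded_lipschitz (\<lambda>x :: real ^ 'n. cos (x $ j))"
proof -
  have c: "\<bar>x $ j - y $ j\<bar> \<le> norm (x - y)" for x y :: "real ^ 'n"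
    using component_le_norm_cart[of "x - y" j] by simp
  have d: "\<bar>f s - f t\<bar> \<le> \<bar>s - t\<bar>" if "\<And>x. (f has_real_derivative f' x) (at x)" "\<And>x. \<bar>f' x\<bar> \<le> 1"
    for f f' :: "real \<Rightarrow> real" and s t
    using field_differentiable_bound[of UNIV f f' 1 s t] that by simp
  have s: "\<bar>sin s - sin t\<bar> \<le> \<bar>s - t\<bar>" for s t :: real
    by (rule d[of sin cos]) (auto intro: DERIV_sin)
  have co: "\<bar>cos s - cos t\<bar> \<le> \<bar>s - t\<bar>" for s t :: real
    by (rule d[of cos "\<lambda>x. - sin x"]) (auto intro: DERIV_cos)
  show "bounded_lipschitz (\<lambda>x :: real ^ 'n. sin (x $ j))"
    unfolding bounded_lipschitz_def
    using order_trans[OF s c] by (auto intro!: exI[of _ 1])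
  show "bounded_lipschitz (\<lambda>x :: real ^ 'n. cos (x $ j))"
    unfolding bounded_lipschitz_def
    using order_trans[OF co c] by (auto intro!: exI[of _ 1])
qed

lemma lipschitz_of_components:
  fixes g :: "'a::real_normed_vector \<Rightarrow> real ^ 'n"
  assumes "\<And>j. bounded_lipschitz (\<lambda>x. g x $ j)"
  obtains L where "L > 0" "\<And>x y. norm (g x - g y) \<le> L * norm (x - y)"
proof -
  have "\<forall>j. \<exists>L. \<forall>x y. \<bar>g x $ j - g y $ j\<bar> \<le> L * norm (x - y)"
    using assms unfolding bounded_lipschitz_def by blast
  then obtain L where L: "\<And>j x y. \<bar>g x $ j - g y $ j\<bar> \<le> L j * norm (x - y)" by metis
  show thesis
  proof
    show "\<bar>\<Sum>j\<in>UNIV. L j\<bar> + 1 > 0" by simp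
    fix x y
    have "norm (g x - g y) \<le> (\<Sum>j\<in>UNIV. \<bar>(g x - g y) $ j\<bar>)" by (rule norm_le_l1_cart)
    also have "\<dots> \<le> (\<Sum>j\<in>UNIV. L j * norm (x - y))" by (intro sum_mono) (simp add: L)
    also have "\<dots> = (\<Sum>j\<in>UNIV. L j) * norm (x - y)" by (simp add: sum_distrib_right)
    also have "\<dots> \<le> (\<bar>\<Sum>j\<in>UNIV. L j\<bar> + 1) * norm (x - y)" by (intro mult_right_mono) auto
    finally show "norm (g x - g y) \<le> (\<bar>\<Sum>j\<in>UNIV. L j\<bar> + 1) * norm (x - y)" .
  qed
qed

text \<open>With \<open>\<kappa>\<close> equal to \<open>stiffness\<close> this is \<beta>/2 times
  the excess of the imbalance. The minimum may be subtracted in each plane separately, since the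
  planes share no angle.\<close>

definition potential :: "real ^ 2 \<Rightarrow> real ^ 2 ^ 2 \<Rightarrow> real ^ 4 \<Rightarrow> real" where
  "potential \<kappa> c x =
     (\<Sum>i\<in>UNIV. \<kappa> $ i / 2 * (residual (c $ i) (x $ \<alpha>_ix i) (x $ \<gamma>_ix i) - residual_min (c $ i)))"

definition potential_gradient :: "real ^ 2 \<Rightarrow> real ^ 2 ^ 2 \<Rightarrow> real ^ 4 \<Rightarrow> real ^ 4" where
  "potential_gradient \<kappa> c x = (\<chi> j. \<Sum>i\<in>UNIV.
     (if j = \<alpha>_ix i then \<kappa> $ i * cos (x $ \<gamma>_ix i) * tangential (c $ i) (x $ \<alpha>_ix i) else 0) +
     (if j = \<gamma>_ix i then - \<kappa> $ i * sin (x $ \<gamma>_ix i) * radial (c $ i) (x $ \<alpha>_ix i) (x $ \<gamma>_ix i) else 0))"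

lemma index_simps: "\<alpha>_ix 1 = 1" "\<gamma>_ix 1 = 2" "\<alpha>_ix 2 = 3" "\<gamma>_ix 2 = 4"
  by (simp_all add: \<alpha>_ix_def \<gamma>_ix_def)

lemma potential_gradient_components:
  "potential_gradient \<kappa> c x $ \<alpha>_ix i = \<kappa> $ i * cos (x $ \<gamma>_ix i) * tangential (c $ i) (x $ \<alpha>_ix i)"
  "potential_gradient \<kappa> c x $ \<gamma>_ix i =
     - \<kappa> $ i * sin (x $ \<gamma>_ix i) * radial (c $ i) (x $ \<alpha>_ix i) (x $ \<gamma>_ix i)"
  using exhaust_2[of i] by (auto simp: potential_gradient_def sum_2 index_simps)

lemma inner_vec4: "(x :: real ^ 4) \<bullet> y = (\<Sum>i\<in>UNIV. x $ \<alpha>_ix i * y $ \<alpha>_ix i + x $ \<gamma>_ix i * y $ \<gamma>_ix i)"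
  by (simp add: inner_vec_def sum_4 sum_2 index_simps)

lemma residual_derivative:
  "((\<lambda>x :: real ^ 4. residual d (x $ j) (x $ k)) has_derivative
     (\<lambda>h. 2 * (cos (x $ k) * tangential d (x $ j) * h $ j - sin (x $ k) * radial d (x $ j) (x $ k) * h $ k))) (at x)"
proof -
  have c: "((\<lambda>x :: real ^ 4. x $ l) has_derivative (\<lambda>h. h $ l)) (at x)" for l
    by (rule bounded_linear.has_derivative[OF bounded_linear_vec_nth has_derivative_ident])
  show ?thesis
    unfolding residual_def tangential_def radial_def
    by (rule derivative_eq_intros has_derivative_cos[OF c] has_derivative_sin[OF c] refl)+
      (simp add: fun_eq_iff power2_eq_square algebra_simps)
qed

lemma potential_derivative:
  "(potential \<kappa> c has_derivative (\<lambda>h. potential_gradient \<kappa> c x \<bullet> h)) (at x)"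
proof -
  have "((\<lambda>x. \<Sum>i\<in>UNIV. \<kappa> $ i / 2 * (residual (c $ i) (x $ \<alpha>_ix i) (x $ \<gamma>_ix i) - residual_min (c $ i)))
      has_derivative (\<lambda>h. \<Sum>i\<in>UNIV. \<kappa> $ i / 2 * (2 * (cos (x $ \<gamma>_ix i) * tangential (c $ i) (x $ \<alpha>_ix i) * h $ \<alpha>_ix i
        - sin (x $ \<gamma>_ix i) * radial (c $ i) (x $ \<alpha>_ix i) (x $ \<gamma>_ix i) * h $ \<gamma>_ix i) - 0))) (at x)"
    by (intro has_derivative_sum has_derivative_mult_right has_derivative_diff residual_derivative has_derivative_const)
  then show ?thesis
    unfolding potential_def[abs_def] inner_vec4 potential_gradient_components
    by (simp add: algebra_simps)
qed

lemma potential_lagrangian: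
  assumes \<kappa>: "\<And>i. \<kappa> $ i > 0"
  shows "\<exists>L z. lagrangian (potential \<kappa> c) (potential_gradient \<kappa> c) L z"
proof -
  have "bounded_lipschitz (\<lambda>x. potential_gradient \<kappa> c x $ j)" for j
  proof -
    have j: "j = \<alpha>_ix 1 \<or> j = \<gamma>_ix 1 \<or> j = \<alpha>_ix 2 \<or> j = \<gamma>_ix 2"
      using exhaust_4[of j] by (auto simp: index_simps)
    have *: "bounded_lipschitz (\<lambda>x. potential_gradient \<kappa> c x $ \<alpha>_ix i)" "bounded_lipschitz (\<lambda>x. potential_gradient \<kappa> c x $ \<gamma>_ix i)" for i
      unfolding potential_gradient_components tangential_def radial_def
      by (intro bounded_lipschitz_add bounded_lipschitz_mult bounded_lipschitz_const bounded_lipschitz_trig)+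
    show ?thesis using j *[of 1] *[of 2] by (elim disjE) simp_all
  qed
  then obtain L where L: "L > 0" "\<And>x y. norm (potential_gradient \<kappa> c x - potential_gradient \<kappa> c y) \<le> L * norm (x - y)"
    by (rule lipschitz_of_components) blast
  have "\<forall>i. \<exists>a b. residual (c $ i) a b = residual_min (c $ i)" using residual_min_attained by blast
  then obtain a b where ab: "\<And>i. residual (c $ i) (a i) (b i) = residual_min (c $ i)" by metis
  define z :: "real ^ 4" where "z = (\<chi> j. if j = 1 then a 1 else if j = 2 then b 1 else if j = 3 then a 2 else b 2)"
  have "potential \<kappa> c z = 0" by (simp add: potential_def sum_2 index_simps z_def ab)
  moreover have "0 \<le> potential \<kappa> c x" for x
    unfolding potential_def by (intro sum_nonneg mult_nonneg_nonneg) (use \<kappa> residual_min_le in \<open>auto simp: less_imp_le\<close>)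
  ultimately have "lagrangian (potential \<kappa> c) (potential_gradient \<kappa> c) L z"
    using L potential_derivative by unfold_locales auto
  then show ?thesis by blast
qed

lemma has_vector_derivative_vecI:
  fixes f :: "real \<Rightarrow> real ^ 'n"
  assumes "\<And>j. ((\<lambda>t. f t $ j) has_real_derivative d $ j) (at t within S)"
  shows "(f has_vector_derivative d) (at t within S)"
  unfolding has_vector_derivative_def has_derivative_componentwise_within[of f]
proof
  fix i :: "real ^ 'n" assume "i \<in> Basis"
  then obtain j where i: "i = axis j 1" by (auto simp: Basis_vec_def)
  show "((\<lambda>x. f x \<bullet> i) has_derivative (\<lambda>x. (x *\<^sub>R d) \<bullet> i)) (at t within S)"
    using assms[of j] by (simp add: i inner_axis has_field_derivative_def mult_commute_abs)
qed

lemma has_vector_derivative_vecD: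
  fixes f :: "real \<Rightarrow> real ^ 'n"
  assumes "(f has_vector_derivative d) (at t within S)"
  shows "((\<lambda>t. f t $ j) has_real_derivative d $ j) (at t within S)"
  using bounded_linear.has_vector_derivative[OF bounded_linear_vec_nth assms]
  by (simp add: has_real_derivative_iff_has_vector_derivative)

context lagrangian
begin

text \<open>The action bound is known for the representative \<open>v\<close>; it passes to the
  classical derivative \<open>P\<close> because the two agree almost everywhere.\<close>

lemma minimizing_action_bound:
  assumes min: "minimizing \<phi> v"
    and \<phi>: "\<And>t. t \<ge> 0 \<Longrightarrow> (\<phi> has_vector_derivative P t) (at t within {0..})"
    and P: "\<And>t. t \<ge> 0 \<Longrightarrow> (P has_vector_derivative g (\<phi> t)) (at t within {0..})"
  obtains m where "\<And>T. T \<ge> 0 \<Longrightarrow> action 0 T \<phi> P \<le> m"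
proof -
  obtain m where \<phi>v: "primitive_curve \<phi> v" and m: "\<And>T. T \<ge> 0 \<Longrightarrow> action 0 T \<phi> v \<le> m"
    using min unfolding minimizing_def by blast
  have cP: "continuous_on {0..} P" by (rule continuous_on_vector_derivative) (use P in force)
  \<comment> \<open>Extending \<open>P\<close> by its initial value makes it continuous on the whole
    line, hence Borel.\<close>
  define Q where "Q = (\<lambda>t. P (max 0 t))"
  have cQ: "continuous_on A Q" for A
    unfolding Q_def by (rule continuous_on_compose2[OF cP]) (auto intro: continuous_intros)
  have QP: "Q t = P t" if "t \<ge> 0" for t using that by (simp add: Q_def)
  have \<phi>Q: "primitive_curve \<phi> Q"
    unfolding primitive_curve_def
  proof (intro conjI allI impI)
    show "Q \<in> borel_measurable borel" by (rule borel_measurable_continuous_onI[OF cQ])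
    show "set_integrable lborel {0..T} (\<lambda>t. (norm (Q t))\<^sup>2)" for T
      by (intro borel_integrable_atLeastAtMost' continuous_intros cQ)
    fix t :: real assume t: "t \<ge> 0"
    have "(Q has_integral (\<phi> t - \<phi> 0)) {0..t}"
    proof (rule fundamental_theorem_of_calculus[OF t])
      fix x assume "x \<in> {0..t}"
      then show "(\<phi> has_vector_derivative Q x) (at x within {0..t})"
        using has_vector_derivative_within_subset[OF \<phi>[of x], of "{0..t}"] by (simp add: QP subset_eq)
    qed
    then show "\<phi> t = \<phi> 0 + integral {0..t} Q" by (simp add: integral_unique)
  qed
  have ae: "AE t in lborel. t \<in> {0..} \<longrightarrow> v t = Q t"
    by (rule AE_eq_of_primitive_curves[OF \<phi>v \<phi>Q, of 0]) simp
  have eq: "action 0 T \<phi> P = action 0 T \<phi> v" for T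
  proof -
    have iQ: "set_integrable lborel {0..T} (\<lambda>x. (norm (Q x))\<^sup>2 / 2 + W (\<phi> x))"
      and iv: "set_integrable lborel {0..T} (\<lambda>x. (norm (v x))\<^sup>2 / 2 + W (\<phi> x))"
      by (rule action_integrable[OF \<phi>Q order_refl] action_integrable[OF \<phi>v order_refl])+
    have "action 0 T \<phi> P = action 0 T \<phi> Q"
      unfolding action_def by (rule Henstock_Kurzweil_Integration.integral_cong) (simp add: QP)
    also have "\<dots> = (LINT x:{0..T}|lborel. (norm (Q x))\<^sup>2 / 2 + W (\<phi> x))"
      unfolding action_def by (rule set_borel_integral_eq_integral(2)[OF iQ, symmetric])
    also have "\<dots> = (LINT x:{0..T}|lborel. (norm (v x))\<^sup>2 / 2 + W (\<phi> x))"
      unfolding set_lebesgue_integral_def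
    proof (rule integral_cong_AE)
      show "AE x in lborel. indicator {0..T} x *\<^sub>R ((norm (Q x))\<^sup>2 / 2 + W (\<phi> x)) =
          indicator {0..T} x *\<^sub>R ((norm (v x))\<^sup>2 / 2 + W (\<phi> x))"
        using ae by eventually_elim (auto simp: indicator_def)
    qed (use iQ iv in \<open>auto simp: set_integrable_def\<close>)
    also have "\<dots> = action 0 T \<phi> v"
      unfolding action_def by (rule set_borel_integral_eq_integral(2)[OF iv])
    finally show ?thesis .
  qed
  show thesis by (rule that[of m]) (simp add: eq m)
qed

end

section \<open>Smoothness\<close>

text \<open>The differential equation makes this algebra closed under differentiation in time.\<close>

inductive trig_algebra :: "(real \<Rightarrow> real ^ 'n) \<Rightarrow> (real \<Rightarrow> real ^ 'n) \<Rightarrow> (real \<Rightarrow> real) \<Rightarrow> bool"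
  for \<phi> P where
  const: "trig_algebra \<phi> P (\<lambda>_. a)"
| vel: "trig_algebra \<phi> P (\<lambda>t. P t $ j)"
| sine: "trig_algebra \<phi> P (\<lambda>t. sin (\<phi> t $ j))"
| cosine: "trig_algebra \<phi> P (\<lambda>t. cos (\<phi> t $ j))"
| plus: "trig_algebra \<phi> P f \<Longrightarrow> trig_algebra \<phi> P h \<Longrightarrow> trig_algebra \<phi> P (\<lambda>t. f t + h t)"
| times: "trig_algebra \<phi> P f \<Longrightarrow> trig_algebra \<phi> P h \<Longrightarrow> trig_algebra \<phi> P (\<lambda>t. f t * h t)"

lemma trig_algebra_derivative:
  fixes \<phi> P :: "real \<Rightarrow> real ^ 'n"
  assumes \<phi>: "\<And>t. t \<ge> 0 \<Longrightarrow> (\<phi> has_vector_derivative P t) (at t within {0..})"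
    and P: "\<And>t. t \<ge> 0 \<Longrightarrow> (P has_vector_derivative H t) (at t within {0..})"
    and H: "\<And>j. trig_algebra \<phi> P (\<lambda>t. H t $ j)"
    and f: "trig_algebra \<phi> P f"
  shows "\<exists>f'. trig_algebra \<phi> P f' \<and> (\<forall>t\<ge>0. (f has_real_derivative f' t) (at t within {0..}))"
  using f
proof induction
  case (const a)
  show ?case by (rule exI[of _ "\<lambda>_. 0"]) (auto intro: trig_algebra.const)
next
  case (vel j)
  show ?case by (rule exI[of _ "\<lambda>t. H t $ j"]) (auto intro: H has_vector_derivative_vecD P)
next
  case (sine j)
  have "((\<lambda>t. sin (\<phi> t $ j)) has_real_derivative cos (\<phi> t $ j) * P t $ j) (at t within {0..})" if "t \<ge> 0" for t
    by (rule derivative_eq_intros has_vector_derivative_vecD[OF \<phi>[OF that]] refl)+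
  then show ?case
    by (intro exI[of _ "\<lambda>t. cos (\<phi> t $ j) * P t $ j"]) (auto intro: trig_algebra.intros)
next
  case (cosine j)
  have "((\<lambda>t. cos (\<phi> t $ j)) has_real_derivative (-1) * (sin (\<phi> t $ j) * P t $ j)) (at t within {0..})" if "t \<ge> 0" for t
    by (rule derivative_eq_intros has_vector_derivative_vecD[OF \<phi>[OF that]] refl)+ simp
  then show ?case
    by (intro exI[of _ "\<lambda>t. (-1) * (sin (\<phi> t $ j) * P t $ j)"] conjI trig_algebra.intros) blast
next
  case (plus f h)
  from plus.IH obtain f' h' where "trig_algebra \<phi> P f'" "\<forall>t\<ge>0. (f has_real_derivative f' t) (at t within {0..})"
    "trig_algebra \<phi> P h'" "\<forall>t\<ge>0. (h has_real_derivative h' t) (at t within {0..})" by blast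
  then show ?case
    by (intro exI[of _ "\<lambda>t. f' t + h' t"]) (auto intro: trig_algebra.plus DERIV_add)
next
  case (times f h)
  from times.IH obtain f' h' where *: "trig_algebra \<phi> P f'" "\<forall>t\<ge>0. (f has_real_derivative f' t) (at t within {0..})"
    "trig_algebra \<phi> P h'" "\<forall>t\<ge>0. (h has_real_derivative h' t) (at t within {0..})" by blast
  have "((\<lambda>t. f t * h t) has_real_derivative f' t * h t + h' t * f t) (at t within {0..})" if "t \<ge> 0" for t
    using * that by (intro DERIV_mult) auto
  then show ?case
    using * times by (intro exI[of _ "\<lambda>t. f' t * h t + h' t * f t"]) (auto intro: trig_algebra.plus trig_algebra.times)
qed

lemma trig_algebra_smooth:
  fixes \<phi> P :: "real \<Rightarrow> real ^ 'n"
  assumes \<phi>: "\<And>t. t \<ge> 0 \<Longrightarrow> (\<phi> has_vector_derivative P t) (at t within {0..})"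
    and P: "\<And>t. t \<ge> 0 \<Longrightarrow> (P has_vector_derivative H t) (at t within {0..})"
    and H: "\<And>j. trig_algebra \<phi> P (\<lambda>t. H t $ j)"
    and lift: "is_lift \<phi> \<Phi>"
  shows "smooth_curve \<Phi>"
proof -
  \<comment> \<open>The membership condition sits under the existential quantifier so that the
    choice \<open>\<Delta>\<close> is total and can be iterated.\<close>
  have "\<forall>f. \<exists>f'. trig_algebra \<phi> P f \<longrightarrow> trig_algebra \<phi> P f' \<and> (\<forall>t\<ge>0. (f has_real_derivative f' t) (at t within {0..}))"
    using trig_algebra_derivative[OF \<phi> P H] by blast
  then obtain \<Delta> where \<Delta>: "\<And>f. trig_algebra \<phi> P f \<Longrightarrow> trig_algebra \<phi> P (\<Delta> f)"
    "\<And>f t. trig_algebra \<phi> P f \<Longrightarrow> t \<ge> 0 \<Longrightarrow> (f has_real_derivative \<Delta> f t) (at t within {0..})"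
    by metis
  \<comment> \<open>The algebra is generated from the velocity and from sines and cosines of the
    angles, not from the angles themselves; order 0 is therefore set apart.\<close>
  define D where "D = (\<lambda>k t. case k of 0 \<Rightarrow> \<phi> t | Suc n \<Rightarrow> (\<chi> j. (\<Delta> ^^ n) (\<lambda>t. P t $ j) t))"
  have alg: "trig_algebra \<phi> P ((\<Delta> ^^ n) (\<lambda>t. P t $ j))" for n j
    by (induction n) (auto intro: \<Delta> trig_algebra.vel)
  have "(D k has_vector_derivative D (Suc k) t) (at t within {0..})" if t: "t \<ge> 0" for k t
  proof (cases k)
    case 0
    then show ?thesis using \<phi>[OF t] by (simp add: D_def)
  next
    case (Suc n)
    show ?thesis
      by (rule has_vector_derivative_vecI) (use \<Delta>(2)[OF alg t] Suc in \<open>simp add: D_def\<close>)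
  qed
  moreover have "is_lift (D 0) \<Phi>" using lift by (simp add: D_def)
  ultimately show ?thesis unfolding smooth_curve_def by blast
qed

lemma potential_gradient_trig_algebra:
  "trig_algebra \<phi> P (\<lambda>t. potential_gradient \<kappa> c (\<phi> t) $ j)"
proof -
  have j: "j = \<alpha>_ix 1 \<or> j = \<gamma>_ix 1 \<or> j = \<alpha>_ix 2 \<or> j = \<gamma>_ix 2"
    using exhaust_4[of j] by (auto simp: index_simps)
  have *: "trig_algebra \<phi> P (\<lambda>t. potential_gradient \<kappa> c (\<phi> t) $ \<alpha>_ix i)"
    "trig_algebra \<phi> P (\<lambda>t. potential_gradient \<kappa> c (\<phi> t) $ \<gamma>_ix i)" for i
    unfolding potential_gradient_components tangential_def radial_def
    by (intro trig_algebra.intros)+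
  show ?thesis using j *[of 1] *[of 2] by (elim disjE) simp_all
qed

section \<open>Asymptotics of the balancing dynamics\<close>

text \<open>Isolates what the asymptotics rest on: the equation of motion and a bound on the
  action.\<close>

locale balancing = lagrangian "potential \<kappa> c" "potential_gradient \<kappa> c" L z
  for \<kappa> :: "real ^ 2" and c :: "real ^ 2 ^ 2" and L z +
  fixes \<phi> P :: "real \<Rightarrow> real ^ 4" and m :: real
  assumes \<kappa>_pos: "\<kappa> $ i > 0"
    and \<phi>: "\<And>t. t \<ge> 0 \<Longrightarrow> (\<phi> has_vector_derivative P t) (at t within {0..})"
    and P: "\<And>t. t \<ge> 0 \<Longrightarrow> (P has_vector_derivative potential_gradient \<kappa> c (\<phi> t)) (at t within {0..})"
    and m: "\<And>T. T \<ge> 0 \<Longrightarrow> action 0 T \<phi> P \<le> m"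
begin

abbreviation "al i t \<equiv> \<phi> t $ \<alpha>_ix i"
abbreviation "ga i t \<equiv> \<phi> t $ \<gamma>_ix i"
abbreviation "res i t \<equiv> residual (c $ i) (al i t) (ga i t)"
abbreviation "tg i t \<equiv> tangential (c $ i) (al i t)"
abbreviation "rd i t \<equiv> radial (c $ i) (al i t) (ga i t)"
abbreviation "u t \<equiv> potential \<kappa> c (\<phi> t)"

lemma u_tendsto: "(u \<longlongrightarrow> 0) at_top"
  by (rule W_along_curve_tendsto[OF \<phi> P m])

lemma P_tendsto: "(P \<longlongrightarrow> 0) at_top"
  by (rule velocity_tendsto[OF \<phi> P m])

lemma norm_P: "t \<ge> 0 \<Longrightarrow> (norm (P t))\<^sup>2 = 2 * u t"
  by (rule zero_energy[OF \<phi> P m])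

lemma continuous_on_curve: "continuous_on {0..} \<phi>"
  by (rule curve_continuous(1)[OF \<phi> P m])

lemma abs_u_derivative_le:
  "t \<ge> 0 \<Longrightarrow> \<bar>potential_gradient \<kappa> c (\<phi> t) \<bullet> P t\<bar> \<le> sqrt (8 * L) * u t"
  by (rule W_along_curve_Lipschitz[OF \<phi> P m])

lemma plane_le_u: "\<kappa> $ i / 2 * (res i t - residual_min (c $ i)) \<le> u t"
  unfolding potential_def
  by (rule member_le_sum) (use \<kappa>_pos residual_min_le in \<open>auto intro!: mult_nonneg_nonneg simp: less_imp_le\<close>)

lemma res_tendsto: "(res i \<longlongrightarrow> residual_min (c $ i)) at_top"
proof -
  have "((\<lambda>t. 2 / \<kappa> $ i * u t) \<longlongrightarrow> 2 / \<kappa> $ i * 0) at_top"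
    by (rule tendsto_mult[OF tendsto_const u_tendsto])
  then have l: "((\<lambda>t. 2 / \<kappa> $ i * u t) \<longlongrightarrow> 0) at_top" by (simp only: mult_zero_right)
  have "norm (res i t - residual_min (c $ i)) \<le> 2 / \<kappa> $ i * u t" for t
    using plane_le_u[of i t] \<kappa>_pos[of i] residual_min_le[of "c $ i" "al i t" "ga i t"]
    by (simp add: field_simps)
  from Lim_null_comparison[OF always_eventually[OF allI, OF this] l]
  show ?thesis by (rule LIM_zero_cancel)
qed

lemma curve_converges: "\<exists>l. (\<phi> \<longlongrightarrow> l) at_top \<and> potential \<kappa> c l = 0"
proof -
  have cont: "continuous_on {0..} (\<lambda>t. \<phi> t $ j)" for j
    by (intro continuous_intros continuous_on_curve)
  \<comment> \<open>For c_i = 0 the torque on \<alpha>_i vanishes, so its velocity is constant; as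
    the velocity tends to 0, this constant is 0.\<close>
  have const: "\<exists>a. \<forall>t\<ge>0. al i t = a" if "c $ i = 0" for i
  proof -
    have "((\<lambda>t. P t $ \<alpha>_ix i) has_real_derivative 0) (at t within {0..})" if t: "t \<in> {0..}" for t
      using has_vector_derivative_vecD[OF P, of t "\<alpha>_ix i"] t \<open>c $ i = 0\<close>
      by (simp add: potential_gradient_components tangential_def)
    then obtain p where "\<forall>t\<in>{0..}. P t $ \<alpha>_ix i = p"
      using has_field_derivative_zero_constant[OF convex_real_interval(1)] by blast
    then have p: "P t $ \<alpha>_ix i = p" if "t \<ge> 0" for t using that by simp
    have "((\<lambda>t. P t $ \<alpha>_ix i) \<longlongrightarrow> 0 $ \<alpha>_ix i) at_top" by (intro tendsto_intros P_tendsto)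
    moreover have "((\<lambda>t. P t $ \<alpha>_ix i) \<longlongrightarrow> p) at_top"
      by (rule tendsto_eventually, rule eventually_at_top_linorderI[of 0]) (rule p)
    ultimately have "p = 0" using tendsto_unique[of at_top] by force
    have "((\<lambda>t. al i t) has_real_derivative 0) (at t within {0..})" if t: "t \<in> {0..}" for t
      using has_vector_derivative_vecD[OF \<phi>, of t "\<alpha>_ix i"] t p[of t] \<open>p = 0\<close> by simp
    then obtain a where "\<forall>t\<in>{0..}. al i t = a"
      using has_field_derivative_zero_constant[OF convex_real_interval(1)] by blast
    then show ?thesis by (intro exI[of _ a]) auto
  qed
  have "\<exists>a. ((\<lambda>t. \<phi> t $ j) \<longlongrightarrow> a) at_top" for j
  proof -
    have j: "j = \<alpha>_ix 1 \<or> j = \<gamma>_ix 1 \<or> j = \<alpha>_ix 2 \<or> j = \<gamma>_ix 2"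
      using exhaust_4[of j] by (auto simp: index_simps)
    have *: "\<exists>a. (al i \<longlongrightarrow> a) at_top" "\<exists>a. (ga i \<longlongrightarrow> a) at_top" for i
      by (rule plane_angles_converge[OF cont cont res_tendsto const]; assumption)+
    show ?thesis using j *[of 1] *[of 2] by (elim disjE) simp_all
  qed
  then obtain a where a: "\<And>j. ((\<lambda>t. \<phi> t $ j) \<longlongrightarrow> a j) at_top" by metis
  define l :: "real ^ 4" where "l = (\<chi> j. a j)"
  have l: "(\<phi> \<longlongrightarrow> l) at_top" by (rule vec_tendstoI) (simp add: l_def a)
  have "((\<lambda>t. u t) \<longlongrightarrow> potential \<kappa> c l) at_top"
    using continuous_on_tendsto_compose[OF continuous_on_W[OF continuous_on_id, of UNIV] l] by simp
  from tendsto_unique[OF _ this u_tendsto] have "potential \<kappa> c l = 0" by simp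
  then show ?thesis using l by blast
qed

definition u' :: "real \<Rightarrow> real" where
  "u' t = (\<Sum>i\<in>UNIV. \<kappa> $ i * (cos (ga i t) * tg i t * P t $ \<alpha>_ix i
     - sin (ga i t) * rd i t * P t $ \<gamma>_ix i))"

text \<open>The Hessian of half the residual at the velocity. The two squares are the squared speed
  of cos \<gamma> e; the other terms carry the tangential or radial force as a factor.\<close>

definition remainder :: "2 \<Rightarrow> real \<Rightarrow> real" where
  "remainder i t = (cos (ga i t))\<^sup>2 * (P t $ \<alpha>_ix i)\<^sup>2 + (sin (ga i t))\<^sup>2 * (P t $ \<gamma>_ix i)\<^sup>2
     - 2 * sin (ga i t) * tg i t * P t $ \<alpha>_ix i * P t $ \<gamma>_ix i
     - cos (ga i t) * rd i t * ((P t $ \<alpha>_ix i)\<^sup>2 + (P t $ \<gamma>_ix i)\<^sup>2)"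

text \<open>By the equation of motion, the squared gradient of the potential plus its Hessian at the
  velocity.\<close>

definition u'' :: "real \<Rightarrow> real" where
  "u'' t = (\<Sum>i\<in>UNIV. \<kappa> $ i * (\<kappa> $ i * ((cos (ga i t))\<^sup>2 * (tg i t)\<^sup>2
     + (sin (ga i t))\<^sup>2 * (rd i t)\<^sup>2) + remainder i t))"

lemma u_derivative:
  assumes t: "t \<ge> 0" shows "(u has_real_derivative u' t) (at t within {0..})"
  using W_along_curve_derivative[OF \<phi>[OF t]]
  by (simp add: inner_vec4 potential_gradient_components u'_def algebra_simps)

lemma u'_derivative:
  assumes t: "t \<ge> 0" shows "(u' has_real_derivative u'' t) (at t within {0..})"
proof -
  have d: "((\<lambda>t. \<phi> t $ j) has_real_derivative P t $ j) (at t within {0..})" for j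
    by (rule has_vector_derivative_vecD[OF \<phi>[OF t]])
  have dP: "((\<lambda>t. P t $ \<alpha>_ix i) has_real_derivative \<kappa> $ i * cos (ga i t) * tg i t) (at t within {0..})"
    "((\<lambda>t. P t $ \<gamma>_ix i) has_real_derivative - \<kappa> $ i * sin (ga i t) * rd i t) (at t within {0..})" for i
    by (rule has_vector_derivative_vecD[OF P[OF t], of "\<alpha>_ix i", unfolded potential_gradient_components]
      has_vector_derivative_vecD[OF P[OF t], of "\<gamma>_ix i", unfolded potential_gradient_components])+
  have dp: "((\<lambda>t. tg i t) has_real_derivative
      - (rd i t - cos (ga i t)) * P t $ \<alpha>_ix i) (at t within {0..})" for i
    unfolding tangential_def radial_def
    by (rule derivative_eq_intros d refl)+ (simp add: algebra_simps)
  have dq: "((\<lambda>t. rd i t) has_real_derivative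
      tg i t * P t $ \<alpha>_ix i - sin (ga i t) * P t $ \<gamma>_ix i) (at t within {0..})" for i
    unfolding tangential_def radial_def
    by (rule derivative_eq_intros d refl)+ (simp add: algebra_simps)
  have "((\<lambda>t. \<kappa> $ i * (cos (ga i t) * tg i t * P t $ \<alpha>_ix i
     - sin (ga i t) * rd i t * P t $ \<gamma>_ix i)) has_real_derivative
    \<kappa> $ i * (\<kappa> $ i * ((cos (ga i t))\<^sup>2 * (tg i t)\<^sup>2
     + (sin (ga i t))\<^sup>2 * (rd i t)\<^sup>2) + remainder i t)) (at t within {0..})" for i
    unfolding remainder_def
    by (rule derivative_eq_intros d dp dq dP refl)+ (simp add: algebra_simps power2_eq_square)
  then show ?thesis
    unfolding u'_def[abs_def] u''_def by (intro DERIV_sum)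
qed

text \<open>The squares are discarded, and zero energy turns the squared speed in the other terms
  into twice the potential.\<close>

lemma remainder_ge:
  assumes t: "t \<ge> 0"
  shows "- ((\<bar>tg i t\<bar> + \<bar>rd i t\<bar>) * (2 * u t)) \<le> remainder i t"
proof -
  define A B p q where "A = P t $ \<alpha>_ix i" and "B = P t $ \<gamma>_ix i"
    and "p = tg i t" and "q = rd i t"
  have "A\<^sup>2 + B\<^sup>2 \<le> P t \<bullet> P t"
    unfolding inner_vec4 A_def B_def power2_eq_square
    by (rule member_le_sum[of i UNIV "\<lambda>i. P t $ \<alpha>_ix i * P t $ \<alpha>_ix i + P t $ \<gamma>_ix i * P t $ \<gamma>_ix i"]) auto
  then have AB: "A\<^sup>2 + B\<^sup>2 \<le> 2 * u t" using norm_P[OF t] by (simp add: power2_norm_eq_inner)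
  have "\<bar>2 * sin (ga i t) * p * A * B\<bar> \<le> \<bar>p\<bar> * (A\<^sup>2 + B\<^sup>2)"
  proof -
    have "\<bar>2 * A * B\<bar> \<le> A\<^sup>2 + B\<^sup>2"
      using zero_le_power2[of "A - B"] zero_le_power2[of "A + B"] unfolding power2_diff power2_sum by linarith
    then have "\<bar>sin (ga i t)\<bar> * (\<bar>p\<bar> * \<bar>2 * A * B\<bar>) \<le> 1 * (\<bar>p\<bar> * (A\<^sup>2 + B\<^sup>2))"
      by (intro mult_mono mult_left_mono) auto
    then show ?thesis by (simp add: abs_mult mult_ac)
  qed
  moreover have "\<bar>cos (ga i t) * q * (A\<^sup>2 + B\<^sup>2)\<bar> \<le> \<bar>q\<bar> * (A\<^sup>2 + B\<^sup>2)"
  proof -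
    have "\<bar>cos (ga i t)\<bar> * (\<bar>q\<bar> * (A\<^sup>2 + B\<^sup>2)) \<le> 1 * (\<bar>q\<bar> * (A\<^sup>2 + B\<^sup>2))"
      by (intro mult_right_mono) auto
    then show ?thesis by (simp add: abs_mult mult_ac)
  qed
  moreover have "0 \<le> (cos (ga i t))\<^sup>2 * A\<^sup>2 + (sin (ga i t))\<^sup>2 * B\<^sup>2" by simp
  ultimately have "- (\<bar>p\<bar> * (A\<^sup>2 + B\<^sup>2) + \<bar>q\<bar> * (A\<^sup>2 + B\<^sup>2)) \<le> remainder i t"
    unfolding remainder_def A_def[symmetric] B_def[symmetric] p_def[symmetric] q_def[symmetric] by linarith
  moreover have "\<bar>p\<bar> * (A\<^sup>2 + B\<^sup>2) + \<bar>q\<bar> * (A\<^sup>2 + B\<^sup>2) \<le> (\<bar>p\<bar> + \<bar>q\<bar>) * (2 * u t)"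
    unfolding distrib_right by (intro add_mono mult_left_mono AB) auto
  ultimately show ?thesis unfolding p_def q_def by linarith
qed

text \<open>The squared gradient is eventually at least 2 \<open>rate\<close> u, while the Hessian
  is at least -2 \<epsilon> u with \<epsilon> tending to 0, because the limiting residual is 0. Once
  \<epsilon> < \<open>rate\<close> / 2, half of the gain survives: u'' >= \<open>rate\<close>
  u.\<close>

lemma exponential_decay:
  assumes small: "\<And>i. norm (c $ i) < 1"
  shows "\<exists>C>0. \<exists>\<mu>>0. \<forall>t\<ge>0. u t \<le> C * exp (- \<mu> * t)"
proof -
  have "\<forall>i. \<exists>\<sigma>>0. \<forall>\<^sub>F t in at_top. \<sigma> * res i t \<le> (cos (ga i t))\<^sup>2 * (tg i t)\<^sup>2
     + (sin (ga i t))\<^sup>2 * (rd i t)\<^sup>2"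
    using gradient_dominates_residual[OF res_tendsto small] by blast
  from choice[OF this] obtain \<sigma> where "\<forall>i. \<sigma> i > 0 \<and> (\<forall>\<^sub>F t in at_top. \<sigma> i * res i t \<le>
     (cos (ga i t))\<^sup>2 * (tg i t)\<^sup>2 + (sin (ga i t))\<^sup>2 * (rd i t)\<^sup>2)"
    by blast
  then have \<sigma>: "\<sigma> i > 0" "\<forall>\<^sub>F t in at_top. \<sigma> i * res i t \<le>
     (cos (ga i t))\<^sup>2 * (tg i t)\<^sup>2 + (sin (ga i t))\<^sup>2 * (rd i t)\<^sup>2" for i
    by blast+
  define rate where "rate = min (\<kappa> $ 1 * \<sigma> 1) (\<kappa> $ 2 * \<sigma> 2)"
  have rate0: "rate > 0" using \<sigma> \<kappa>_pos by (simp add: rate_def)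
  have rate_i: "rate \<le> \<kappa> $ i * \<sigma> i" for i using exhaust_2[of i] by (auto simp: rate_def)
  have rm: "residual_min (c $ i) = 0" for i using small[of i] by (simp add: residual_min_def)
  define \<epsilon> where "\<epsilon> = (\<lambda>t. \<Sum>i\<in>UNIV. \<kappa> $ i * (\<bar>tg i t\<bar> + \<bar>rd i t\<bar>))"
  have pq: "((\<lambda>t. \<bar>tg i t\<bar>) \<longlongrightarrow> 0) at_top" "((\<lambda>t. \<bar>rd i t\<bar>) \<longlongrightarrow> 0) at_top" for i
  proof -
    have "((\<lambda>t. sqrt (res i t)) \<longlongrightarrow> sqrt (residual_min (c $ i))) at_top" by (intro tendsto_intros res_tendsto)
    then have l: "((\<lambda>t. sqrt (res i t)) \<longlongrightarrow> 0) at_top" by (simp add: rm)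
    have bnd: "norm \<bar>tg i t\<bar> \<le> sqrt (res i t)" "norm \<bar>rd i t\<bar> \<le> sqrt (res i t)" for t
      by (rule real_le_rsqrt, simp add: residual_def)+
    show "((\<lambda>t. \<bar>tg i t\<bar>) \<longlongrightarrow> 0) at_top"
      by (rule Lim_null_comparison[OF always_eventually[OF allI, OF bnd(1)] l])
    show "((\<lambda>t. \<bar>rd i t\<bar>) \<longlongrightarrow> 0) at_top"
      by (rule Lim_null_comparison[OF always_eventually[OF allI, OF bnd(2)] l])
  qed
  have "(\<epsilon> \<longlongrightarrow> (\<Sum>i\<in>UNIV. \<kappa> $ i * (0 + 0))) at_top"
    unfolding \<epsilon>_def by (intro tendsto_intros pq)
  then have "(\<epsilon> \<longlongrightarrow> 0) at_top" by simp
  then have e\<epsilon>: "\<forall>\<^sub>F t in at_top. \<epsilon> t < rate / 2" using rate0 by (intro order_tendstoD) auto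
  have e\<sigma>: "\<forall>\<^sub>F t in at_top. \<forall>i. \<sigma> i * res i t \<le> (cos (ga i t))\<^sup>2 * (tg i t)\<^sup>2
     + (sin (ga i t))\<^sup>2 * (rd i t)\<^sup>2"
    using \<sigma>(2) by (simp add: eventually_all_finite)
  have "\<forall>\<^sub>F t in at_top. rate * u t \<le> u'' t"
    using e\<epsilon> e\<sigma> eventually_ge_at_top[of 0]
  proof eventually_elim
    case (elim t)
    have "(\<Sum>i\<in>UNIV. 2 * rate * (\<kappa> $ i / 2 * res i t) - \<kappa> $ i * (\<bar>tg i t\<bar> + \<bar>rd i t\<bar>) * (2 * u t)) \<le> u'' t"
      unfolding u''_def
    proof (rule sum_mono)
      fix i
      have r0: "0 \<le> res i t" by (simp add: residual_def)
      have "2 * rate * (\<kappa> $ i / 2 * res i t) = \<kappa> $ i * (rate * res i t)" by simp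
      also have "\<dots> \<le> \<kappa> $ i * (\<kappa> $ i * (\<sigma> i * res i t))"
        using mult_right_mono[OF rate_i[of i] r0] \<kappa>_pos[of i] by (intro mult_left_mono) (auto simp: mult.assoc)
      also have "\<dots> \<le> \<kappa> $ i * (\<kappa> $ i * ((cos (ga i t))\<^sup>2 * (tg i t)\<^sup>2
          + (sin (ga i t))\<^sup>2 * (rd i t)\<^sup>2))"
        using elim(2) \<kappa>_pos[of i] by (intro mult_left_mono) auto
      finally have 1: "2 * rate * (\<kappa> $ i / 2 * res i t) \<le> \<kappa> $ i * (\<kappa> $ i * ((cos (ga i t))\<^sup>2 * (tg i t)\<^sup>2
          + (sin (ga i t))\<^sup>2 * (rd i t)\<^sup>2))" .
      have 2: "\<kappa> $ i * (- ((\<bar>tg i t\<bar> + \<bar>rd i t\<bar>) * (2 * u t))) \<le> \<kappa> $ i * remainder i t"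
        using remainder_ge[OF elim(3), of i] \<kappa>_pos[of i] by (intro mult_left_mono) auto
      show "2 * rate * (\<kappa> $ i / 2 * res i t) - \<kappa> $ i * (\<bar>tg i t\<bar> + \<bar>rd i t\<bar>) * (2 * u t)
        \<le> \<kappa> $ i * (\<kappa> $ i * ((cos (ga i t))\<^sup>2 * (tg i t)\<^sup>2
          + (sin (ga i t))\<^sup>2 * (rd i t)\<^sup>2) + remainder i t)"
        using add_mono[OF 1 2] by (simp add: algebra_simps)
    qed
    also have "(\<Sum>i\<in>UNIV. 2 * rate * (\<kappa> $ i / 2 * res i t) - \<kappa> $ i * (\<bar>tg i t\<bar> + \<bar>rd i t\<bar>) * (2 * u t))
        = 2 * rate * u t - \<epsilon> t * (2 * u t)"
    proof -
      have "u t = (\<Sum>i\<in>UNIV. \<kappa> $ i / 2 * res i t)" by (simp add: potential_def rm)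
      then show ?thesis unfolding sum_subtractf \<epsilon>_def sum_distrib_right by (simp only: sum_distrib_left)
    qed
    finally have "2 * rate * u t - \<epsilon> t * (2 * u t) \<le> u'' t" .
    moreover have "\<epsilon> t * (2 * u t) \<le> rate / 2 * (2 * u t)"
      using elim(1) W_nonneg by (intro mult_right_mono) auto
    ultimately show ?case by simp
  qed
  then obtain T' where T': "\<And>t. t \<ge> T' \<Longrightarrow> rate * u t \<le> u'' t" by (auto simp: eventually_at_top_linorder)
  define T where "T = max T' 0"
  define \<mu> where "\<mu> = sqrt rate"
  have \<mu>: "\<mu> > 0" "\<mu>\<^sup>2 = rate" using rate0 by (auto simp: \<mu>_def)
  \<comment> \<open>Excludes the exponentially growing solution in
    \<open>second_order_exponential_decay\<close>.\<close>
  have u'0: "(u' \<longlongrightarrow> 0) at_top"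
  proof -
    have "((\<lambda>t. sqrt (8 * L) * u t) \<longlongrightarrow> sqrt (8 * L) * 0) at_top"
      by (rule tendsto_mult[OF tendsto_const u_tendsto])
    then have l: "((\<lambda>t. sqrt (8 * L) * u t) \<longlongrightarrow> 0) at_top" by (simp only: mult_zero_right)
    have "u' t = potential_gradient \<kappa> c (\<phi> t) \<bullet> P t" for t
      by (simp add: inner_vec4 potential_gradient_components u'_def algebra_simps)
    then have "\<forall>\<^sub>F t in at_top. norm (u' t) \<le> sqrt (8 * L) * u t"
      using abs_u_derivative_le by (intro eventually_at_top_linorderI[of 0]) simp
    then show ?thesis using l by (rule Lim_null_comparison)
  qed
  have late: "u t \<le> u T * exp (- \<mu> * (t - T))" if t: "t \<ge> T" for t
  proof (rule second_order_exponential_decay[of T u u' u'' \<mu>])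
    show "(u has_real_derivative u' t) (at t within {0..})" "(u' has_real_derivative u'' t) (at t within {0..})"
      "\<mu>\<^sup>2 * u t \<le> u'' t" if "t \<ge> T" for t
      using that u_derivative[of t] u'_derivative[of t] T'[of t] by (auto simp: T_def \<mu>)
  qed (use \<mu> u_tendsto u'0 t in \<open>auto simp: T_def\<close>)
  have T0: "T \<ge> 0" by (simp add: T_def)
  have "continuous_on {0..T} u"
    by (intro continuous_on_W continuous_on_subset[OF continuous_on_curve]) auto
  then have "bounded (u ` {0..T})"
    by (intro compact_imp_bounded compact_continuous_image) auto
  then obtain B0 where B0: "\<And>t. t \<in> {0..T} \<Longrightarrow> \<bar>u t\<bar> \<le> B0"
    unfolding bounded_iff by (metis imageI real_norm_def)
  define B where "B = max B0 1"
  have B: "u t \<le> B" if "t \<in> {0..T}" for t using B0[OF that] by (simp add: B_def)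
  have B1: "B > 0" by (simp add: B_def)
  have "u t \<le> B * exp (\<mu> * T) * exp (- \<mu> * t)" if t: "t \<ge> 0" for t
  proof (cases "t \<le> T")
    case True
    have "u t \<le> B * 1" using B[of t] True t by simp
    also have "\<dots> \<le> B * exp (\<mu> * (T - t))" using B1 \<mu> True by (intro mult_left_mono) auto
    finally show ?thesis by (simp add: exp_add[symmetric] algebra_simps)
  next
    case False
    then have "u t \<le> u T * exp (- \<mu> * (t - T))" by (intro late) simp
    also have "\<dots> \<le> B * exp (- \<mu> * (t - T))" using B[of T] T0 by (intro mult_right_mono) auto
    finally show ?thesis by (simp add: exp_add[symmetric] algebra_simps)
  qed
  then show ?thesis using B1 \<mu> by (intro exI[of _ "B * exp (\<mu> * T)"] exI[of _ \<mu>] conjI) auto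
qed

end

section \<open>The balancing problem\<close>

context
  fixes m r :: "real ^ 2" and \<omega> \<beta> :: real and F c :: "real ^ 2 ^ 2" and G :: "angle ^ 4 \<Rightarrow> real"
  assumes pos: "\<And>i. m $ i > 0" "\<And>i. r $ i > 0" "\<omega> > 0" "\<beta> > 0"
    and G: "G = imbalance_indicator m r \<omega> F"
    and c: "\<And>i. c $ i = (1 / (2 * m $ i * r $ i * \<omega>\<^sup>2)) *\<^sub>R F $ i"
begin

text \<open>Writing F_i as \<open>2 * m $ i * r $ i * \<omega>\<^sup>2\<close> times c_i extracts
  the square of this factor from the imbalance of each plane; \<beta> is the weight in the
  cost.\<close>

definition stiffness :: "real ^ 2" where
  "stiffness = (\<chi> i. \<beta> * (2 * m $ i * r $ i * \<omega>\<^sup>2)\<^sup>2)"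

lemma stiffness_pos: "stiffness $ i > 0"
  using pos(1)[of i] pos(2)[of i] pos(3,4) by (simp add: stiffness_def)

lemma plane_imbalance_residual:
  "plane_imbalance (m $ i) (r $ i) \<omega> (F $ i) (angle_of x) (angle_of y) =
     (2 * m $ i * r $ i * \<omega>\<^sup>2)\<^sup>2 * residual (c $ i) x y"
proof -
  define K where "K = 2 * m $ i * r $ i * \<omega>\<^sup>2"
  have "K \<noteq> 0" using pos(1)[of i] pos(2)[of i] pos(3) by (simp add: K_def)
  then have F: "F $ i $ 1 = K * c $ i $ 1" "F $ i $ 2 = K * c $ i $ 2"
    by (simp_all add: c K_def)
  have alg: "(K * y * p + K * d)\<^sup>2 + (K * y * q + K * e)\<^sup>2 =
      K\<^sup>2 * (y\<^sup>2 * (q\<^sup>2 + p\<^sup>2) + 2 * y * (d * p + e * q) + (d\<^sup>2 + e\<^sup>2))" for y p q d e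
    by (simp add: power2_eq_square algebra_simps)
  have sc: "(sin x)\<^sup>2 + (cos x)\<^sup>2 = 1" by simp
  have "plane_imbalance (m $ i) (r $ i) \<omega> (F $ i) (angle_of x) (angle_of y) =
      (K * cos y * cos x + K * c $ i $ 1)\<^sup>2 + (K * cos y * sin x + K * c $ i $ 2)\<^sup>2"
    by (simp add: plane_imbalance_def F K_def)
  also have "\<dots> = K\<^sup>2 * ((cos y)\<^sup>2 * ((sin x)\<^sup>2 + (cos x)\<^sup>2) + 2 * cos y * (c $ i $ 1 * cos x + c $ i $ 2 * sin x)
      + ((c $ i $ 1)\<^sup>2 + (c $ i $ 2)\<^sup>2))"
    by (rule alg)
  also have "\<dots> = K\<^sup>2 * residual (c $ i) x y"
    unfolding residual_expand radial_def norm_sq_vec2 sc by simp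
  finally show ?thesis by (simp add: K_def)
qed

lemma imbalance_residual:
  "G (torus_of x) = (\<Sum>i\<in>UNIV. (2 * m $ i * r $ i * \<omega>\<^sup>2)\<^sup>2 * residual (c $ i) (x $ \<alpha>_ix i) (x $ \<gamma>_ix i))"
  by (simp add: G imbalance_indicator_def torus_of_def plane_imbalance_residual sum_2 index_simps)

text \<open>The planes have no angle in common, so both residuals attain their minima at the single
  point \<open>z\<close>.\<close>

lemma imbalance_min:
  "Inf (range G) = (\<Sum>i\<in>UNIV. (2 * m $ i * r $ i * \<omega>\<^sup>2)\<^sup>2 * residual_min (c $ i))"
  "Inf (range G) \<le> G p"
proof -
  define I where "I = (\<Sum>i\<in>UNIV. (2 * m $ i * r $ i * \<omega>\<^sup>2)\<^sup>2 * residual_min (c $ i))"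
  have lower: "I \<le> G p" for p
  proof -
    obtain x where x: "torus_of x = p" using torus_of_surj by blast
    show ?thesis
      unfolding x[symmetric] imbalance_residual I_def
      by (intro sum_mono mult_left_mono residual_min_le) auto
  qed
  have "\<forall>i. \<exists>a b. residual (c $ i) a b = residual_min (c $ i)" using residual_min_attained by blast
  then obtain a b where ab: "\<And>i. residual (c $ i) (a i) (b i) = residual_min (c $ i)" by metis
  define z :: "real ^ 4" where "z = (\<chi> j. if j = 1 then a 1 else if j = 2 then b 1 else if j = 3 then a 2 else b 2)"
  have "G (torus_of z) = I" by (simp add: imbalance_residual I_def sum_2 index_simps z_def ab)
  then have "I \<in> range G" by (metis rangeI)
  then have "Inf (range G) = I" by (rule cInf_eq_minimum) (use lower in auto)
  then show "Inf (range G) = (\<Sum>i\<in>UNIV. (2 * m $ i * r $ i * \<omega>\<^sup>2)\<^sup>2 * residual_min (c $ i))" "Inf (range G) \<le> G p"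
    using lower by (simp_all add: I_def)
qed

lemma potential_excess: "potential stiffness c x = \<beta> / 2 * excess G (torus_of x)"
  unfolding potential_def excess_def imbalance_residual imbalance_min(1) sum_subtractf[symmetric] sum_distrib_left
  by (rule sum.cong) (simp_all add: stiffness_def algebra_simps)

lemma torus_lagrangian_exists:
  "\<exists>L z. torus_lagrangian (potential stiffness c) (potential_gradient stiffness c) L z G \<beta>"
proof -
  obtain L z where L: "lagrangian (potential stiffness c) (potential_gradient stiffness c) L z"
    using potential_lagrangian[of stiffness c] stiffness_pos by blast
  then interpret lagrangian "potential stiffness c" "potential_gradient stiffness c" L z .
  have "torus_lagrangian (potential stiffness c) (potential_gradient stiffness c) L z G \<beta>"
    by unfold_locales (rule potential_excess)
  then show ?thesis by blast
qed

lemma imbalance_optimal_exists: "\<exists>\<Phi>. optimal \<beta> G \<Phi>\<^sub>0 \<Phi>"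
proof -
  obtain L z where "torus_lagrangian (potential stiffness c) (potential_gradient stiffness c) L z G \<beta>"
    using torus_lagrangian_exists by blast
  then show ?thesis by (rule torus_lagrangian.optimal_exists)
qed

lemma optimal_dynamics:
  assumes "optimal \<beta> G \<Phi>\<^sub>0 \<Phi>"
  obtains L z \<phi> P A where "balancing stiffness c L z \<phi> P A" "\<And>t. t \<ge> 0 \<Longrightarrow> torus_of (\<phi> t) = \<Phi> t"
proof -
  obtain L z where T: "torus_lagrangian (potential stiffness c) (potential_gradient stiffness c) L z G \<beta>"
    using torus_lagrangian_exists by blast
  then interpret torus_lagrangian "potential stiffness c" "potential_gradient stiffness c" L z G \<beta> .
  obtain \<phi> v where \<phi>: "minimizing \<phi> v" "\<And>t. t \<ge> 0 \<Longrightarrow> torus_of (\<phi> t) = \<Phi> t"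
    using optimal_lift[OF assms] by blast
  obtain P where P: "\<And>t. t \<ge> 0 \<Longrightarrow> (\<phi> has_vector_derivative P t) (at t within {0..})"
    "\<And>t. t \<ge> 0 \<Longrightarrow> (P has_vector_derivative potential_gradient stiffness c (\<phi> t)) (at t within {0..})"
    using minimizing_euler_lagrange[OF \<phi>(1)] by blast
  obtain A where A: "\<And>T. T \<ge> 0 \<Longrightarrow> action 0 T \<phi> P \<le> A"
    using minimizing_action_bound[OF \<phi>(1), of P] P by blast
  have "balancing stiffness c L z \<phi> P A"
    by unfold_locales (use stiffness_pos P A in auto)
  then show thesis using \<phi>(2) that by blast
qed

section \<open>Optimal trajectories on the torus\<close>

context
  fixes L z \<phi> P A and \<Phi> :: "real \<Rightarrow> angle ^ 4"
  assumes bal: "balancing stiffness c L z \<phi> P A" and \<Phi>: "\<And>t. t \<ge> 0 \<Longrightarrow> torus_of (\<phi> t) = \<Phi> t"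
begin

interpretation balancing stiffness c L z \<phi> P A by (rule bal)

lemma trajectory_lift: "is_lift \<phi> \<Phi>"
  using continuous_on_curve \<Phi> by (simp add: is_lift_def)

lemma trajectory_smooth: "smooth_curve \<Phi>"
  by (rule trig_algebra_smooth[OF \<phi> P potential_gradient_trig_algebra trajectory_lift])

lemma trajectory_velocity: "t \<ge> 0 \<Longrightarrow> velocity \<Phi> t = P t"
  by (rule velocity_eq[OF trajectory_lift \<phi>])

lemma trajectory_acceleration:
  assumes t: "t > 0"
  shows "vector_derivative (velocity \<Phi>) (at t) = potential_gradient stiffness c (\<phi> t)"
proof -
  have "(P has_vector_derivative potential_gradient stiffness c (\<phi> t)) (at t within {0..})"
    using P t by simp
  then have "(P has_vector_derivative potential_gradient stiffness c (\<phi> t)) (at t)"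
    using at_within_interior[of t "{0..}"] t by simp
  then have "(velocity \<Phi> has_vector_derivative potential_gradient stiffness c (\<phi> t)) (at t)"
    by (rule has_vector_derivative_transform_within_open[of _ _ _ "{0<..}"])
      (use t trajectory_velocity in auto)
  then show ?thesis by (rule vector_derivative_at)
qed

text \<open>The angles of the lift enter the gradient only through sine and cosine, which descend to
  the circle. Signs and the factor \<open>(2 * m $ i * r $ i * \<omega>\<^sup>2)\<^sup>2\<close> are
  those of the gradient of \<beta>/2 times G.\<close>

lemma trajectory_euler_lagrange:
  assumes t: "t > 0"
  shows "- vector_derivative (velocity \<Phi>) (at t) $ \<alpha>_ix i =
      - \<beta> * (2 * m $ i * r $ i * \<omega>\<^sup>2)\<^sup>2 * cos_angle (\<Phi> t $ \<gamma>_ix i) *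
      (- c $ i $ 1 * sin_angle (\<Phi> t $ \<alpha>_ix i) + c $ i $ 2 * cos_angle (\<Phi> t $ \<alpha>_ix i))"
    and "- vector_derivative (velocity \<Phi>) (at t) $ \<gamma>_ix i =
      \<beta> * (2 * m $ i * r $ i * \<omega>\<^sup>2)\<^sup>2 * sin_angle (\<Phi> t $ \<gamma>_ix i) *
      (c $ i $ 1 * cos_angle (\<Phi> t $ \<alpha>_ix i) + c $ i $ 2 * sin_angle (\<Phi> t $ \<alpha>_ix i)
       + cos_angle (\<Phi> t $ \<gamma>_ix i))"
proof -
  have "\<Phi> t $ j = angle_of (\<phi> t $ j)" for j using \<Phi>[of t] t by (auto simp: torus_of_def vec_eq_iff)
  then show "- vector_derivative (velocity \<Phi>) (at t) $ \<alpha>_ix i =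
      - \<beta> * (2 * m $ i * r $ i * \<omega>\<^sup>2)\<^sup>2 * cos_angle (\<Phi> t $ \<gamma>_ix i) *
      (- c $ i $ 1 * sin_angle (\<Phi> t $ \<alpha>_ix i) + c $ i $ 2 * cos_angle (\<Phi> t $ \<alpha>_ix i))"
    "- vector_derivative (velocity \<Phi>) (at t) $ \<gamma>_ix i =
      \<beta> * (2 * m $ i * r $ i * \<omega>\<^sup>2)\<^sup>2 * sin_angle (\<Phi> t $ \<gamma>_ix i) *
      (c $ i $ 1 * cos_angle (\<Phi> t $ \<alpha>_ix i) + c $ i $ 2 * sin_angle (\<Phi> t $ \<alpha>_ix i)
       + cos_angle (\<Phi> t $ \<gamma>_ix i))"
    unfolding trajectory_acceleration[OF t] potential_gradient_components
    by (simp_all add: stiffness_def tangential_def radial_def)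
qed

lemma trajectory_velocity_tendsto: "(velocity \<Phi> \<longlongrightarrow> 0) at_top"
proof -
  have "\<forall>\<^sub>F t in at_top. P t = velocity \<Phi> t"
    by (rule eventually_at_top_linorderI[of 0]) (simp add: trajectory_velocity)
  then show ?thesis by (rule Lim_transform_eventually[OF P_tendsto])
qed

lemma trajectory_excess: "t \<ge> 0 \<Longrightarrow> excess G (\<Phi> t) = 2 / \<beta> * u t"
  using potential_excess[of "\<phi> t"] \<Phi>[of t] pos(4) by (simp add: field_simps)

lemma trajectory_excess_tendsto: "((\<lambda>t. \<bar>excess G (\<Phi> t)\<bar>) \<longlongrightarrow> 0) at_top"
proof -
  have "((\<lambda>t. \<bar>2 / \<beta> * u t\<bar>) \<longlongrightarrow> \<bar>2 / \<beta> * 0\<bar>) at_top"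
    by (intro tendsto_rabs tendsto_mult tendsto_const u_tendsto)
  then have l: "((\<lambda>t. \<bar>2 / \<beta> * u t\<bar>) \<longlongrightarrow> 0) at_top" by simp
  have "\<forall>\<^sub>F t in at_top. \<bar>2 / \<beta> * u t\<bar> = \<bar>excess G (\<Phi> t)\<bar>"
    by (rule eventually_at_top_linorderI[of 0]) (simp add: trajectory_excess)
  then show ?thesis by (rule Lim_transform_eventually[OF l])
qed

lemma dist_torus_of_le: "dist (torus_of x) (torus_of y) \<le> norm (x - y)"
  unfolding dist_torus by (rule cInf_lower) (auto intro!: bdd_belowI[of _ 0])

lemma trajectory_converges:
  obtains l where "torus_of l \<in> argmin_set G" "(\<phi> \<longlongrightarrow> l) at_top" "(\<Phi> \<longlongrightarrow> torus_of l) at_top"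
proof -
  obtain l where l: "(\<phi> \<longlongrightarrow> l) at_top" "potential stiffness c l = 0" using curve_converges by blast
  have "G (torus_of l) = Inf (range G)"
    using potential_excess[of l] l(2) pos(4) by (simp add: excess_def)
  then have "torus_of l \<in> argmin_set G"
    using imbalance_min(2) by (simp add: argmin_set_def is_arg_min_linorder)
  moreover have "(\<Phi> \<longlongrightarrow> torus_of l) at_top"
  proof (rule iffD2[OF tendsto_dist_iff])
    have z: "((\<lambda>t. norm (\<phi> t - l)) \<longlongrightarrow> 0) at_top"
      by (rule tendsto_norm_zero[OF LIM_zero[OF l(1)]])
    have "\<forall>\<^sub>F t in at_top. norm (dist (\<Phi> t) (torus_of l)) \<le> norm (\<phi> t - l)"
    proof (rule eventually_at_top_linorderI)
      fix t :: real assume "t \<ge> 0"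
      then show "norm (dist (\<Phi> t) (torus_of l)) \<le> norm (\<phi> t - l)"
        using dist_torus_of_le[of "\<phi> t" l] by (simp add: \<Phi>)
    qed
    then show "((\<lambda>t. dist (\<Phi> t) (torus_of l)) \<longlongrightarrow> 0) at_top" using z by (rule Lim_null_comparison)
  qed
  ultimately show thesis using l(1) that by blast
qed

text \<open>The mass condition says norm (c_i) < 1 for both planes. Then inf G = 0, so the decay of
  the potential is a decay of G itself.\<close>

lemma trajectory_exponential:
  assumes lim: "(\<phi> \<longlongrightarrow> l) at_top"
    and heavy: "\<And>i. m $ i * r $ i > sqrt ((F $ i $ 1)\<^sup>2 + (F $ i $ 2)\<^sup>2) / (2 * \<omega>\<^sup>2)"
  shows "\<exists>C>0. \<exists>\<mu>>0. \<forall>t\<ge>0. dist (\<Phi> t) (torus_of l) + norm (velocity \<Phi> t) + \<bar>G (\<Phi> t)\<bar> \<le> C * exp (- \<mu> * t)"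
proof -
  have small: "norm (c $ i) < 1" for i
  proof -
    have K: "2 * m $ i * r $ i * \<omega>\<^sup>2 > 0" using pos(1)[of i] pos(2)[of i] pos(3) by simp
    have "norm (F $ i) = sqrt ((F $ i $ 1)\<^sup>2 + (F $ i $ 2)\<^sup>2)"
      by (simp add: norm_sq_vec2[symmetric])
    also have "\<dots> < 2 * m $ i * r $ i * \<omega>\<^sup>2"
      using heavy[of i] pos(3) by (simp add: field_simps)
    finally show ?thesis using K unfolding c by (simp add: field_simps)
  qed
  then obtain C \<mu> where C: "C > 0" "\<mu> > 0" "\<And>t. t \<ge> 0 \<Longrightarrow> u t \<le> C * exp (- \<mu> * t)"
    using exponential_decay by blast
  \<comment> \<open>The speed is the square root of twice the potential, which halves the rate; the
    distance inherits it by integration.\<close>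
  define \<nu> where "\<nu> = \<mu> / 2"
  have \<nu>: "\<nu> > 0" using C by (simp add: \<nu>_def)
  have speed: "norm (P t) \<le> sqrt (2 * C) * exp (- \<nu> * t)" if t: "t \<ge> 0" for t
  proof (rule power2_le_imp_le)
    have "(norm (P t))\<^sup>2 \<le> 2 * (C * exp (- \<mu> * t))" using norm_P[OF t] C(3)[OF t] by simp
    also have "\<dots> = (sqrt (2 * C) * exp (- \<nu> * t))\<^sup>2"
      using C(1) by (simp add: power_mult_distrib exp_double[symmetric] \<nu>_def)
    finally show "(norm (P t))\<^sup>2 \<le> (sqrt (2 * C) * exp (- \<nu> * t))\<^sup>2" .
  qed (use C in simp)
  have near: "dist (\<Phi> t) (torus_of l) \<le> sqrt (2 * C) / \<nu> * exp (- \<nu> * t)" if t: "t \<ge> 0" for t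
    using order_trans[OF dist_torus_of_le tendsto_exponential_rate[OF \<phi> speed \<nu> lim t]] \<Phi>[OF t] by simp
  have "Inf (range G) = 0"
    using small by (simp add: imbalance_min(1) residual_min_def less_imp_le)
  then have GE: "\<bar>G (\<Phi> t)\<bar> \<le> 2 / \<beta> * C * exp (- \<nu> * t)" if t: "t \<ge> 0" for t
  proof -
    assume "Inf (range G) = 0"
    then have "G (\<Phi> t) = 2 / \<beta> * u t" using trajectory_excess[OF t] by (simp add: excess_def)
    moreover have "0 \<le> 2 / \<beta> * u t" using pos(4) W_nonneg by simp
    ultimately have "\<bar>G (\<Phi> t)\<bar> = 2 / \<beta> * u t" by (simp only: abs_of_nonneg)
    also have "\<dots> \<le> 2 / \<beta> * (C * exp (- \<mu> * t))" using C(3)[OF t] pos(4) by (intro mult_left_mono) auto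
    also have "\<dots> \<le> 2 / \<beta> * (C * exp (- \<nu> * t))"
      using C pos(4) t by (intro mult_left_mono) (auto simp: \<nu>_def)
    finally show ?thesis by (simp add: mult.assoc)
  qed
  define D where "D = sqrt (2 * C) / \<nu> + sqrt (2 * C) + 2 / \<beta> * C"
  have "D > 0" using C \<nu> pos(4) by (simp add: D_def add_pos_pos)
  moreover have "dist (\<Phi> t) (torus_of l) + norm (velocity \<Phi> t) + \<bar>G (\<Phi> t)\<bar> \<le> D * exp (- \<nu> * t)" if t: "t \<ge> 0" for t
    using near[OF t] speed[OF t] GE[OF t]
    unfolding trajectory_velocity[OF t] D_def distrib_right by linarith
  ultimately show ?thesis using \<nu> by blast
qed

end

end

theorem proposition1:
  fixes a b Fx Fy Nx Ny \<omega> \<beta> :: real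
    and m r :: "real ^ 2"
    and F c :: "real ^ 2 ^ 2"
    and \<Phi>\<^sub>0 :: "angle ^ 4"
    and G :: "angle ^ 4 \<Rightarrow> real"
  assumes "a \<ge> 0" "b \<ge> 0" "a + b > 0"
    and "\<And>i. m $ i > 0" "\<And>i. r $ i > 0" "\<omega> > 0" "\<beta> > 0"
    and F: "F = plane_forces a b Fx Fy Nx Ny"
    and G: "G = imbalance_indicator m r \<omega> F"
    and c: "\<And>i. c $ i = (1 / (2 * m $ i * r $ i * \<omega>\<^sup>2)) *\<^sub>R F $ i"
  shows
    "(\<exists>\<Phi>. optimal \<beta> G \<Phi>\<^sub>0 \<Phi>) \<and>
     (\<forall>\<Phi>. optimal \<beta> G \<Phi>\<^sub>0 \<Phi> \<longrightarrow>
        smooth_curve \<Phi> \<and>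
        (\<forall>i. \<forall>t>0.
           - vector_derivative (velocity \<Phi>) (at t) $ \<alpha>_ix i =
             - \<beta> * (2 * m $ i * r $ i * \<omega>\<^sup>2)\<^sup>2 * cos_angle (\<Phi> t $ \<gamma>_ix i) *
             (- c $ i $ 1 * sin_angle (\<Phi> t $ \<alpha>_ix i) + c $ i $ 2 * cos_angle (\<Phi> t $ \<alpha>_ix i)) \<and>
           - vector_derivative (velocity \<Phi>) (at t) $ \<gamma>_ix i =
             \<beta> * (2 * m $ i * r $ i * \<omega>\<^sup>2)\<^sup>2 * sin_angle (\<Phi> t $ \<gamma>_ix i) *
             (c $ i $ 1 * cos_angle (\<Phi> t $ \<alpha>_ix i) + c $ i $ 2 * sin_angle (\<Phi> t $ \<alpha>_ix i)
              + cos_angle (\<Phi> t $ \<gamma>_ix i))) \<and>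
        (\<forall>i. \<Phi> 0 $ \<alpha>_ix i = \<Phi>\<^sub>0 $ \<alpha>_ix i \<and> \<Phi> 0 $ \<gamma>_ix i = \<Phi>\<^sub>0 $ \<gamma>_ix i) \<and>
        (velocity \<Phi> \<longlongrightarrow> 0) at_top) \<and>
     (\<forall>\<Phi>. optimal \<beta> G \<Phi>\<^sub>0 \<Phi> \<longrightarrow>
        (\<exists>\<Psi> \<in> argmin_set G.
           (\<Phi> \<longlongrightarrow> \<Psi>) at_top \<and>
           (velocity \<Phi> \<longlongrightarrow> 0) at_top \<and>
           ((\<lambda>t. \<bar>excess G (\<Phi> t)\<bar>) \<longlongrightarrow> 0) at_top \<and>
           (m $ 1 * r $ 1 > sqrt ((F $ 1 $ 1)\<^sup>2 + (F $ 1 $ 2)\<^sup>2) / (2 * \<omega>\<^sup>2) \<and>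
            m $ 2 * r $ 2 > sqrt ((F $ 2 $ 1)\<^sup>2 + (F $ 2 $ 2)\<^sup>2) / (2 * \<omega>\<^sup>2) \<longrightarrow>
            (\<exists>C>0. \<exists>\<mu>>0. \<forall>t\<ge>0.
               dist (\<Phi> t) \<Psi> + norm (velocity \<Phi> t) + \<bar>G (\<Phi> t)\<bar> \<le> C * exp (- \<mu> * t)))))"
proof (intro conjI allI impI)
  note setting = assms(4-7) G c
  show "\<exists>\<Phi>. optimal \<beta> G \<Phi>\<^sub>0 \<Phi>" by (rule imbalance_optimal_exists[OF setting])
  fix \<Phi> assume opt: "optimal \<beta> G \<Phi>\<^sub>0 \<Phi>"
  obtain L z \<phi> P A where bal: "balancing (stiffness m r \<omega> \<beta>) c L z \<phi> P A"
    and lift: "\<And>t. t \<ge> 0 \<Longrightarrow> torus_of (\<phi> t) = \<Phi> t"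
    using optimal_dynamics[OF setting opt] by blast
  note facts = setting bal lift
  show "smooth_curve \<Phi>" by (rule trajectory_smooth[OF facts])
  show "(velocity \<Phi> \<longlongrightarrow> 0) at_top" by (rule trajectory_velocity_tendsto[OF facts])
  have "\<Phi> 0 = \<Phi>\<^sub>0"
    using opt by (simp add: optimal_def is_arg_min_def admissible_def)
  then show "\<Phi> 0 $ \<alpha>_ix i = \<Phi>\<^sub>0 $ \<alpha>_ix i" "\<Phi> 0 $ \<gamma>_ix i = \<Phi>\<^sub>0 $ \<gamma>_ix i" for i by simp_all
  show "- vector_derivative (velocity \<Phi>) (at t) $ \<alpha>_ix i =
      - \<beta> * (2 * m $ i * r $ i * \<omega>\<^sup>2)\<^sup>2 * cos_angle (\<Phi> t $ \<gamma>_ix i) *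
      (- c $ i $ 1 * sin_angle (\<Phi> t $ \<alpha>_ix i) + c $ i $ 2 * cos_angle (\<Phi> t $ \<alpha>_ix i))"
    if "t > 0" for i t
    by (rule trajectory_euler_lagrange(1)[OF facts that])
  show "- vector_derivative (velocity \<Phi>) (at t) $ \<gamma>_ix i =
      \<beta> * (2 * m $ i * r $ i * \<omega>\<^sup>2)\<^sup>2 * sin_angle (\<Phi> t $ \<gamma>_ix i) *
      (c $ i $ 1 * cos_angle (\<Phi> t $ \<alpha>_ix i) + c $ i $ 2 * sin_angle (\<Phi> t $ \<alpha>_ix i)
       + cos_angle (\<Phi> t $ \<gamma>_ix i))" if "t > 0" for i t
    by (rule trajectory_euler_lagrange(2)[OF facts that])
  obtain l where l: "torus_of l \<in> argmin_set G" "(\<phi> \<longlongrightarrow> l) at_top" "(\<Phi> \<longlongrightarrow> torus_of l) at_top"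
    by (rule trajectory_converges[OF facts])
  show "\<exists>\<Psi> \<in> argmin_set G.
           (\<Phi> \<longlongrightarrow> \<Psi>) at_top \<and>
           (velocity \<Phi> \<longlongrightarrow> 0) at_top \<and>
           ((\<lambda>t. \<bar>excess G (\<Phi> t)\<bar>) \<longlongrightarrow> 0) at_top \<and>
           (m $ 1 * r $ 1 > sqrt ((F $ 1 $ 1)\<^sup>2 + (F $ 1 $ 2)\<^sup>2) / (2 * \<omega>\<^sup>2) \<and>
            m $ 2 * r $ 2 > sqrt ((F $ 2 $ 1)\<^sup>2 + (F $ 2 $ 2)\<^sup>2) / (2 * \<omega>\<^sup>2) \<longrightarrow>
            (\<exists>C>0. \<exists>\<mu>>0. \<forall>t\<ge>0.
               dist (\<Phi> t) \<Psi> + norm (velocity \<Phi> t) + \<bar>G (\<Phi> t)\<bar> \<le> C * exp (- \<mu> * t)))"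
  proof (intro bexI[OF _ l(1)] conjI l(3) trajectory_velocity_tendsto[OF facts]
      trajectory_excess_tendsto[OF facts] impI)
    assume heavy: "m $ 1 * r $ 1 > sqrt ((F $ 1 $ 1)\<^sup>2 + (F $ 1 $ 2)\<^sup>2) / (2 * \<omega>\<^sup>2) \<and>
            m $ 2 * r $ 2 > sqrt ((F $ 2 $ 1)\<^sup>2 + (F $ 2 $ 2)\<^sup>2) / (2 * \<omega>\<^sup>2)"
    have heavy': "m $ i * r $ i > sqrt ((F $ i $ 1)\<^sup>2 + (F $ i $ 2)\<^sup>2) / (2 * \<omega>\<^sup>2)" for i
      using heavy exhaust_2[of i] by auto
    show "\<exists>C>0. \<exists>\<mu>>0. \<forall>t\<ge>0.
        dist (\<Phi> t) (torus_of l) + norm (velocity \<Phi> t) + \<bar>G (\<Phi> t)\<bar> \<le> C * exp (- \<mu> * t)"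
      by (rule trajectory_exponential[OF facts l(2) heavy'])
  qed
qed

end
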